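(* a) Let $p,n\in\mathbb{N}^*$. Then $\mathcal{F}_{n,p}$ is empty if $p>\left[\frac{n}{2}\right]+1$. b) Let $\varepsilon\in\{0,1\}$ and $t\in\mathbb{N}$. There exists a polynomial $P_{\varepsilon,t}\in\mathbb{Q}[T]$ of degree $\left[\frac{t}{2}\right]$ and with positive dominant (leading) coefficient such that $$\sharp\mathcal{F}_{2n+\varepsilon,\,n+1-t}=P_{\varepsilon,t}(n)$$ for all sufficiently large $n$.
   Context: $\Bbbk$ is an algebraically closed field of characteristic zero; $\mathbb{N}=\{0,1,2,\dots\}$, $\mathbb{N}^*=\mathbb{N}\setminus\{0\}$; $[x]$ is the integer part of $x$; $\sharp$ denotes cardinality. For $n\in\mathbb{N}^*$, $\mathcal{C}_n$ is the set of compositions of $n$ (finite sequences $\mathbf{a}=(a_1,\dots,a_r)$, $r\ge1$, of positive integers with sum $n$), and $p(\mathbf{a})=r$ is the number of parts. For $\mathbf{a}\in\mathcal{C}_n$, $\mathfrak{p}_{\mathbf{a}}$ is the standard parabolic subalgebra of $\mathrm{sl}_n(\Bbbk)$ consisting of trace-zero block upper triangular matrices with diagonal block sizes $a_1,\dots,a_r$. The index of a Lie algebra $\mathfrak{g}$ is $\mathrm{ind}(\mathfrak{g})=\min_{f\in\mathfrak{g}^*}\dim\{x\in\mathfrak{g}: f([x,y])=0\ \forall y\in\mathfrak{g}\}$. Let $\mathcal{F}_n=\{\mathbf{a}\in\mathcal{C}_n : \mathrm{ind}(\mathfrak{p}_{\mathbf{a}})=0\}$ (compositions giving Frobenius standard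 parabolic subalgebras) and $\mathcal{F}_{n,p}=\{\mathbf{a}\in\mathcal{F}_n : p(\mathbf{a})=p\}$. *)

theory Defs
  imports
    "HOL-Computational_Algebra.Computational_Algebra"
    "Jordan_Normal_Form.VS_Connect"
begin

text \<open>
  Lie algebras over the field \<open>'k\<close> are given by a vector space \<open>V\<close> over \<open>class_ring\<close> (the type
  \<open>'k\<close> seen as a field record) together with a bracket \<open>br\<close> on its carrier.
  Linear functionals are only constrained on the carrier; the values outside are irrelevant.
\<close>

definition dual_space :: "('k :: field, 'v) module \<Rightarrow> ('v \<Rightarrow> 'k) set" where
  "dual_space V = {f.
     (\<forall>x \<in> carrier V. \<forall>y \<in> carrier V. f (x \<oplus>\<^bsub>V\<^esub> y) = f x + f y) \<and>
     (\<forall>c. \<forall>x \<in> carrier V. f (c \<odot>\<^bsub>V\<^esub> x) = c * f x)}"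

definition lie_stabilizer ::
    "('k :: field, 'v) module \<Rightarrow> ('v \<Rightarrow> 'v \<Rightarrow> 'v) \<Rightarrow> ('v \<Rightarrow> 'k) \<Rightarrow> 'v set" where
  "lie_stabilizer V br f = {x \<in> carrier V. \<forall>y \<in> carrier V. f (br x y) = 0}"

definition lie_index :: "('k :: field, 'v) module \<Rightarrow> ('v \<Rightarrow> 'v \<Rightarrow> 'v) \<Rightarrow> nat" where
  "lie_index V br = (LEAST d. \<exists>f \<in> dual_space V.
     d = vectorspace.dim class_ring (V\<lparr>carrier := lie_stabilizer V br f\<rparr>))"

definition compositions :: "nat \<Rightarrow> nat list set" where
  "compositions n = {a. a \<noteq> [] \<and> (\<forall>x \<in> set a. 0 < x) \<and> sum_list a = n}"

definition commutator_mat :: "'k :: field mat \<Rightarrow> 'k mat \<Rightarrow> 'k mat" where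
  "commutator_mat A B = A * B - B * A"

definition trace_mat :: "'k :: field mat \<Rightarrow> 'k" where
  "trace_mat A = (\<Sum>i < dim_row A. A $$ (i, i))"

text \<open>
  Indices start at 0, so the block boundaries of \<open>a\<close> are the partial sums
  \<open>sum_list (take s a)\<close>, and the position \<open>(i, j)\<close> lies strictly below the diagonal blocks iff
  some boundary separates the column \<open>j\<close> from the row \<open>i\<close>.
\<close>

definition block_upper_triangular :: "nat list \<Rightarrow> 'k :: field mat \<Rightarrow> bool" where
  "block_upper_triangular a A \<longleftrightarrow>
     (\<forall>i < dim_row A. \<forall>j < dim_col A.
        (\<exists>s \<le> length a. j < sum_list (take s a) \<and> sum_list (take s a) \<le> i) \<longrightarrow> A $$ (i, j) = 0)"

definition parabolic :: "'k :: field itself \<Rightarrow> nat list \<Rightarrow> ('k, 'k mat) module" where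
  "parabolic K a = (module_mat K (sum_list a) (sum_list a))
     \<lparr>carrier := {A \<in> carrier_mat (sum_list a) (sum_list a).
        trace_mat A = 0 \<and> block_upper_triangular a A}\<rparr>"

definition frobenius_compositions :: "'k :: field itself \<Rightarrow> nat \<Rightarrow> nat list set" where
  "frobenius_compositions K n =
     {a \<in> compositions n. lie_index (parabolic K a) commutator_mat = 0}"

definition frobenius_compositions_parts :: "'k :: field itself \<Rightarrow> nat \<Rightarrow> nat \<Rightarrow> nat list set" where
  "frobenius_compositions_parts K n p = {a \<in> frobenius_compositions K n. length a = p}"

end

theory Submission
  imports Defs "Jordan_Normal_Form.Missing_VectorSpace"
begin

text \<open>
  The trace form turns a functional on the block upper triangular matrices into a matrix \<open>F\<close>,
  acting as \<open>A \<mapsto> tr (F A)\<close>, and \<open>x\<close> stabilises it iff the commutator of \<open>F\<close> and \<open>x\<close>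
  vanishes at every position transposed to one of the pattern. In characteristic zero the
  traceless matrices are a complement of the scalars, so the index of \<open>parabolic K a\<close> is zero iff
  some \<open>F\<close> is rigid: only scalar matrices of the pattern stabilise it
  (\<open>lie_index_eq_0_iff_rigid\<close>).

  Rigidity makes sense for the pattern of any pair \<open>(a | b)\<close> of compositions of \<open>n\<close>, the matrices
  that are upper triangular for the blocks of \<open>a\<close> and lower triangular for those of \<open>b\<close>; parabolic
  subalgebras are the case \<open>b = [n]\<close>. Let \<open>d < e\<close> be the first parts. The block of \<open>F\<close> that pairs
  the first \<open>d\<close> coordinates with the other \<open>e - d\<close> coordinates of the first block of \<open>b\<close> is
  unconstrained. It has full rank for generic \<open>F\<close>, and conjugation inside the pattern turns it
  into a matching of coordinates. The stabiliser equations then identify matched coordinates, and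
  what is left is the stabiliser of a functional for a smaller pair (\<open>rigid_reduction\<close>,
  \<open>rigid_short\<close>, \<open>rigid_long\<close>). If \<open>d = e\<close>, the first block splits off, and nothing is rigid
  except in size one.

  The meander graph of \<open>(a | b)\<close> has vertices \<open>0, \<dots>, n - 1\<close> and joins every vertex to its
  mirror image in its block of \<open>a\<close> and in its block of \<open>b\<close>. It follows the same recursion,
  contracting the arcs of the matched coordinates. Hence rigidity means that the graph is
  connected and not a cycle, that is, a path (\<open>rigid_iff_meander_path\<close>). The two ends of a path
  are the centres of odd blocks, so exactly two of the parts of \<open>a\<close> and \<open>b\<close> are odd. For \<open>b = [n]\<close>
  this says \<open>length a + excess a = n div 2 + 1\<close>, where \<open>excess a\<close> is the sum of \<open>(x - 1) div 2\<close>
  over the parts \<open>x\<close>. The bound on the number of parts follows, and the compositions of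
  \<open>2 * n + \<epsilon>\<close> with \<open>n + 1 - t\<close> parts that are to be counted are those of excess \<open>t\<close> whose
  meander is a path.

  When \<open>t\<close> is small against \<open>n\<close>, nearly all parts are 2. Two parts 2 opposite each other under
  \<open>i \<mapsto> n - 1 - i\<close> form a closed cycle if they are aligned, and otherwise one of their arcs
  is a bridge of the graph: \<open>a\<close> is \<open>L @ M @ 2 # R\<close>, up to reversal, with
  \<open>sum_list L = sum_list R + 1\<close>, and it is a path iff both \<open>L @ 1 # R\<close> and \<open>M @ [1]\<close> are paths
  (\<open>path_comp_cut\<close>). A path without such a cut has size at most \<open>8 * t + 4\<close> (\<open>irreducible_bound\<close>).
  Cutting every large path at its outermost cut expresses the counts through the numbers
  \<open>core_count N t\<close> of paths ending in 1, with finitely many outer factors \<open>L @ 1 # R\<close> that do not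
  depend on \<open>N\<close>. The outer factor \<open>[1, 1]\<close> contributes \<open>core_count (N - 2) t\<close>, and all other ones
  that can occur for a path ending in 1 have excess at least 2 (\<open>core_count_rec\<close>). So \<open>core_count\<close>
  has a backward difference that is, by induction on \<open>t\<close>, eventually polynomial of degree
  \<open>(t - 2) div 2\<close> with positive leading coefficient, and its own degree is \<open>t div 2\<close>; for \<open>t < 2\<close>
  the difference vanishes and the count is eventually constant.
\<close>

section \<open>Matrices on an index set and rigid functionals\<close>

definition mmul :: "'i set \<Rightarrow> ('i \<Rightarrow> 'i \<Rightarrow> 'k::field) \<Rightarrow> ('i \<Rightarrow> 'i \<Rightarrow> 'k) \<Rightarrow> 'i \<Rightarrow> 'i \<Rightarrow> 'k" where
  "mmul I A B = (\<lambda>i j. \<Sum>k\<in>I. A i k * B k j)"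

definition supported :: "'i set \<Rightarrow> ('i \<Rightarrow> 'i \<Rightarrow> bool) \<Rightarrow> ('i \<Rightarrow> 'i \<Rightarrow> 'k::field) \<Rightarrow> bool" where
  "supported I S x \<longleftrightarrow> (\<forall>i j. x i j \<noteq> 0 \<longrightarrow> i \<in> I \<and> j \<in> I \<and> S i j)"

text \<open>
  With \<open>tr (F [x, y]) = tr ([F, x] y)\<close> for \<open>y\<close> ranging over the matrices of the pattern \<open>S\<close>, the
  stabiliser of the functional \<open>F\<close> consists of the \<open>x\<close> for which \<open>[F, x]\<close> vanishes at the
  transposed positions, whence the condition \<open>S j i\<close>.
\<close>

definition stab :: "'i set \<Rightarrow> ('i \<Rightarrow> 'i \<Rightarrow> bool) \<Rightarrow> ('i \<Rightarrow> 'i \<Rightarrow> 'k::field) \<Rightarrow> ('i \<Rightarrow> 'i \<Rightarrow> 'k) set" where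
  "stab I S F = {x. supported I S x \<and>
     (\<forall>i\<in>I. \<forall>j\<in>I. S j i \<longrightarrow> mmul I F x i j = mmul I x F i j)}"

definition scalar_on :: "'i set \<Rightarrow> ('i \<Rightarrow> 'i \<Rightarrow> 'k::field) \<Rightarrow> bool" where
  "scalar_on I x \<longleftrightarrow> (\<exists>c. \<forall>i\<in>I. \<forall>j\<in>I. x i j = (if i = j then c else 0))"

text \<open>
  Scalar matrices stabilise every functional; a rigid functional has the smallest possible
  stabiliser.
\<close>

definition rigid_by :: "'i set \<Rightarrow> ('i \<Rightarrow> 'i \<Rightarrow> bool) \<Rightarrow> ('i \<Rightarrow> 'i \<Rightarrow> 'k::field) \<Rightarrow> bool" where
  "rigid_by I S F \<longleftrightarrow> (\<forall>x\<in>stab I S F. scalar_on I x)"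

lemma mmul_assoc: "mmul I (mmul I A B) C = mmul I A (mmul I B C)"
proof (intro ext)
  fix i j
  show "mmul I (mmul I A B) C i j = mmul I A (mmul I B C) i j"
    unfolding mmul_def sum_distrib_left sum_distrib_right
    by (subst sum.swap) (simp add: mult.assoc)
qed

lemma mmul_id:
  assumes "finite I" "\<And>i j. i \<in> I \<Longrightarrow> j \<in> I \<Longrightarrow> E i j = (if i = j then 1 else 0)"
  shows "i \<in> I \<Longrightarrow> mmul I E A i j = A i j" "j \<in> I \<Longrightarrow> mmul I A E i j = A i j"
proof -
  assume "i \<in> I"
  then have "mmul I E A i j = (\<Sum>k\<in>I. if k = i then A i j else 0)"
    unfolding mmul_def by (intro sum.cong) (auto simp: assms(2))
  then show "mmul I E A i j = A i j" using \<open>i \<in> I\<close> assms(1) by simp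
next
  assume "j \<in> I"
  then have "mmul I A E i j = (\<Sum>k\<in>I. if k = j then A i j else 0)"
    unfolding mmul_def by (intro sum.cong) (auto simp: assms(2))
  then show "mmul I A E i j = A i j" using \<open>j \<in> I\<close> assms(1) by simp
qed

lemma mmul_cong:
  assumes "\<And>k. k \<in> I \<Longrightarrow> A i k = A' i k" "\<And>k. k \<in> I \<Longrightarrow> B k j = B' k j"
  shows "mmul I A B i j = mmul I A' B' i j"
  unfolding mmul_def using assms by (intro sum.cong) auto

text \<open>
  If \<open>x\<close> stabilises \<open>g F h\<close> then \<open>h x g\<close> stabilises \<open>F\<close>: transitivity of \<open>S\<close> keeps products of
  matrices of the pattern inside the pattern, and dually the entries of \<open>[F, h x g]\<close> at transposed
  positions only involve entries of \<open>[g F h, x]\<close> at transposed positions.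
\<close>

lemma rigid_conj:
  assumes fin: "finite I"
    and trans: "\<And>i j k. \<lbrakk>i \<in> I; j \<in> I; k \<in> I; S i j; S j k\<rbrakk> \<Longrightarrow> S i k"
    and g: "supported I S g" and h: "supported I S h"
    and gh: "\<And>i j. \<lbrakk>i \<in> I; j \<in> I\<rbrakk> \<Longrightarrow> mmul I g h i j = (if i = j then 1 else 0)"
    and hg: "\<And>i j. \<lbrakk>i \<in> I; j \<in> I\<rbrakk> \<Longrightarrow> mmul I h g i j = (if i = j then 1 else 0)"
    and rig: "rigid_by I S F"
  shows "rigid_by I S (mmul I g (mmul I F h))"
  unfolding rigid_by_def
proof
  let ?F' = "mmul I g (mmul I F h)"
  fix x assume x: "x \<in> stab I S ?F'"
  then have sx: "supported I S x"
    and comm: "\<And>i j. \<lbrakk>i \<in> I; j \<in> I; S j i\<rbrakk> \<Longrightarrow> mmul I ?F' x i j = mmul I x ?F' i j"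
    by (auto simp: stab_def)
  let ?y = "mmul I h (mmul I x g)"
  have nz: "\<exists>k l. h i k \<noteq> 0 \<and> A k l \<noteq> 0 \<and> g l j \<noteq> 0 \<and> k \<in> I \<and> l \<in> I"
    if nonzero: "mmul I h (mmul I A g) i j \<noteq> 0" for A i j
  proof -
    obtain k where k: "k \<in> I" "h i k * mmul I A g k j \<noteq> 0"
      using nonzero unfolding mmul_def[of I h] by (rule sum.not_neutral_contains_not_neutral)
    then have "(\<Sum>l\<in>I. A k l * g l j) \<noteq> 0" by (auto simp: mmul_def)
    then obtain l where "l \<in> I" "A k l * g l j \<noteq> 0"
      by (rule sum.not_neutral_contains_not_neutral)
    then show ?thesis using k by auto
  qed
  have sy: "supported I S ?y"
    unfolding supported_def
  proof (intro allI impI)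
    fix i j assume "?y i j \<noteq> 0"
    then obtain k l where "h i k \<noteq> 0" "x k l \<noteq> 0" "g l j \<noteq> 0" "k \<in> I" "l \<in> I"
      using nz by blast
    moreover from this have "S i k" "S k l" "S l j" "i \<in> I" "j \<in> I"
      using g h sx unfolding supported_def by blast+
    ultimately show "i \<in> I \<and> j \<in> I \<and> S i j"
      using trans by blast
  qed
  have com: "mmul I F ?y i j = mmul I ?y F i j" if ij: "i \<in> I" "j \<in> I" "S j i" for i j
  proof -
    let ?D = "\<lambda>k l. mmul I ?F' x k l - mmul I x ?F' k l"
    have "mmul I h (mmul I ?D g) i j = 0"
    proof (rule ccontr)
      assume "mmul I h (mmul I ?D g) i j \<noteq> 0"
      then obtain k l where kl: "h i k \<noteq> 0" "?D k l \<noteq> 0" "g l j \<noteq> 0" "k \<in> I" "l \<in> I"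
        using nz by blast
      then have "S i k" "S l j" using g h by (auto simp: supported_def)
      then have "S l k" using ij kl trans by blast
      then show False using comm kl by simp
    qed
    moreover have "mmul I h (mmul I ?D g) i j =
        mmul I h (mmul I (mmul I ?F' x) g) i j - mmul I h (mmul I (mmul I x ?F') g) i j"
      unfolding mmul_def[of I h] mmul_def[of I _ g]
      by (simp add: sum_subtractf algebra_simps sum_distrib_left)
    moreover have "mmul I h (mmul I (mmul I ?F' x) g) = mmul I (mmul I h g) (mmul I F ?y)"
      by (simp add: mmul_assoc)
    moreover have "mmul I h (mmul I (mmul I x ?F') g) = mmul I (mmul I ?y F) (mmul I h g)"
      by (simp add: mmul_assoc)
    ultimately show ?thesis using mmul_id[OF fin hg] ij by simp
  qed
  have "?y \<in> stab I S F" using sy com by (auto simp: stab_def)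
  then obtain c where c: "\<And>i j. \<lbrakk>i \<in> I; j \<in> I\<rbrakk> \<Longrightarrow> ?y i j = (if i = j then c else 0)"
    using rig unfolding rigid_by_def scalar_on_def by blast
  have "x i j = (if i = j then c else 0)" if ij: "i \<in> I" "j \<in> I" for i j
  proof -
    have "x i j = mmul I (mmul I g h) (mmul I x (mmul I g h)) i j"
      using mmul_id[OF fin gh] ij by simp
    also have "\<dots> = mmul I g (mmul I ?y h) i j" by (simp add: mmul_assoc)
    also have "\<dots> = mmul I g (\<lambda>k l. c * h k l) i j"
    proof (rule mmul_cong)
      fix k assume "k \<in> I"
      have "mmul I ?y h k j = (\<Sum>l\<in>I. if l = k then c * h k j else 0)"
        unfolding mmul_def[of I ?y] using c \<open>k \<in> I\<close> by (intro sum.cong) auto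
      then show "mmul I ?y h k j = c * h k j" using fin \<open>k \<in> I\<close> by simp
    qed simp
    also have "\<dots> = c * mmul I g h i j"
      unfolding mmul_def by (simp add: sum_distrib_left mult.left_commute)
    finally show ?thesis using gh ij by simp
  qed
  then show "scalar_on I x" unfolding scalar_on_def by blast
qed

text \<open>
  Gaussian elimination over the polynomial ring. A coefficient that does not vanish at \<open>z\<close> can
  serve as pivot for all but finitely many \<open>s\<close>, and cross-multiplying instead of dividing keeps
  the remaining coefficients polynomial.
\<close>

lemma kernel_generic:
  fixes c :: "'e \<Rightarrow> 'q \<Rightarrow> 'k::field poly"
  assumes "finite Q"
    and "\<And>v. (\<forall>e\<in>E. (\<Sum>q\<in>Q. poly (c e q) z * v q) = 0) \<Longrightarrow> \<forall>q\<in>Q. v q = 0"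
  shows "finite {s. \<exists>v. (\<forall>e\<in>E. (\<Sum>q\<in>Q. poly (c e q) s * v q) = 0) \<and> (\<exists>q\<in>Q. v q \<noteq> 0)}"
  using assms
proof (induction Q arbitrary: c rule: finite_induct)
  case empty
  then show ?case by simp
next
  case (insert q0 Q)
  have "\<exists>e\<in>E. poly (c e q0) z \<noteq> 0"
  proof (rule ccontr)
    assume "\<not> ?thesis"
    then have "\<forall>e\<in>E. (\<Sum>q\<in>insert q0 Q. poly (c e q) z * (if q = q0 then 1 else 0)) = 0"
      using insert.hyps by (auto intro!: sum.neutral)
    from insert.prems[OF this] show False by simp
  qed
  then obtain e0 where e0: "e0 \<in> E" "poly (c e0 q0) z \<noteq> 0" by blast
  define d where "d e q = c e0 q0 * c e q - c e q0 * c e0 q" for e q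
  have dsum: "(\<Sum>q\<in>Q. poly (d e q) s * v q) =
      poly (c e0 q0) s * (\<Sum>q\<in>Q. poly (c e q) s * v q) -
      poly (c e q0) s * (\<Sum>q\<in>Q. poly (c e0 q) s * v q)" for e s v
    by (simp add: d_def algebra_simps sum_subtractf sum_distrib_left)
  have ker: "\<forall>q\<in>Q. v q = 0" if v: "\<forall>e\<in>E. (\<Sum>q\<in>Q. poly (d e q) z * v q) = 0" for v
  proof -
    define w where "w = v(q0 := - (\<Sum>q\<in>Q. poly (c e0 q) z * v q) / poly (c e0 q0) z)"
    have wQ: "(\<Sum>q\<in>Q. poly (c e q) z * w q) = (\<Sum>q\<in>Q. poly (c e q) z * v q)" for e
      using insert.hyps by (intro sum.cong) (auto simp: w_def)
    have "\<forall>e\<in>E. (\<Sum>q\<in>insert q0 Q. poly (c e q) z * w q) = 0"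
    proof
      fix e assume "e \<in> E"
      then have "(\<Sum>q\<in>Q. poly (d e q) z * v q) = 0" using v by blast
      then show "(\<Sum>q\<in>insert q0 Q. poly (c e q) z * w q) = 0"
        using insert.hyps e0 by (simp add: wQ dsum) (simp add: w_def field_simps)
    qed
    from insert.prems[OF this] have "\<forall>q\<in>Q. w q = 0" by simp
    then show ?thesis using insert.hyps by (auto simp: w_def split: if_splits)
  qed
  have "finite {s. poly (c e0 q0) s = 0}"
    using e0 by (intro poly_roots_finite) auto
  moreover have "{s. \<exists>v. (\<forall>e\<in>E. (\<Sum>q\<in>insert q0 Q. poly (c e q) s * v q) = 0) \<and> (\<exists>q\<in>insert q0 Q. v q \<noteq> 0)}
     \<subseteq> {s. poly (c e0 q0) s = 0} \<union>
       {s. \<exists>v. (\<forall>e\<in>E. (\<Sum>q\<in>Q. poly (d e q) s * v q) = 0) \<and> (\<exists>q\<in>Q. v q \<noteq> 0)}" (is "?A \<subseteq> ?B \<union> ?C")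
  proof
    fix s assume "s \<in> ?A"
    then obtain v where v: "\<And>e. e\<in>E \<Longrightarrow> poly (c e q0) s * v q0 + (\<Sum>q\<in>Q. poly (c e q) s * v q) = 0"
      "\<exists>q\<in>insert q0 Q. v q \<noteq> 0" using insert.hyps by auto
    show "s \<in> ?B \<union> ?C"
    proof (cases "poly (c e0 q0) s = 0")
      case False
      have "(\<Sum>q\<in>Q. poly (d e q) s * v q) = 0" if "e \<in> E" for e
      proof -
        have 1: "(\<Sum>q\<in>Q. poly (c e q) s * v q) = - (poly (c e q0) s * v q0)"
          using v(1)[OF that] by (simp add: add_eq_0_iff)
        have 2: "(\<Sum>q\<in>Q. poly (c e0 q) s * v q) = - (poly (c e0 q0) s * v q0)"
          using v(1)[OF e0(1)] by (simp add: add_eq_0_iff)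
        show ?thesis unfolding dsum 1 2 by simp
      qed
      moreover have "\<exists>q\<in>Q. v q \<noteq> 0"
      proof (rule ccontr)
        assume a: "\<not> ?thesis"
        then have "poly (c e0 q0) s * v q0 = 0" using v(1)[OF e0(1)] by simp
        then show False using v(2) a False by auto
      qed
      ultimately show ?thesis by blast
    qed simp
  qed
  ultimately show ?case using insert.IH[OF ker] by (meson finite_UnI finite_subset)
qed

text \<open>
  An injective square system is surjective. Equations and unknowns are arbitrary finite sets, so
  that the elimination step can drop one of each without renumbering.
\<close>

lemma square_solvable:
  fixes c :: "'e \<Rightarrow> 'q \<Rightarrow> 'k::field"
  assumes "finite Q" "finite E" "card E = card Q"
    and "\<And>v. (\<forall>e\<in>E. (\<Sum>q\<in>Q. c e q * v q) = 0) \<Longrightarrow> \<forall>q\<in>Q. v q = 0"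
  shows "\<exists>v. \<forall>e\<in>E. (\<Sum>q\<in>Q. c e q * v q) = w e"
  using assms
proof (induction Q arbitrary: c E w rule: finite_induct)
  case empty
  then show ?case by simp
next
  case (insert q0 Q)
  have "\<exists>e\<in>E. c e q0 \<noteq> 0"
  proof (rule ccontr)
    assume "\<not> ?thesis"
    then have "\<forall>e\<in>E. (\<Sum>q\<in>insert q0 Q. c e q * (if q = q0 then 1 else 0)) = 0"
      using insert.hyps by (auto intro!: sum.neutral)
    from insert.prems(3)[OF this] show False by simp
  qed
  then obtain e0 where e0: "e0 \<in> E" "c e0 q0 \<noteq> 0" by blast
  define d where "d e q = c e q - c e q0 / c e0 q0 * c e0 q" for e q
  have dsum: "(\<Sum>q\<in>Q. d e q * v q) =
      (\<Sum>q\<in>Q. c e q * v q) - c e q0 / c e0 q0 * (\<Sum>q\<in>Q. c e0 q * v q)" for e v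
    by (simp add: d_def left_diff_distrib sum_subtractf sum_distrib_left mult.assoc)
  have ext: "(\<Sum>q\<in>insert q0 Q. c e q * (v(q0 := (u - (\<Sum>q\<in>Q. c e0 q * v q)) / c e0 q0)) q) =
       c e q0 / c e0 q0 * u + (\<Sum>q\<in>Q. d e q * v q)" for e u v
  proof -
    have "(\<Sum>q\<in>Q. c e q * (v(q0 := (u - (\<Sum>q\<in>Q. c e0 q * v q)) / c e0 q0)) q) = (\<Sum>q\<in>Q. c e q * v q)"
      using insert.hyps by (intro sum.cong) auto
    then show ?thesis using insert.hyps e0 by (simp add: dsum) (simp add: field_simps)
  qed
  have d0: "d e0 q = 0" for q using e0 by (simp add: d_def)
  have ker: "\<forall>q\<in>Q. v q = 0" if v: "\<forall>e\<in>E - {e0}. (\<Sum>q\<in>Q. d e q * v q) = 0" for v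
  proof -
    have "(\<Sum>q\<in>Q. d e q * v q) = 0" if "e \<in> E" for e
      using v d0 that by (cases "e = e0") auto
    then have "\<forall>e\<in>E. (\<Sum>q\<in>insert q0 Q. c e q * (v(q0 := (0 - (\<Sum>q\<in>Q. c e0 q * v q)) / c e0 q0)) q) = 0"
      using ext[of _ v 0] by simp
    from insert.prems(3)[OF this] show ?thesis using insert.hyps by (auto split: if_splits)
  qed
  have "card (E - {e0}) = card Q" using insert.prems insert.hyps e0 by simp
  from insert.IH[OF _ this ker, where w = "\<lambda>e. w e - c e q0 / c e0 q0 * w e0"] insert.prems(1)
  obtain v where v: "\<forall>e\<in>E - {e0}. (\<Sum>q\<in>Q. d e q * v q) = w e - c e q0 / c e0 q0 * w e0" by auto
  have "\<forall>e\<in>E. (\<Sum>q\<in>insert q0 Q. c e q * (v(q0 := (w e0 - (\<Sum>q\<in>Q. c e0 q * v q)) / c e0 q0)) q) = w e"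
  proof
    fix e assume "e \<in> E"
    then show "(\<Sum>q\<in>insert q0 Q. c e q * (v(q0 := (w e0 - (\<Sum>q\<in>Q. c e0 q * v q)) / c e0 q0)) q) = w e"
      unfolding ext using v d0 e0 by (cases "e = e0") auto
  qed
  then show ?case by blast
qed

text \<open>
  The columns of \<open>B\<close> solve \<open>M v = e\<close>, with \<open>e\<close> a unit vector. This right inverse is also a left
  inverse, because \<open>M (B M - 1) = 0\<close> and \<open>M\<close> is injective.
\<close>

lemma square_inverse:
  fixes M :: "'i \<Rightarrow> 'i \<Rightarrow> 'k::field"
  assumes X: "finite X"
    and ker: "\<And>v. (\<forall>i\<in>X. (\<Sum>j\<in>X. M i j * v j) = 0) \<Longrightarrow> \<forall>j\<in>X. v j = 0"
  obtains B where "\<And>i j. \<lbrakk>i \<in> X; j \<in> X\<rbrakk> \<Longrightarrow> mmul X M B i j = (if i = j then 1 else 0)"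
    "\<And>i j. \<lbrakk>i \<in> X; j \<in> X\<rbrakk> \<Longrightarrow> mmul X B M i j = (if i = j then 1 else 0)"
proof -
  have "\<forall>j. \<exists>v. \<forall>i\<in>X. (\<Sum>k\<in>X. M i k * v k) = (if i = j then 1 else 0)"
  proof
    fix j
    show "\<exists>v. \<forall>i\<in>X. (\<Sum>k\<in>X. M i k * v k) = (if i = j then 1 else 0)"
      by (rule square_solvable[OF X X refl]) (rule ker)
  qed
  then obtain C where C: "\<And>j i. i \<in> X \<Longrightarrow> (\<Sum>k\<in>X. M i k * C j k) = (if i = j then 1 else 0)"
    by metis
  define B where "B k j = C j k" for k j
  have MB: "mmul X M B i j = (if i = j then 1 else 0)" if "i \<in> X" for i j
    using C[OF that, of j] by (simp add: mmul_def B_def)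
  have "mmul X B M i j = (if i = j then 1 else 0)" if ij: "i \<in> X" "j \<in> X" for i j
  proof -
    let ?v = "\<lambda>k. mmul X B M k j - (if k = j then 1 else 0)"
    have "(\<Sum>k\<in>X. M i k * ?v k) = 0" if "i \<in> X" for i
    proof -
      have "mmul X M (mmul X B M) i j = M i j"
        using mmul_id(1)[OF X MB that] by (simp add: mmul_assoc[symmetric])
      moreover have "(\<Sum>k\<in>X. M i k * (if k = j then 1 else 0)) = M i j"
        using X ij by (simp add: if_distrib cong: if_cong)
      ultimately show ?thesis
        unfolding mmul_def[of X M] by (simp add: right_diff_distrib sum_subtractf)
    qed
    then have "?v i = 0" using ker[of ?v] ij by blast
    then show ?thesis by simp
  qed
  then show thesis using that MB by blast
qed

text \<open>
  Rigidity says that a homogeneous linear system, with coefficients linear in \<open>F\<close>, has trivial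
  kernel: subtracting a scalar from a stabilising \<open>x\<close> makes one fixed diagonal entry vanish, and
  rigidity means that nothing else is left. Along a line through a rigid functional this fails
  only finitely often.
\<close>

lemma rigid_generic:
  fixes F0 F1 :: "'i \<Rightarrow> 'i \<Rightarrow> 'k::field"
  assumes I: "finite I" and rig: "rigid_by I S F0"
    and refl: "\<And>i. i \<in> I \<Longrightarrow> S i i"
  shows "finite {s. \<not> rigid_by I S (\<lambda>i j. F0 i j + s * (F1 i j - F0 i j))}"
proof (cases "I = {}")
  case True
  then show ?thesis by (simp add: rigid_by_def scalar_on_def)
next
  case False
  then obtain i0 where i0: "i0 \<in> I" by blast
  define Q where "Q = {(i,j). i \<in> I \<and> j \<in> I \<and> S i j} - {(i0,i0)}"
  have "Q \<subseteq> I \<times> I" by (auto simp: Q_def)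
  then have finQ: "finite Q" using I finite_subset by blast
  define E where "E = {(i,j). i \<in> I \<and> j \<in> I \<and> S j i}"
  \<comment> \<open>the coefficient of the entry (p, q) of x in the entry (i, j) of [F, x]\<close>
  define co :: "('i \<Rightarrow> 'i \<Rightarrow> 'k) \<Rightarrow> 'i \<times> 'i \<Rightarrow> 'i \<times> 'i \<Rightarrow> 'k" where
    "co F = (\<lambda>(i,j) (p,q). (if q = j then F i p else 0) - (if p = i then F q j else 0))" for F
  have co: "(\<Sum>r\<in>Q. co F (i,j) r * x (fst r) (snd r)) = mmul I F x i j - mmul I x F i j"
    if x: "supported I S x" "x i0 i0 = 0" and ij: "i \<in> I" "j \<in> I" for F x i j
  proof -
    have "(\<Sum>r\<in>Q. co F (i,j) r * x (fst r) (snd r)) = (\<Sum>r\<in>I\<times>I. co F (i,j) r * x (fst r) (snd r))"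
      by (rule sum.mono_neutral_left) (use I x \<open>Q \<subseteq> I \<times> I\<close> in \<open>auto simp: Q_def supported_def\<close>)
    also have "\<dots> = (\<Sum>p\<in>I. \<Sum>q\<in>I. co F (i,j) (p,q) * x p q)"
      by (simp add: sum.cartesian_product split_beta)
    also have "\<dots> = (\<Sum>p\<in>I. \<Sum>q\<in>I. (if q = j then F i p * x p j else 0)) -
         (\<Sum>p\<in>I. \<Sum>q\<in>I. (if p = i then F q j * x i q else 0))"
      unfolding sum_subtractf[symmetric]
      by (intro sum.cong) (auto simp: co_def left_diff_distrib)
    also have "(\<Sum>p\<in>I. \<Sum>q\<in>I. (if q = j then F i p * x p j else 0)) = mmul I F x i j"
      using I ij by (simp add: mmul_def)
    also have "(\<Sum>p\<in>I. \<Sum>q\<in>I. (if p = i then F q j * x i q else 0)) = mmul I x F i j"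
      using I ij by (subst sum.swap) (simp add: mmul_def mult.commute)
    finally show ?thesis .
  qed
  \<comment> \<open>the line from F0 to F1 makes the coefficients polynomials in s\<close>
  define c where "c e q = [:co F0 e q, co F1 e q - co F0 e q:]" for e q
  have pc: "poly (c e q) s = co (\<lambda>i j. F0 i j + s * (F1 i j - F0 i j)) e q" for e q s
    by (auto simp: c_def co_def split_beta algebra_simps)
  have key: "rigid_by I S F \<longleftrightarrow>
     (\<forall>v. (\<forall>e\<in>E. (\<Sum>q\<in>Q. co F e q * v q) = 0) \<longrightarrow> (\<forall>q\<in>Q. v q = 0))" for F
  proof
    assume r: "rigid_by I S F"
    show "\<forall>v. (\<forall>e\<in>E. (\<Sum>q\<in>Q. co F e q * v q) = 0) \<longrightarrow> (\<forall>q\<in>Q. v q = 0)"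
    proof (intro allI impI)
      fix v assume v: "\<forall>e\<in>E. (\<Sum>q\<in>Q. co F e q * v q) = 0"
      define x where "x i j = (if (i,j) \<in> Q then v (i,j) else 0)" for i j
      have sx: "supported I S x" "x i0 i0 = 0" by (auto simp: supported_def x_def Q_def)
      have "(\<Sum>r\<in>Q. co F e r * x (fst r) (snd r)) = (\<Sum>q\<in>Q. co F e q * v q)" for e
        by (rule sum.cong) (auto simp: x_def)
      then have "mmul I F x i j - mmul I x F i j = 0" if "i \<in> I" "j \<in> I" "S j i" for i j
        using v that co[OF sx that(1,2), of F] by (auto simp: E_def)
      then have "x \<in> stab I S F" using sx by (auto simp: stab_def)
      then obtain d where d: "\<forall>i\<in>I. \<forall>j\<in>I. x i j = (if i = j then d else 0)"
        using r unfolding rigid_by_def scalar_on_def by blast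
      then have "d = 0" using sx i0 by auto
      then have "x i j = 0" if "i \<in> I" "j \<in> I" for i j using d that by simp
      then show "\<forall>q\<in>Q. v q = 0" using \<open>Q \<subseteq> I \<times> I\<close> unfolding x_def
        by (metis (no_types, lifting) mem_Sigma_iff subsetD surj_pair)
    qed
  next
    assume k: "\<forall>v. (\<forall>e\<in>E. (\<Sum>q\<in>Q. co F e q * v q) = 0) \<longrightarrow> (\<forall>q\<in>Q. v q = 0)"
    show "rigid_by I S F"
      unfolding rigid_by_def
    proof
      fix x assume x: "x \<in> stab I S F"
      \<comment> \<open>the normalised stabilising matrix has entry 0 at (i0, i0)\<close>
      define y where "y i j = x i j - (if i = j \<and> i \<in> I then x i0 i0 else 0)" for i j
      have sy: "supported I S y" "y i0 i0 = 0"
        using x refl i0 unfolding stab_def supported_def y_def by auto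
      have "mmul I F y i j - mmul I y F i j = mmul I F x i j - mmul I x F i j" if "i \<in> I" "j \<in> I" for i j
      proof -
        have "mmul I F y i j = mmul I F x i j - (\<Sum>k\<in>I. if k = j then F i j * x i0 i0 else 0)"
          unfolding mmul_def sum_subtractf[symmetric] by (rule sum.cong) (auto simp: y_def right_diff_distrib)
        moreover have "mmul I y F i j = mmul I x F i j - (\<Sum>k\<in>I. if k = i then F i j * x i0 i0 else 0)"
          unfolding mmul_def sum_subtractf[symmetric] by (rule sum.cong) (auto simp: y_def left_diff_distrib)
        ultimately show ?thesis using that I by simp
      qed
      then have "\<forall>e\<in>E. (\<Sum>q\<in>Q. co F e q * (\<lambda>r. y (fst r) (snd r)) q) = 0"
        using co[OF sy] x by (auto simp: E_def stab_def)
      then have "\<forall>q\<in>Q. y (fst q) (snd q) = 0" using k[rule_format, of "\<lambda>r. y (fst r) (snd r)"] by blast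
      then have y0: "y i j = 0" if "i \<in> I" "j \<in> I" for i j
        using sy that unfolding Q_def supported_def by force
      have "\<forall>i\<in>I. \<forall>j\<in>I. x i j = (if i = j then x i0 i0 else 0)"
        using y0 unfolding y_def by fastforce
      then show "scalar_on I x" unfolding scalar_on_def by blast
    qed
  qed
  have "finite {s. \<exists>v. (\<forall>e\<in>E. (\<Sum>q\<in>Q. poly (c e q) s * v q) = 0) \<and> (\<exists>q\<in>Q. v q \<noteq> 0)}"
  proof (rule kernel_generic[OF finQ, where z = 0])
    fix v assume "\<forall>e\<in>E. (\<Sum>q\<in>Q. poly (c e q) 0 * v q) = 0"
    then show "\<forall>q\<in>Q. v q = 0" using rig unfolding key pc by simp
  qed
  then show ?thesis unfolding key pc by (rule rev_finite_subset) blast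
qed

section \<open>Reduction of a pattern along a matching of two blocks\<close>

text \<open>
  The situation of two first blocks of different size: \<open>X1 \<union> X2\<close> is the smaller one and is
  contained in the larger one \<open>X1 \<union> X2 \<union> Y1 \<union> Y2\<close>, while \<open>Z\<close> collects all
  other indices. The functionals pair \<open>Y1 \<union> Y2\<close> with \<open>X1 \<union> X2\<close> by an arbitrary
  matrix; a generic one has full rank, and \<open>\<pi>\<close>, with inverse \<open>\<rho>\<close>, matches the part \<open>X2\<close>
  of one side with the part \<open>Y2\<close> of the other. Full rank leaves unmatched indices on one side at
  most, which is the condition \<open>degenerate\<close>.
\<close>

locale block_split =
  fixes I X1 X2 Y1 Y2 Z :: "'i set" and S :: "'i \<Rightarrow> 'i \<Rightarrow> bool" and \<pi> \<rho> :: "'i \<Rightarrow> 'i"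
  assumes finI: "finite I"
    and I_eq: "I = X1 \<union> X2 \<union> Y1 \<union> Y2 \<union> Z"
    and disj: "X1 \<inter> X2 = {}" "Y1 \<inter> Y2 = {}" "(X1 \<union> X2) \<inter> (Y1 \<union> Y2) = {}"
      "(X1 \<union> X2) \<inter> Z = {}" "(Y1 \<union> Y2) \<inter> Z = {}"
    and \<pi>: "\<And>i. i \<in> X2 \<Longrightarrow> \<pi> i \<in> Y2" "\<And>i. i \<in> X2 \<Longrightarrow> \<rho> (\<pi> i) = i"
    and \<rho>: "\<And>j. j \<in> Y2 \<Longrightarrow> \<rho> j \<in> X2" "\<And>j. j \<in> Y2 \<Longrightarrow> \<pi> (\<rho> j) = j"
    and degenerate: "X1 = {} \<or> Y1 = {}"
    and refl: "\<And>i. i \<in> I \<Longrightarrow> S i i"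
    and trans: "\<And>i j k. \<lbrakk>i \<in> I; j \<in> I; k \<in> I; S i j; S j k\<rbrakk> \<Longrightarrow> S i k"
    and SXX: "\<And>i j. \<lbrakk>i \<in> X1 \<union> X2; j \<in> X1 \<union> X2\<rbrakk> \<Longrightarrow> S i j"
    and SXY: "\<And>i j. \<lbrakk>i \<in> X1 \<union> X2; j \<in> Y1 \<union> Y2\<rbrakk> \<Longrightarrow> S i j"
    and SY12: "\<And>i j. \<lbrakk>i \<in> Y1; j \<in> Y2\<rbrakk> \<Longrightarrow> S i j"
    and nSYX: "\<And>i j. \<lbrakk>i \<in> Y1 \<union> Y2; j \<in> X1 \<union> X2\<rbrakk> \<Longrightarrow> \<not> S i j"
    and nSXZ: "\<And>i j. \<lbrakk>i \<in> X1 \<union> X2; j \<in> Z\<rbrakk> \<Longrightarrow> \<not> S i j"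
    and nSZX: "\<And>i j. \<lbrakk>i \<in> Z; j \<in> X1 \<union> X2\<rbrakk> \<Longrightarrow> \<not> S i j"
    and nSYZ: "\<And>i j. \<lbrakk>i \<in> Y1 \<union> Y2; j \<in> Z\<rbrakk> \<Longrightarrow> \<not> S i j"
begin

abbreviation "X \<equiv> X1 \<union> X2"
abbreviation "Y \<equiv> Y1 \<union> Y2"

text \<open>
  The pattern that remains on \<open>I - X2\<close> once \<open>X2\<close> is identified with \<open>Y2\<close>. The positions
  \<open>Y1 \<times> Y2\<close> are lost because the stabiliser equations for a normal functional force the
  entries there to vanish.
\<close>

definition "S' i j \<longleftrightarrow> S i j \<and> \<not> (i \<in> Y1 \<and> j \<in> Y2)"

definition normal :: "('i \<Rightarrow> 'i \<Rightarrow> 'k::field) \<Rightarrow> bool" where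
  "normal F \<longleftrightarrow> (\<forall>i j. F i j \<noteq> 0 \<longrightarrow> i \<in> I \<and> j \<in> I \<and> S j i) \<and>
     (\<forall>i\<in>Y. \<forall>j\<in>X. F i j = (if j \<in> X2 \<and> i = \<pi> j then 1 else 0))"

text \<open>
  The rows and columns of the removed indices are added to those of their partners in \<open>Y2\<close>.
\<close>

definition reduced :: "('i \<Rightarrow> 'i \<Rightarrow> 'k::field) \<Rightarrow> 'i \<Rightarrow> 'i \<Rightarrow> 'k" where
  "reduced F i j = (if i \<in> Y2 \<and> j \<in> Y2 then F i j + F (\<rho> i) (\<rho> j)
     else if i \<in> Y2 \<and> j \<in> X1 then F (\<rho> i) j else F i j)"

lemma fin: "finite X1" "finite X2" "finite Y1" "finite Y2" "finite Z" "finite X" "finite Y"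
  using finI unfolding I_eq by auto

lemma neq: "i \<in> X1 \<Longrightarrow> i \<notin> X2 \<and> i \<notin> Y1 \<and> i \<notin> Y2 \<and> i \<notin> Z" "i \<in> X2 \<Longrightarrow> i \<notin> X1 \<and> i \<notin> Y1 \<and> i \<notin> Y2 \<and> i \<notin> Z"
  "i \<in> Y1 \<Longrightarrow> i \<notin> X1 \<and> i \<notin> X2 \<and> i \<notin> Y2 \<and> i \<notin> Z" "i \<in> Y2 \<Longrightarrow> i \<notin> X1 \<and> i \<notin> X2 \<and> i \<notin> Y1 \<and> i \<notin> Z"
  "i \<in> Z \<Longrightarrow> i \<notin> X1 \<and> i \<notin> X2 \<and> i \<notin> Y1 \<and> i \<notin> Y2"
  using disj by auto

lemma inI: "i \<in> X1 \<Longrightarrow> i \<in> I" "i \<in> X2 \<Longrightarrow> i \<in> I" "i \<in> Y1 \<Longrightarrow> i \<in> I" "i \<in> Y2 \<Longrightarrow> i \<in> I" "i \<in> Z \<Longrightarrow> i \<in> I"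
  using I_eq by auto

lemma mmul_split: "mmul I A B i j = mmul X A B i j + mmul Y A B i j + mmul Z A B i j"
proof -
  have "I = (X \<union> Y) \<union> Z" using I_eq by auto
  then show ?thesis
    unfolding mmul_def using disj fin by (simp add: sum.union_disjoint Int_Un_distrib2)
qed

lemma mmul_X: "mmul X A B i j = mmul X1 A B i j + mmul X2 A B i j"
  unfolding mmul_def using disj fin by (simp add: sum.union_disjoint)

lemma mmul_Y: "mmul Y A B i j = mmul Y1 A B i j + mmul Y2 A B i j"
  unfolding mmul_def using disj fin by (simp add: sum.union_disjoint)

lemma mmul_zero: "(\<And>k. k \<in> K \<Longrightarrow> A i k = 0 \<or> B k j = 0) \<Longrightarrow> mmul K A B i j = 0"
  unfolding mmul_def by (rule sum.neutral) auto

lemma sum_Y2: "(\<Sum>k\<in>Y2. f k) = (\<Sum>k\<in>X2. f (\<pi> k))"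
  by (rule sum.reindex_bij_witness[of _ \<pi> \<rho>]) (use \<pi> \<rho> in auto)

text \<open>
  The stabiliser equations block by block. At positions in \<open>Y \<times> X\<close> a normal functional only
  compares entries of \<open>x\<close> with each other, which identifies \<open>X2\<close> with \<open>Y2\<close>.
\<close>

lemma stab_iff:
  assumes nF: "normal F"
  shows "x \<in> stab I S F \<longleftrightarrow> supported I S x \<and>
    (\<forall>i\<in>X. \<forall>j\<in>X. mmul X F x i j = mmul X x F i j + (if j \<in> X2 then x i (\<pi> j) else 0)) \<and>
    (\<forall>i\<in>Y. \<forall>j\<in>X. (if i \<in> Y2 then x (\<rho> i) j else 0) = (if j \<in> X2 then x i (\<pi> j) else 0)) \<and>
    (\<forall>i\<in>Y. \<forall>j\<in>Y. S j i \<longrightarrow> (if i \<in> Y2 then x (\<rho> i) j else 0) + mmul Y F x i j + mmul Z F x i j = mmul Y x F i j) \<and>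
    (\<forall>i\<in>Y. \<forall>j\<in>Z. S j i \<longrightarrow> mmul Z F x i j = mmul Y x F i j) \<and>
    (\<forall>i\<in>Z. \<forall>j\<in>Z. S j i \<longrightarrow> mmul Z F x i j = mmul Y x F i j + mmul Z x F i j)"
proof (cases "supported I S x")
  case False
  then show ?thesis by (simp add: stab_def)
next
  case True
  have x0: "x i j = 0" if "i \<in> Y \<and> j \<in> X \<or> i \<in> X \<and> j \<in> Z \<or> i \<in> Z \<and> j \<in> X \<or> i \<in> Y \<and> j \<in> Z" for i j
    using True that nSYX nSXZ nSZX nSYZ unfolding supported_def by blast
  have F0: "F i j = 0" if "i \<in> X \<and> j \<in> Y \<or> i \<in> Z \<and> j \<in> X \<or> i \<in> X \<and> j \<in> Z \<or> i \<in> Z \<and> j \<in> Y" for i j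
    using nF that nSYX nSXZ nSZX nSYZ unfolding normal_def by blast
  have FYX: "F i j = (if j \<in> X2 \<and> i = \<pi> j then 1 else 0)" if "i \<in> Y" "j \<in> X" for i j
    using nF that unfolding normal_def by blast
  have XF: "mmul Y x F i j = (if j \<in> X2 then x i (\<pi> j) else 0)" if "j \<in> X" for i j
  proof -
    have "mmul Y x F i j = (\<Sum>k\<in>Y. if j \<in> X2 \<and> k = \<pi> j then x i k else 0)"
      unfolding mmul_def by (rule sum.cong) (use FYX that in auto)
    then show ?thesis using fin \<pi>(1) by (auto simp: sum.delta)
  qed
  have FX: "mmul X F x i j = (if i \<in> Y2 then x (\<rho> i) j else 0)" if "i \<in> Y" for i j
  proof -
    have "mmul X F x i j = (\<Sum>k\<in>X. if i \<in> Y2 \<and> k = \<rho> i then x k j else 0)"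
      unfolding mmul_def
    proof (rule sum.cong)
      fix k assume "k \<in> X"
      moreover have "k \<in> X2 \<and> i = \<pi> k \<longleftrightarrow> i \<in> Y2 \<and> k = \<rho> i" using \<pi> \<rho> by metis
      ultimately show "F i k * x k j = (if i \<in> Y2 \<and> k = \<rho> i then x k j else 0)"
        using FYX[OF that, of k] by simp
    qed simp
    then show ?thesis using fin \<rho>(1) by (auto simp: sum.delta)
  qed
  have XX: "mmul I F x i j = mmul I x F i j \<longleftrightarrow>
      mmul X F x i j = mmul X x F i j + (if j \<in> X2 then x i (\<pi> j) else 0)"
    if "i \<in> X" "j \<in> X" for i j
  proof -
    have "mmul Y F x i j = 0" "mmul Z F x i j = 0" "mmul Z x F i j = 0"
      by (rule mmul_zero; use x0 F0 that in blast)+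
    then show ?thesis unfolding mmul_split XF[OF that(2)] by simp
  qed
  have YX: "mmul I F x i j = mmul I x F i j \<longleftrightarrow>
     (if i \<in> Y2 then x (\<rho> i) j else 0) = (if j \<in> X2 then x i (\<pi> j) else 0)"
    if "i \<in> Y" "j \<in> X" for i j
  proof -
    have "mmul Y F x i j = 0" "mmul Z F x i j = 0" "mmul X x F i j = 0" "mmul Z x F i j = 0"
      by (rule mmul_zero; use x0 F0 that in blast)+
    then show ?thesis unfolding mmul_split XF[OF that(2)] FX[OF that(1)] by simp
  qed
  have YY: "mmul I F x i j = mmul I x F i j \<longleftrightarrow>
     (if i \<in> Y2 then x (\<rho> i) j else 0) + mmul Y F x i j + mmul Z F x i j = mmul Y x F i j"
    if "i \<in> Y" "j \<in> Y" for i j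
  proof -
    have "mmul X x F i j = 0" "mmul Z x F i j = 0"
      by (rule mmul_zero; use x0 F0 that in blast)+
    then show ?thesis unfolding mmul_split FX[OF that(1)] by simp
  qed
  have YZ: "mmul I F x i j = mmul I x F i j \<longleftrightarrow> mmul Z F x i j = mmul Y x F i j"
    if "i \<in> Y" "j \<in> Z" for i j
  proof -
    have "mmul X F x i j = 0" "mmul Y F x i j = 0" "mmul X x F i j = 0" "mmul Z x F i j = 0"
      by (rule mmul_zero; use x0 F0 that in blast)+
    then show ?thesis unfolding mmul_split by simp
  qed
  have ZZ: "mmul I F x i j = mmul I x F i j \<longleftrightarrow> mmul Z F x i j = mmul Y x F i j + mmul Z x F i j"
    if "i \<in> Z" "j \<in> Z" for i j
  proof -
    have "mmul X F x i j = 0" "mmul Y F x i j = 0" "mmul X x F i j = 0"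
      by (rule mmul_zero; use x0 F0 that in blast)+
    then show ?thesis unfolding mmul_split by simp
  qed
  have eq: "(\<forall>i\<in>I. \<forall>j\<in>I. S j i \<longrightarrow> mmul I F x i j = mmul I x F i j) \<longleftrightarrow>
     (\<forall>i\<in>X. \<forall>j\<in>X. mmul I F x i j = mmul I x F i j) \<and>
     (\<forall>i\<in>Y. \<forall>j\<in>X. mmul I F x i j = mmul I x F i j) \<and>
     (\<forall>i\<in>Y. \<forall>j\<in>Y. S j i \<longrightarrow> mmul I F x i j = mmul I x F i j) \<and>
     (\<forall>i\<in>Y. \<forall>j\<in>Z. S j i \<longrightarrow> mmul I F x i j = mmul I x F i j) \<and>
     (\<forall>i\<in>Z. \<forall>j\<in>Z. S j i \<longrightarrow> mmul I F x i j = mmul I x F i j)" (is "?L \<longleftrightarrow> ?R")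
  proof
    assume L: ?L
    show ?R by (intro conjI ballI impI L[rule_format]) (auto intro: inI SXX SXY)
  next
    assume R: ?R
    show ?L
    proof (intro ballI impI)
      fix i j assume "i \<in> I" "j \<in> I" "S j i"
      then consider "i \<in> X" "j \<in> X" | "i \<in> Y" "j \<in> X" | "i \<in> Y" "j \<in> Y" | "i \<in> Y" "j \<in> Z" | "i \<in> Z" "j \<in> Z"
        using I_eq nSYX[of j i] nSXZ[of j i] nSZX[of j i] nSYZ[of j i] by blast
      then show "mmul I F x i j = mmul I x F i j" using R \<open>S j i\<close> by cases blast+
    qed
  qed
  show ?thesis unfolding stab_def mem_Collect_eq eq using True
    by (simp only: XX YX YY YZ ZZ simp_thms cong: ball_cong)
qed

lemma stab'_iff:
  assumes nF: "normal F"
  shows "x \<in> stab (I - X2) S' (reduced F) \<longleftrightarrow> supported (I - X2) S' x \<and>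
    (\<forall>i\<in>X1. \<forall>j\<in>X1. mmul X1 F x i j = mmul X1 x F i j + (\<Sum>k\<in>X2. x i (\<pi> k) * F k j)) \<and>
    (\<forall>i\<in>Y2. \<forall>j\<in>X1. (\<Sum>k\<in>X1. F (\<rho> i) k * x k j) = (\<Sum>k\<in>X2. x i (\<pi> k) * F k j)) \<and>
    (\<forall>i\<in>Y. \<forall>j\<in>Y. S' j i \<longrightarrow>
       (if i \<in> Y2 then (\<Sum>k\<in>X1. F (\<rho> i) k * x k j) + (\<Sum>k\<in>X2. F (\<rho> i) k * x (\<pi> k) j) else 0)
        + mmul Y F x i j + mmul Z F x i j =
       mmul Y x F i j + (if j \<in> Y2 then (\<Sum>k\<in>X2. x i (\<pi> k) * F k (\<rho> j)) else 0)) \<and>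
    (\<forall>i\<in>Y. \<forall>j\<in>Z. S' j i \<longrightarrow> mmul Z F x i j = mmul Y x F i j) \<and>
    (\<forall>i\<in>Z. \<forall>j\<in>Z. S' j i \<longrightarrow> mmul Z F x i j = mmul Y x F i j + mmul Z x F i j)"
proof (cases "supported (I - X2) S' x")
  case False
  then show ?thesis by (simp add: stab_def)
next
  case True
  let ?F = "reduced F"
  let ?I = "I - X2"
  have S'S: "S' i j \<Longrightarrow> S i j" for i j by (simp add: S'_def)
  have x0: "x i j = 0" if "i \<in> Y \<and> j \<in> X1 \<or> i \<in> X1 \<and> j \<in> Z \<or> i \<in> Z \<and> j \<in> X1 \<or> i \<in> Y \<and> j \<in> Z \<or> i \<in> Y1 \<and> j \<in> Y2" for i j
    using True that nSYX nSXZ nSZX nSYZ unfolding supported_def S'_def by blast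
  have F0: "F i j = 0" if "i \<in> X \<and> j \<in> Y \<or> i \<in> Z \<and> j \<in> X \<or> i \<in> X \<and> j \<in> Z \<or> i \<in> Z \<and> j \<in> Y" for i j
    using nF that nSYX nSXZ nSZX nSYZ unfolding normal_def by blast
  have FYX: "F i j = 0" if "i \<in> Y" "j \<in> X1" for i j
  proof -
    have "F i j = (if j \<in> X2 \<and> i = \<pi> j then 1 else 0)" using nF that unfolding normal_def by blast
    then show ?thesis using neq(1)[OF that(2)] by simp
  qed
  have F'eq: "?F i j = F i j" if "i \<notin> Y2 \<or> j \<notin> Y2 \<union> X1" for i j
    using that by (auto simp: reduced_def)
  have F'Y2: "?F i j = F i j + F (\<rho> i) (\<rho> j)" if "i \<in> Y2" "j \<in> Y2" for i j
    using that by (simp add: reduced_def)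
  have F'X1: "?F i j = F (\<rho> i) j" if "i \<in> Y2" "j \<in> X1" for i j
    using that neq(1)[of j] by (simp add: reduced_def)
  have F'0: "?F i j = 0" if "i \<in> X1 \<and> j \<in> Y \<or> i \<in> Z \<and> j \<in> X1 \<or> i \<in> X1 \<and> j \<in> Z \<or> i \<in> Z \<and> j \<in> Y \<or> i \<in> Y1 \<and> j \<in> X1" for i j
  proof -
    have "i \<notin> Y2" using that disj by blast
    then have "?F i j = F i j" by (simp add: F'eq)
    moreover have "F i j = 0" using that F0[of i j] FYX[of i j] by blast
    ultimately show ?thesis by simp
  qed
  have sp: "mmul ?I A B i j = mmul X1 A B i j + mmul Y A B i j + mmul Z A B i j" for A B :: "'i \<Rightarrow> 'i \<Rightarrow> 'b::field" and i j
  proof -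
    have "?I = (X1 \<union> Y) \<union> Z" using I_eq disj by blast
    moreover have "(X1 \<union> Y) \<inter> Z = {}" "X1 \<inter> Y = {}" using disj by blast+
    ultimately show ?thesis
      unfolding mmul_def using fin by (simp add: sum.union_disjoint)
  qed
  have c11: "mmul ?I ?F x i j = mmul ?I x ?F i j \<longleftrightarrow>
      mmul X1 F x i j = mmul X1 x F i j + (\<Sum>k\<in>X2. x i (\<pi> k) * F k j)" if "i \<in> X1" "j \<in> X1" for i j
  proof -
    have "mmul Y ?F x i j = 0" "mmul Z ?F x i j = 0" "mmul Z x ?F i j = 0"
      by (rule mmul_zero; use x0 F0 F'0 that in blast)+
    moreover have "mmul X1 ?F x i j = mmul X1 F x i j" "mmul X1 x ?F i j = mmul X1 x F i j"
      by (intro mmul_cong F'eq refl; use disj that in blast)+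
    moreover have "mmul Y x ?F i j = (\<Sum>k\<in>X2. x i (\<pi> k) * F k j)"
    proof -
      have "mmul Y1 x ?F i j = 0" by (rule mmul_zero) (use F'0 that in blast)
      moreover have "mmul Y2 x ?F i j = (\<Sum>k\<in>Y2. x i k * F (\<rho> k) j)"
        unfolding mmul_def by (rule sum.cong) (use that F'X1 in auto)
      ultimately show ?thesis unfolding mmul_Y sum_Y2 using \<pi> by simp
    qed
    ultimately show ?thesis unfolding sp by simp
  qed
  have cY1: "mmul ?I ?F x i j = mmul ?I x ?F i j" if "i \<in> Y1" "j \<in> X1" for i j
    using degenerate that by auto
  have cY2: "mmul ?I ?F x i j = mmul ?I x ?F i j \<longleftrightarrow>
      (\<Sum>k\<in>X1. F (\<rho> i) k * x k j) = (\<Sum>k\<in>X2. x i (\<pi> k) * F k j)" if "i \<in> Y2" "j \<in> X1" for i j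
  proof -
    have "mmul Y ?F x i j = 0" "mmul Z ?F x i j = 0" "mmul X1 x ?F i j = 0" "mmul Z x ?F i j = 0"
      by (rule mmul_zero; use x0 F0 F'0 that in blast)+
    moreover have "mmul X1 ?F x i j = (\<Sum>k\<in>X1. F (\<rho> i) k * x k j)"
      unfolding mmul_def by (rule sum.cong) (use that F'X1 in auto)
    moreover have "mmul Y x ?F i j = (\<Sum>k\<in>X2. x i (\<pi> k) * F k j)"
    proof -
      have "mmul Y1 x ?F i j = 0" by (rule mmul_zero) (use F'0 that in blast)
      moreover have "mmul Y2 x ?F i j = (\<Sum>k\<in>Y2. x i k * F (\<rho> k) j)"
        unfolding mmul_def by (rule sum.cong) (use that F'X1 in auto)
      ultimately show ?thesis unfolding mmul_Y sum_Y2 using \<pi> by simp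
    qed
    ultimately show ?thesis unfolding sp by simp
  qed
  have cYY: "mmul ?I ?F x i j = mmul ?I x ?F i j \<longleftrightarrow>
      (if i \<in> Y2 then (\<Sum>k\<in>X1. F (\<rho> i) k * x k j) + (\<Sum>k\<in>X2. F (\<rho> i) k * x (\<pi> k) j) else 0)
        + mmul Y F x i j + mmul Z F x i j =
       mmul Y x F i j + (if j \<in> Y2 then (\<Sum>k\<in>X2. x i (\<pi> k) * F k (\<rho> j)) else 0)"
    if "i \<in> Y" "j \<in> Y" for i j
  proof -
    have "mmul X1 x ?F i j = 0" "mmul Z x ?F i j = 0"
      by (rule mmul_zero; use x0 F0 F'0 that in blast)+
    moreover have "mmul X1 ?F x i j = (if i \<in> Y2 then (\<Sum>k\<in>X1. F (\<rho> i) k * x k j) else 0)"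
    proof (cases "i \<in> Y2")
      case True
      then show ?thesis unfolding mmul_def by (auto intro!: sum.cong simp: F'X1)
    next
      case False
      then have "mmul X1 ?F x i j = 0" by (intro mmul_zero) (use F'0 that in blast)
      then show ?thesis using False by simp
    qed
    moreover have "mmul Z ?F x i j = mmul Z F x i j"
      by (intro mmul_cong F'eq refl; use disj that in blast)
    moreover have "mmul Y ?F x i j = mmul Y F x i j + (if i \<in> Y2 then (\<Sum>k\<in>X2. F (\<rho> i) k * x (\<pi> k) j) else 0)"
    proof -
      have "mmul Y1 ?F x i j = mmul Y1 F x i j"
        by (intro mmul_cong F'eq refl; use disj that in blast)
      moreover have "mmul Y2 ?F x i j = mmul Y2 F x i j + (\<Sum>k\<in>Y2. (if i \<in> Y2 then F (\<rho> i) (\<rho> k) else 0) * x k j)"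
        unfolding mmul_def sum.distrib[symmetric]
        by (rule sum.cong) (auto simp: F'Y2 F'eq distrib_right)
      ultimately show ?thesis unfolding mmul_Y sum_Y2 using \<pi> by (auto intro!: sum.cong)
    qed
    moreover have jX1: "j \<notin> X1" using that disj by blast
    have "mmul Y x ?F i j = mmul Y x F i j + (if j \<in> Y2 then (\<Sum>k\<in>X2. x i (\<pi> k) * F k (\<rho> j)) else 0)"
    proof -
      have "mmul Y1 x ?F i j = mmul Y1 x F i j"
        by (intro mmul_cong F'eq refl; use disj that in blast)
      moreover have "mmul Y2 x ?F i j = mmul Y2 x F i j + (\<Sum>k\<in>Y2. x i k * (if j \<in> Y2 then F (\<rho> k) (\<rho> j) else 0))"
        unfolding mmul_def sum.distrib[symmetric] using jX1
        by (intro sum.cong) (auto simp: F'Y2 F'eq distrib_left)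
      ultimately show ?thesis unfolding mmul_Y sum_Y2 using \<pi> by (auto intro!: sum.cong)
    qed
    ultimately show ?thesis unfolding sp by (simp add: algebra_simps)
  qed
  have cYZ: "mmul ?I ?F x i j = mmul ?I x ?F i j \<longleftrightarrow> mmul Z F x i j = mmul Y x F i j"
    if "i \<in> Y" "j \<in> Z" for i j
  proof -
    have "mmul X1 ?F x i j = 0" "mmul Y ?F x i j = 0" "mmul X1 x ?F i j = 0" "mmul Z x ?F i j = 0"
      by (rule mmul_zero; use x0 F0 F'0 that in blast)+
    moreover have "mmul Z ?F x i j = mmul Z F x i j" "mmul Y x ?F i j = mmul Y x F i j"
      by (intro mmul_cong F'eq refl; use disj that in blast)+
    ultimately show ?thesis unfolding sp by simp
  qed
  have cZZ: "mmul ?I ?F x i j = mmul ?I x ?F i j \<longleftrightarrow> mmul Z F x i j = mmul Y x F i j + mmul Z x F i j"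
    if "i \<in> Z" "j \<in> Z" for i j
  proof -
    have "mmul X1 ?F x i j = 0" "mmul Y ?F x i j = 0" "mmul X1 x ?F i j = 0"
      by (rule mmul_zero; use x0 F0 F'0 that in blast)+
    moreover have "mmul Z ?F x i j = mmul Z F x i j" "mmul Y x ?F i j = mmul Y x F i j" "mmul Z x ?F i j = mmul Z x F i j"
      by (intro mmul_cong F'eq refl; use disj that in blast)+
    ultimately show ?thesis unfolding sp by simp
  qed
  have eq: "(\<forall>i\<in>?I. \<forall>j\<in>?I. S' j i \<longrightarrow> mmul ?I ?F x i j = mmul ?I x ?F i j) \<longleftrightarrow>
     (\<forall>i\<in>X1. \<forall>j\<in>X1. mmul ?I ?F x i j = mmul ?I x ?F i j) \<and>
     (\<forall>i\<in>Y2. \<forall>j\<in>X1. mmul ?I ?F x i j = mmul ?I x ?F i j) \<and>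
     (\<forall>i\<in>Y. \<forall>j\<in>Y. S' j i \<longrightarrow> mmul ?I ?F x i j = mmul ?I x ?F i j) \<and>
     (\<forall>i\<in>Y. \<forall>j\<in>Z. S' j i \<longrightarrow> mmul ?I ?F x i j = mmul ?I x ?F i j) \<and>
     (\<forall>i\<in>Z. \<forall>j\<in>Z. S' j i \<longrightarrow> mmul ?I ?F x i j = mmul ?I x ?F i j)" (is "?L \<longleftrightarrow> ?R")
  proof
    assume L: ?L
    have "S' j i" if "j \<in> X1" "i \<in> X1 \<union> Y2" for i j
      using SXX SXY that disj unfolding S'_def by blast
    then show ?R by (intro conjI ballI impI L[rule_format]) (use inI disj \<open>\<And>i j. \<lbrakk>j \<in> X1; i \<in> X1 \<union> Y2\<rbrakk> \<Longrightarrow> S' j i\<close> in blast)+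
  next
    assume R: ?R
    show ?L
    proof (intro ballI impI)
      fix i j assume "i \<in> ?I" "j \<in> ?I" "S' j i"
      then consider "i \<in> X1" "j \<in> X1" | "i \<in> Y1" "j \<in> X1" | "i \<in> Y2" "j \<in> X1" | "i \<in> Y" "j \<in> Y" | "i \<in> Y" "j \<in> Z" | "i \<in> Z" "j \<in> Z"
        using I_eq nSYX[of j i] nSXZ[of j i] nSZX[of j i] nSYZ[of j i] S'S[of j i] by blast
      then show "mmul ?I ?F x i j = mmul ?I x ?F i j" using R \<open>S' j i\<close> cY1 by cases blast+
    qed
  qed
  show ?thesis unfolding stab_def mem_Collect_eq eq using True
    by (simp only: c11 cY2 cYY cYZ cZZ simp_thms cong: ball_cong)
qed

lemma mmul_scalar:
  assumes "finite K" "\<And>i j. \<lbrakk>i \<in> K; j \<in> K\<rbrakk> \<Longrightarrow> x i j = (if i = j then c else 0)"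
  shows "j \<in> K \<Longrightarrow> mmul K F x i j = F i j * c" "i \<in> K \<Longrightarrow> mmul K x F i j = c * F i j"
proof -
  assume j: "j \<in> K"
  have "mmul K F x i j = (\<Sum>k\<in>K. if k = j then F i j * c else 0)"
    unfolding mmul_def by (rule sum.cong) (use assms(2) j in auto)
  then show "mmul K F x i j = F i j * c" using assms(1) j by simp
next
  assume i: "i \<in> K"
  have "mmul K x F i j = (\<Sum>k\<in>K. if k = i then c * F i j else 0)"
    unfolding mmul_def by (rule sum.cong) (use assms(2) i in auto)
  then show "mmul K x F i j = c * F i j" using assms(1) i by simp
qed

text \<open>
  A stabilising \<open>x\<close> for \<open>F\<close> yields a stabilising \<open>y\<close> for the reduced functional: restrict \<open>x\<close>, but
  fill \<open>X1 \<times> Y2\<close> from \<open>X1 \<times> X2\<close>, as the matching suggests. Since \<open>y\<close> is scalar, so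
  are the diagonal blocks of \<open>x\<close>, and then the equations on \<open>X \<times> X\<close> and \<open>Y \<times> Y\<close>
  leave no room for its entries in \<open>X \<times> Y\<close>.
\<close>

lemma rigid_if_reduced:
  assumes nF: "normal F" and rig: "rigid_by (I - X2) S' (reduced F)"
  shows "rigid_by I S F"
  unfolding rigid_by_def
proof
  fix x assume x: "x \<in> stab I S F"
  have supp: "supported I S x"
    and XX: "\<And>i j. \<lbrakk>i\<in>X; j\<in>X\<rbrakk> \<Longrightarrow> mmul X F x i j = mmul X x F i j + (if j \<in> X2 then x i (\<pi> j) else 0)"
    and YX: "\<And>i j. \<lbrakk>i\<in>Y; j\<in>X\<rbrakk> \<Longrightarrow> (if i \<in> Y2 then x (\<rho> i) j else 0) = (if j \<in> X2 then x i (\<pi> j) else 0)"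
    and YY: "\<And>i j. \<lbrakk>i\<in>Y; j\<in>Y; S j i\<rbrakk> \<Longrightarrow> (if i \<in> Y2 then x (\<rho> i) j else 0) + mmul Y F x i j + mmul Z F x i j = mmul Y x F i j"
    and YZ: "\<And>i j. \<lbrakk>i\<in>Y; j\<in>Z; S j i\<rbrakk> \<Longrightarrow> mmul Z F x i j = mmul Y x F i j"
    and ZZ: "\<And>i j. \<lbrakk>i\<in>Z; j\<in>Z; S j i\<rbrakk> \<Longrightarrow> mmul Z F x i j = mmul Y x F i j + mmul Z x F i j"
    using x unfolding stab_iff[OF nF] by blast+
  have x0: "x i j = 0" if "i \<in> Y \<and> j \<in> X \<or> i \<in> X \<and> j \<in> Z \<or> i \<in> Z \<and> j \<in> X \<or> i \<in> Y \<and> j \<in> Z" for i j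
    using supp that nSYX nSXZ nSZX nSYZ unfolding supported_def by blast
  have x21: "x i j = 0" if "i \<in> X2" "j \<in> X1" for i j
    using YX[of "\<pi> i" j] \<pi>[OF that(1)] neq(1)[OF that(2)] that by simp
  have x22: "x i (\<pi> j) = x (\<rho> i) j" if "i \<in> Y2" "j \<in> X2" for i j
    using YX[of i j] that by simp
  have y12: "x i j = 0" if "i \<in> Y1" "j \<in> Y2" for i j
    using YX[of i "\<rho> j"] \<rho>[OF that(2)] neq(3)[OF that(1)] that by simp
  define y where "y i j = (if i \<in> I - X2 \<and> j \<in> I - X2 then
     if i \<in> X1 \<and> j \<in> Y2 then x i (\<rho> j) else x i j else 0)" for i j
  have yX1: "y i j = x i j" if "i \<in> X1" "j \<in> X1" for i j
    using that neq(1)[of i] neq(1)[of j] inI by (simp add: y_def)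
  have yX12: "y i j = x i (\<rho> j)" if "i \<in> X1" "j \<in> Y2" for i j
    using that neq(1)[of i] neq(4)[of j] inI by (simp add: y_def)
  have yYZ: "y i j = x i j" if "i \<in> Y \<union> Z" "j \<in> Y \<union> Z" for i j
    using that disj I_eq by (auto simp: y_def)
  have ysupp: "supported (I - X2) S' y"
    unfolding supported_def
  proof (intro allI impI)
    fix i j assume "y i j \<noteq> 0"
    then have ij: "i \<in> I - X2" "j \<in> I - X2" by (auto simp: y_def split: if_splits)
    moreover have "S' i j"
    proof (cases "i \<in> X1 \<and> j \<in> Y2")
      case True
      then show ?thesis using SXY[of i j] neq(1)[of i] by (auto simp: S'_def)
    next
      case False
      then have "x i j \<noteq> 0" using \<open>y i j \<noteq> 0\<close> ij by (auto simp: y_def)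
      then show ?thesis using supp y12 unfolding S'_def supported_def by blast
    qed
    ultimately show "i \<in> I - X2 \<and> j \<in> I - X2 \<and> S' i j" by blast
  qed
  have "y \<in> stab (I - X2) S' (reduced F)"
    unfolding stab'_iff[OF nF]
  proof (intro conjI ballI impI ysupp)
    fix i j assume ij: "i \<in> X1" "j \<in> X1"
    have "mmul X1 F y i j = mmul X1 F x i j" "mmul X1 y F i j = mmul X1 x F i j"
      by (rule mmul_cong; use yX1 ij in simp)+
    moreover have "mmul X2 F x i j = 0" by (rule mmul_zero) (use x21 ij in simp)
    moreover have "mmul X2 x F i j = (\<Sum>k\<in>X2. y i (\<pi> k) * F k j)"
      unfolding mmul_def by (rule sum.cong) (use yX12 ij \<pi> in auto)
    ultimately show "mmul X1 F y i j = mmul X1 y F i j + (\<Sum>k\<in>X2. y i (\<pi> k) * F k j)"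
      using XX[of i j] ij neq(1)[of j] unfolding mmul_X by simp
  next
    fix i j assume ij: "i \<in> Y2" "j \<in> X1"
    have \<rho>i: "\<rho> i \<in> X2" using \<rho> ij by blast
    have "mmul X1 F x (\<rho> i) j = (\<Sum>k\<in>X1. F (\<rho> i) k * y k j)"
      unfolding mmul_def by (rule sum.cong) (use yX1 ij in auto)
    moreover have "mmul X2 F x (\<rho> i) j = 0" by (rule mmul_zero) (use x21 ij in simp)
    moreover have "mmul X1 x F (\<rho> i) j = 0" by (rule mmul_zero) (use x21 \<rho>i in simp)
    moreover have "mmul X2 x F (\<rho> i) j = (\<Sum>k\<in>X2. y i (\<pi> k) * F k j)"
      unfolding mmul_def by (rule sum.cong) (use yYZ x22 ij \<pi> in auto)
    ultimately show "(\<Sum>k\<in>X1. F (\<rho> i) k * y k j) = (\<Sum>k\<in>X2. y i (\<pi> k) * F k j)"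
      using XX[of "\<rho> i" j] ij neq(1)[of j] \<rho>i unfolding mmul_X by simp
  next
    fix i j assume ij: "i \<in> Y" "j \<in> Y" "S' j i"
    have e: "mmul Y F y i j = mmul Y F x i j" "mmul Y y F i j = mmul Y x F i j" "mmul Z F y i j = mmul Z F x i j"
      by (rule mmul_cong; use yYZ ij in auto)+
    have S: "S j i" using ij by (simp add: S'_def)
    show "(if i \<in> Y2 then (\<Sum>k\<in>X1. F (\<rho> i) k * y k j) + (\<Sum>k\<in>X2. F (\<rho> i) k * y (\<pi> k) j) else 0)
        + mmul Y F y i j + mmul Z F y i j =
       mmul Y y F i j + (if j \<in> Y2 then (\<Sum>k\<in>X2. y i (\<pi> k) * F k (\<rho> j)) else 0)"
    proof (cases "i \<in> Y2")
      case False
      have "(\<Sum>k\<in>X2. y i (\<pi> k) * F k (\<rho> j)) = 0"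
        by (rule sum.neutral) (use y12[of i] yYZ[of i] False ij \<pi> in auto)
      then show ?thesis using YY[OF ij(1,2) S] False unfolding e by simp
    next
      case i2: True
      then have j2: "j \<in> Y2" using ij by (auto simp: S'_def)
      have \<rho>: "\<rho> i \<in> X2" "\<rho> j \<in> X2" "\<pi> (\<rho> j) = j" using \<rho> i2 j2 by blast+
      have "mmul X1 F x (\<rho> i) (\<rho> j) = (\<Sum>k\<in>X1. F (\<rho> i) k * y k j)"
        unfolding mmul_def by (rule sum.cong) (use yX12 j2 in auto)
      moreover have "mmul X2 F x (\<rho> i) (\<rho> j) = (\<Sum>k\<in>X2. F (\<rho> i) k * y (\<pi> k) j)"
        unfolding mmul_def by (rule sum.cong) (use yYZ x22[of _ "\<rho> j"] j2 \<rho> \<pi> in auto)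
      moreover have "mmul X1 x F (\<rho> i) (\<rho> j) = 0" by (rule mmul_zero) (use x21 \<rho> in simp)
      moreover have "mmul X2 x F (\<rho> i) (\<rho> j) = (\<Sum>k\<in>X2. y i (\<pi> k) * F k (\<rho> j))"
        unfolding mmul_def by (rule sum.cong) (use yYZ x22 i2 \<pi> in auto)
      ultimately show ?thesis
        using XX[of "\<rho> i" "\<rho> j"] YY[OF ij(1,2) S] \<rho> i2 j2 unfolding e unfolding mmul_X by (simp add: algebra_simps)
    qed
  next
    fix i j assume ij: "i \<in> Y" "j \<in> Z" "S' j i"
    have e: "mmul Y y F i j = mmul Y x F i j" "mmul Z F y i j = mmul Z F x i j"
      by (rule mmul_cong; use yYZ ij in auto)+
    then show "mmul Z F y i j = mmul Y y F i j" using YZ[of i j] ij by (simp add: S'_def)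
  next
    fix i j assume ij: "i \<in> Z" "j \<in> Z" "S' j i"
    have e: "mmul Y y F i j = mmul Y x F i j" "mmul Z F y i j = mmul Z F x i j" "mmul Z y F i j = mmul Z x F i j"
      by (rule mmul_cong; use yYZ ij in auto)+
    then show "mmul Z F y i j = mmul Y y F i j + mmul Z y F i j" using ZZ[of i j] ij by (simp add: S'_def)
  qed
  then obtain c where c: "\<And>i j. \<lbrakk>i \<in> I - X2; j \<in> I - X2\<rbrakk> \<Longrightarrow> y i j = (if i = j then c else 0)"
    using rig unfolding rigid_by_def scalar_on_def by blast
  have cYZ: "x i j = (if i = j then c else 0)" if "i \<in> Y \<union> Z" "j \<in> Y \<union> Z" for i j
  proof -
    have "i \<in> I - X2" "j \<in> I - X2" using that disj I_eq by blast+
    then show ?thesis using c[of i j] yYZ[OF that] by simp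
  qed
  have cX: "x i j = (if i = j then c else 0)" if ij: "i \<in> X" "j \<in> X" for i j
  proof -
    consider "i \<in> X1" "j \<in> X1" | "i \<in> X1" "j \<in> X2" | "i \<in> X2" "j \<in> X1" | "i \<in> X2" "j \<in> X2"
      using ij by blast
    then show ?thesis
    proof cases
      case 1
      then show ?thesis using c[of i j] yX1 inI neq(1)[of i] neq(1)[of j] by auto
    next
      case 2
      then have "\<pi> j \<in> Y2" "\<rho> (\<pi> j) = j" using \<pi> by auto
      moreover have "i \<noteq> \<pi> j" "i \<noteq> j" using neq(1)[OF 2(1)] 2 \<open>\<pi> j \<in> Y2\<close> by auto
      ultimately show ?thesis
        using c[of i "\<pi> j"] yX12[of i "\<pi> j"] 2 inI neq(1)[of i] neq(4)[of "\<pi> j"] by auto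
    next
      case 3
      then have "i \<noteq> j" using neq(1)[of j] by blast
      then show ?thesis using x21[OF 3] by simp
    next
      case 4
      then have "x i j = x (\<pi> i) (\<pi> j)" using x22[of "\<pi> i" j] \<pi> by simp
      also have "\<dots> = (if \<pi> i = \<pi> j then c else 0)" using cYZ 4 \<pi> by simp
      also have "\<pi> i = \<pi> j \<longleftrightarrow> i = j" using \<pi>(2) 4 by metis
      finally show ?thesis .
    qed
  qed
  have XY2: "x i j = 0" if ij: "i \<in> X" "j \<in> Y2" for i j
  proof -
    have \<rho>: "\<rho> j \<in> X2" "\<pi> (\<rho> j) = j" using \<rho> ij by blast+
    have "mmul X F x i (\<rho> j) = F i (\<rho> j) * c" "mmul X x F i (\<rho> j) = c * F i (\<rho> j)"
      using mmul_scalar[of X x c, OF _ cX] fin \<rho> ij by auto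
    then show ?thesis using XX[of i "\<rho> j"] \<rho> ij by simp
  qed
  have XY1: "x i j = 0" if ij: "i \<in> X" "j \<in> Y1" for i j
  proof -
    have i2: "i \<in> X2" using ij degenerate by auto
    then have p: "\<pi> i \<in> Y2" "\<rho> (\<pi> i) = i" using \<pi> by auto
    have "mmul Y F x (\<pi> i) j = F (\<pi> i) j * c" "mmul Y x F (\<pi> i) j = c * F (\<pi> i) j"
      using mmul_scalar[of Y x c, OF _ cYZ] fin p ij by auto
    moreover have "mmul Z F x (\<pi> i) j = 0"
    proof (rule mmul_zero)
      fix k assume "k \<in> Z"
      then have "k \<noteq> j" using ij disj by blast
      then show "F (\<pi> i) k = 0 \<or> x k j = 0" using cYZ[of k j] \<open>k \<in> Z\<close> ij by simp
    qed
    ultimately show ?thesis using YY[of "\<pi> i" j] SY12[of j "\<pi> i"] p ij by simp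
  qed
  have "x i j = (if i = j then c else 0)" if ij: "i \<in> I" "j \<in> I" for i j
  proof -
    consider "i \<in> X" "j \<in> X" | "i \<in> X" "j \<in> Y" | "i \<in> X" "j \<in> Z" | "i \<in> Y \<union> Z" "j \<in> X" | "i \<in> Y \<union> Z" "j \<in> Y \<union> Z"
      using ij I_eq by blast
    then show ?thesis
    proof cases
      case 1 then show ?thesis by (rule cX)
    next
      case 2
      then have "x i j = 0" using XY1 XY2 by blast
      moreover have "i \<noteq> j" using 2 disj by blast
      ultimately show ?thesis by simp
    next
      case 3
      then have "x i j = 0" using x0 by blast
      moreover have "i \<noteq> j" using 3 disj by blast
      ultimately show ?thesis by simp
    next
      case 4
      then have "x i j = 0" using x0 by blast
      moreover have "i \<noteq> j" using 4 disj by blast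
      ultimately show ?thesis by simp
    next
      case 5 then show ?thesis by (rule cYZ)
    qed
  qed
  then show "scalar_on I x" unfolding scalar_on_def by blast
qed

text \<open>
  Conversely, a stabilising \<open>y\<close> for the reduced functional extends to a stabilising \<open>x\<close> for \<open>F\<close>:
  copy the entries of \<open>Y2\<close> to \<open>X2\<close>, and solve the equations for the entries of \<open>x\<close> in
  \<open>X \<times> Y2\<close> and \<open>X2 \<times> Y1\<close>, which occur there without a coefficient because \<open>F\<close> is the
  matching on \<open>Y \<times> X\<close>.
\<close>

lemma reduced_rigid:
  assumes nF: "normal F" and rig: "rigid_by I S F"
  shows "rigid_by (I - X2) S' (reduced F)"
  unfolding rigid_by_def
proof
  fix y assume y: "y \<in> stab (I - X2) S' (reduced F)"
  have supp: "supported (I - X2) S' y"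
    and XX: "\<And>i j. \<lbrakk>i\<in>X1; j\<in>X1\<rbrakk> \<Longrightarrow> mmul X1 F y i j = mmul X1 y F i j + (\<Sum>k\<in>X2. y i (\<pi> k) * F k j)"
    and YX: "\<And>i j. \<lbrakk>i\<in>Y2; j\<in>X1\<rbrakk> \<Longrightarrow> (\<Sum>k\<in>X1. F (\<rho> i) k * y k j) = (\<Sum>k\<in>X2. y i (\<pi> k) * F k j)"
    and YY: "\<And>i j. \<lbrakk>i\<in>Y; j\<in>Y; S' j i\<rbrakk> \<Longrightarrow>
       (if i \<in> Y2 then (\<Sum>k\<in>X1. F (\<rho> i) k * y k j) + (\<Sum>k\<in>X2. F (\<rho> i) k * y (\<pi> k) j) else 0)
        + mmul Y F y i j + mmul Z F y i j =
       mmul Y y F i j + (if j \<in> Y2 then (\<Sum>k\<in>X2. y i (\<pi> k) * F k (\<rho> j)) else 0)"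
    and YZ: "\<And>i j. \<lbrakk>i\<in>Y; j\<in>Z; S' j i\<rbrakk> \<Longrightarrow> mmul Z F y i j = mmul Y y F i j"
    and ZZ: "\<And>i j. \<lbrakk>i\<in>Z; j\<in>Z; S' j i\<rbrakk> \<Longrightarrow> mmul Z F y i j = mmul Y y F i j + mmul Z y F i j"
    using y unfolding stab'_iff[OF nF] by blast+
  have y0: "y i j = 0" if "i \<in> Y \<and> j \<in> X1 \<or> i \<in> X1 \<and> j \<in> Z \<or> i \<in> Z \<and> j \<in> X1 \<or> i \<in> Y \<and> j \<in> Z \<or> i \<in> Y1 \<and> j \<in> Y2" for i j
    using supp that nSYX nSXZ nSZX nSYZ unfolding supported_def S'_def by blast
  \<comment> \<open>the block on X: the entries of Y2 copied to X2 by the matching\<close>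
  define x0 where "x0 i j = (if i \<in> X1 \<and> j \<in> X1 then y i j else if i \<in> X1 \<and> j \<in> X2 then y i (\<pi> j)
     else if i \<in> X2 \<and> j \<in> X2 then y (\<pi> i) (\<pi> j) else 0)" for i j
  \<comment> \<open>the second and third line solve the equations on \<open>X \<times> X2\<close> and \<open>Y2 \<times> Y1\<close> for x\<close>
  define x where "x i j = (if i \<in> X \<and> j \<in> X then x0 i j
     else if i \<in> X \<and> j \<in> Y2 then mmul X F x0 i (\<rho> j) - mmul X x0 F i (\<rho> j)
     else if i \<in> X2 \<and> j \<in> Y1 then mmul Y y F (\<pi> i) j - mmul Y F y (\<pi> i) j - mmul Z F y (\<pi> i) j
     else if i \<in> Y \<union> Z \<and> j \<in> Y \<union> Z then y i j else 0)" for i j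
  have xX: "x i j = x0 i j" if "i \<in> X" "j \<in> X" for i j using that by (simp add: x_def)
  have x11: "x0 i j = y i j" if "i \<in> X1" "j \<in> X1" for i j using that by (simp add: x0_def)
  have x12: "x0 i j = y i (\<pi> j)" if "i \<in> X1" "j \<in> X2" for i j
    using that neq(2)[of j] by (simp add: x0_def)
  have x21: "x0 i j = 0" if "i \<in> X2" "j \<in> X1" for i j
    using that neq(1)[of j] neq(2)[of i] by (simp add: x0_def)
  have x22: "x0 i j = y (\<pi> i) (\<pi> j)" if "i \<in> X2" "j \<in> X2" for i j
    using that neq(2)[of i] by (simp add: x0_def)
  have xXY2: "x i j = mmul X F x0 i (\<rho> j) - mmul X x0 F i (\<rho> j)" if "i \<in> X" "j \<in> Y2" for i j
    using that neq(4)[of j] by (simp add: x_def)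
  have xXY1: "x i j = mmul Y y F (\<pi> i) j - mmul Y F y (\<pi> i) j - mmul Z F y (\<pi> i) j" if "i \<in> X2" "j \<in> Y1" for i j
    using that neq(3)[of j] by (simp add: x_def)
  have xYZ: "x i j = y i j" if "i \<in> Y \<union> Z" "j \<in> Y \<union> Z" for i j
  proof -
    have "i \<notin> X" using that disj by blast
    then show ?thesis using that by (simp add: x_def)
  qed
  have xsupp: "supported I S x"
    unfolding supported_def
  proof (intro allI impI)
    fix i j assume nz: "x i j \<noteq> 0"
    then consider "i \<in> X" "j \<in> X" | "i \<in> X" "j \<in> Y" | "i \<in> Y \<union> Z" "j \<in> Y \<union> Z"
      by (auto simp: x_def split: if_splits)
    then show "i \<in> I \<and> j \<in> I \<and> S i j"
    proof cases
      case 1 then show ?thesis using SXX I_eq by blast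
    next
      case 2 then show ?thesis using SXY I_eq by blast
    next
      case 3
      then have "y i j \<noteq> 0" using nz xYZ by simp
      then show ?thesis using supp unfolding supported_def S'_def by blast
    qed
  qed
  have "x \<in> stab I S F"
    unfolding stab_iff[OF nF]
  proof (intro conjI ballI impI xsupp)
    fix i j assume ij: "i \<in> X" "j \<in> X"
    have e: "mmul X F x i j = mmul X F x0 i j" "mmul X x F i j = mmul X x0 F i j"
      by (rule mmul_cong; use xX ij in simp)+
    show "mmul X F x i j = mmul X x F i j + (if j \<in> X2 then x i (\<pi> j) else 0)"
    proof (cases "j \<in> X2")
      case True
      then show ?thesis using xXY2[of i "\<pi> j"] ij \<pi> unfolding e by simp
    next
      case False
      then have j1: "j \<in> X1" using ij by blast
      have z: "mmul X2 F x0 i j = 0" by (rule mmul_zero) (use x21 j1 in simp)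
      show ?thesis
      proof (cases "i \<in> X1")
        case True
        have "mmul X1 F x0 i j = mmul X1 F y i j" "mmul X1 x0 F i j = mmul X1 y F i j"
          by (rule mmul_cong; use x11 True j1 in simp)+
        moreover have "mmul X2 x0 F i j = (\<Sum>k\<in>X2. y i (\<pi> k) * F k j)"
          unfolding mmul_def by (rule sum.cong) (use x12 True in auto)
        ultimately show ?thesis using XX[OF True j1] False z unfolding e unfolding mmul_X by simp
      next
        case i1: False
        then have i2: "i \<in> X2" using ij by blast
        have "mmul X1 F x0 i j = (\<Sum>k\<in>X1. F (\<rho> (\<pi> i)) k * y k j)"
          unfolding mmul_def by (rule sum.cong) (use x11 j1 i2 \<pi> in auto)
        moreover have "mmul X1 x0 F i j = 0" by (rule mmul_zero) (use x21 i2 in simp)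
        moreover have "mmul X2 x0 F i j = (\<Sum>k\<in>X2. y (\<pi> i) (\<pi> k) * F k j)"
          unfolding mmul_def by (rule sum.cong) (use x22 i2 in auto)
        ultimately show ?thesis using YX[of "\<pi> i" j] \<pi> i2 j1 False z unfolding e unfolding mmul_X by simp
      qed
    qed
  next
    fix i j assume ij: "i \<in> Y" "j \<in> X"
    have 1: "x (\<rho> i) j = (if j \<in> X2 then y i (\<pi> j) else 0)" if "i \<in> Y2"
      using \<rho>[OF that] x21[of "\<rho> i" j] x22[of "\<rho> i" j] xX[of "\<rho> i" j] ij by auto
    have 2: "x i (\<pi> j) = y i (\<pi> j)" if "j \<in> X2" using xYZ ij \<pi>(1)[OF that] by blast
    have 3: "y i (\<pi> j) = 0" if "j \<in> X2" "i \<notin> Y2" using y0 ij \<pi>(1)[OF that(1)] that by blast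
    show "(if i \<in> Y2 then x (\<rho> i) j else 0) = (if j \<in> X2 then x i (\<pi> j) else 0)"
      using 1 2 3 by simp
  next
    fix i j assume ij: "i \<in> Y" "j \<in> Y" "S j i"
    have e: "mmul Y F x i j = mmul Y F y i j" "mmul Y x F i j = mmul Y y F i j" "mmul Z F x i j = mmul Z F y i j"
      by (rule mmul_cong; use xYZ ij in auto)+
    show "(if i \<in> Y2 then x (\<rho> i) j else 0) + mmul Y F x i j + mmul Z F x i j = mmul Y x F i j"
    proof (cases "i \<in> Y2 \<and> j \<in> Y1")
      case True
      then show ?thesis using xXY1[of "\<rho> i" j] \<rho> unfolding e by simp
    next
      case nij: False
      then have S': "S' j i" using ij by (auto simp: S'_def)
      show ?thesis
      proof (cases "i \<in> Y2")
        case False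
        have "(\<Sum>k\<in>X2. y i (\<pi> k) * F k (\<rho> j)) = 0"
          by (rule sum.neutral) (use y0[of i] False ij \<pi> in auto)
        then show ?thesis using YY[OF ij(1,2) S'] False unfolding e by simp
      next
        case i2: True
        then have j2: "j \<in> Y2" using nij ij by blast
        have \<rho>: "\<rho> i \<in> X2" "\<rho> j \<in> X2" "\<pi> (\<rho> j) = j" "\<pi> (\<rho> i) = i" using \<rho> i2 j2 by blast+
        have "mmul X1 F x0 (\<rho> i) (\<rho> j) = (\<Sum>k\<in>X1. F (\<rho> i) k * y k j)"
          unfolding mmul_def by (rule sum.cong) (use x12 \<rho> in auto)
        moreover have "mmul X2 F x0 (\<rho> i) (\<rho> j) = (\<Sum>k\<in>X2. F (\<rho> i) k * y (\<pi> k) j)"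
          unfolding mmul_def by (rule sum.cong) (use x22 \<rho> in auto)
        moreover have "mmul X1 x0 F (\<rho> i) (\<rho> j) = 0" by (rule mmul_zero) (use x21 \<rho> in simp)
        moreover have "mmul X2 x0 F (\<rho> i) (\<rho> j) = (\<Sum>k\<in>X2. y i (\<pi> k) * F k (\<rho> j))"
          unfolding mmul_def by (rule sum.cong) (use x22 \<rho> in auto)
        ultimately have xe: "x (\<rho> i) j = (\<Sum>k\<in>X1. F (\<rho> i) k * y k j) + (\<Sum>k\<in>X2. F (\<rho> i) k * y (\<pi> k) j)
            - (\<Sum>k\<in>X2. y i (\<pi> k) * F k (\<rho> j))"
          using xXY2[of "\<rho> i" j] \<rho> j2 unfolding mmul_X by simp
        show ?thesis using YY[OF ij(1,2) S'] i2 j2 unfolding e xe by (simp add: algebra_simps)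
      qed
    qed
  next
    fix i j assume ij: "i \<in> Y" "j \<in> Z" "S j i"
    have e: "mmul Y x F i j = mmul Y y F i j" "mmul Z F x i j = mmul Z F y i j"
      by (rule mmul_cong; use xYZ ij in auto)+
    have "S' j i" using ij neq(5)[of j] by (simp add: S'_def)
    then show "mmul Z F x i j = mmul Y x F i j" using YZ[of i j] ij e by simp
  next
    fix i j assume ij: "i \<in> Z" "j \<in> Z" "S j i"
    have e: "mmul Y x F i j = mmul Y y F i j" "mmul Z F x i j = mmul Z F y i j" "mmul Z x F i j = mmul Z y F i j"
      by (rule mmul_cong; use xYZ ij in auto)+
    have "S' j i" using ij neq(5)[of j] by (simp add: S'_def)
    then show "mmul Z F x i j = mmul Y x F i j + mmul Z x F i j" using ZZ[of i j] ij e by simp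
  qed
  then obtain c where c: "\<And>i j. \<lbrakk>i \<in> I; j \<in> I\<rbrakk> \<Longrightarrow> x i j = (if i = j then c else 0)"
    using rig unfolding rigid_by_def scalar_on_def by blast
  have "y i j = (if i = j then c else 0)" if ij: "i \<in> I - X2" "j \<in> I - X2" for i j
  proof -
    consider "i \<in> X1" "j \<in> X1" | "i \<in> X1" "j \<in> Y1" | "i \<in> X1" "j \<in> Y2" | "i \<in> X1" "j \<in> Z"
      | "i \<in> Y \<union> Z" "j \<in> X1" | "i \<in> Y \<union> Z" "j \<in> Y \<union> Z"
      using ij I_eq by blast
    then show ?thesis
    proof cases
      case 1 then show ?thesis using c[of i j] xX[of i j] x11 ij by simp
    next
      case 2 then show ?thesis using degenerate by auto
    next
      case 3
      then have r: "\<rho> j \<in> X2" "\<pi> (\<rho> j) = j" using \<rho> by auto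
      then have "y i j = x i (\<rho> j)" using x12[of i "\<rho> j"] xX[of i "\<rho> j"] 3 by simp
      moreover have "i \<noteq> j" "i \<noteq> \<rho> j" using neq(1)[OF 3(1)] 3 r by auto
      ultimately show ?thesis using c[of i "\<rho> j"] inI r 3 by simp
    next
      case 4
      then have "y i j = 0" "i \<noteq> j" using y0 disj by blast+
      then show ?thesis by simp
    next
      case 5
      then have "y i j = 0" "i \<noteq> j" using y0 disj by blast+
      then show ?thesis by simp
    next
      case 6 then show ?thesis using c[of i j] xYZ[of i j] ij by simp
    qed
  qed
  then show "scalar_on (I - X2) y" unfolding scalar_on_def by blast
qed

end

text \<open>
  A functional on the pattern \<open>S\<close> only sees the entries at the transposed positions.
\<close>

lemma stab_cong:
  assumes trans: "\<And>i j k. \<lbrakk>i \<in> I; j \<in> I; k \<in> I; S i j; S j k\<rbrakk> \<Longrightarrow> S i k"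
    and eq: "\<And>i j. \<lbrakk>i \<in> I; j \<in> I; S j i\<rbrakk> \<Longrightarrow> F i j = G i j"
  shows "stab I S F = stab I S G"
proof -
  have "mmul I F x i j = mmul I G x i j" "mmul I x F i j = mmul I x G i j"
    if x: "supported I S x" and ij: "i \<in> I" "j \<in> I" "S j i" for x i j
  proof -
    have "F i k * x k j = G i k * x k j" if "k \<in> I" for k
    proof (cases "x k j = 0")
      case False
      then have "S k i" using x ij that trans unfolding supported_def by blast
      then show ?thesis using eq ij that by simp
    qed simp
    then show "mmul I F x i j = mmul I G x i j" unfolding mmul_def by (rule sum.cong[OF refl])
    have "x i k * F k j = x i k * G k j" if "k \<in> I" for k
    proof (cases "x i k = 0")
      case False
      then have "S j k" using x ij that trans unfolding supported_def by blast
      then show ?thesis using eq ij that by simp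
    qed simp
    then show "mmul I x F i j = mmul I x G i j" unfolding mmul_def by (rule sum.cong[OF refl])
  qed
  then show ?thesis unfolding stab_def by auto
qed

context block_split
begin

text \<open>
  Since \<open>X2 \<times> X2\<close> belongs to the pattern, conjugation by an invertible matrix that acts on
  \<open>X2\<close> alone is allowed, and it multiplies the block \<open>Y2 \<times> X2\<close> by an arbitrary invertible
  matrix.
\<close>

lemma normalize_diagonal:
  fixes F :: "'i \<Rightarrow> 'i \<Rightarrow> 'k::field"
  assumes rig: "rigid_by I S F"
    and ker: "\<And>v. (\<forall>i\<in>X2. (\<Sum>j\<in>X2. F (\<pi> i) j * v j) = 0) \<Longrightarrow> \<forall>j\<in>X2. v j = 0"
  obtains F' :: "'i \<Rightarrow> 'i \<Rightarrow> 'k" where "rigid_by I S F'"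
    "\<And>i j. \<lbrakk>i \<in> Y2; j \<in> X2\<rbrakk> \<Longrightarrow> F' i j = (if i = \<pi> j then 1 else 0)"
proof -
  define M where "M i j = F (\<pi> i) j" for i j
  obtain B where MB: "\<And>i j. \<lbrakk>i \<in> X2; j \<in> X2\<rbrakk> \<Longrightarrow> mmul X2 M B i j = (if i = j then 1 else 0)"
    and BM: "\<And>i j. \<lbrakk>i \<in> X2; j \<in> X2\<rbrakk> \<Longrightarrow> mmul X2 B M i j = (if i = j then 1 else 0)"
  proof (rule square_inverse[OF fin(2), of M])
    fix v assume "\<forall>i\<in>X2. (\<Sum>j\<in>X2. M i j * v j) = 0"
    then show "\<forall>j\<in>X2. v j = 0" using ker unfolding M_def by blast
  qed blast
  define E where "E A i j = (if i \<in> X2 \<and> j \<in> X2 then A i j else if i = j \<and> i \<in> I then 1 else 0)"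
    for A :: "'i \<Rightarrow> 'i \<Rightarrow> 'k" and i j
  have X2I: "X2 \<subseteq> I" using I_eq by blast
  have row: "mmul I (E A) C i j = (if i \<in> X2 then mmul X2 A C i j else C i j)" if "i \<in> I" for A C i j
  proof (cases "i \<in> X2")
    case True
    have "mmul I (E A) C i j = mmul X2 (E A) C i j"
      unfolding mmul_def
      by (rule sum.mono_neutral_right) (use finI X2I True in \<open>auto simp: E_def\<close>)
    also have "\<dots> = mmul X2 A C i j" by (rule mmul_cong) (use True in \<open>auto simp: E_def\<close>)
    finally show ?thesis using True by simp
  next
    case False
    have "mmul I (E A) C i j = (\<Sum>k\<in>I. if k = i then C i j else 0)"
      unfolding mmul_def by (rule sum.cong) (use False that in \<open>auto simp: E_def\<close>)
    then show ?thesis using False finI that by simp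
  qed
  have col: "mmul I C (E A) i j = mmul X2 C A i j" if "j \<in> X2" for A C i j
  proof -
    have "mmul I C (E A) i j = mmul X2 C (E A) i j"
      unfolding mmul_def
      by (rule sum.mono_neutral_right) (use finI X2I that in \<open>auto simp: E_def\<close>)
    also have "\<dots> = mmul X2 C A i j" by (rule mmul_cong) (use that in \<open>auto simp: E_def\<close>)
    finally show ?thesis .
  qed
  have inv: "mmul I (E A) (E A') i j = (if i = j then 1 else 0)"
    if ij: "i \<in> I" "j \<in> I" and AA: "\<And>i j. \<lbrakk>i \<in> X2; j \<in> X2\<rbrakk> \<Longrightarrow> mmul X2 A A' i j = (if i = j then 1 else 0)"
    for A A' i j
  proof (cases "i \<in> X2")
    case True
    show ?thesis
    proof (cases "j \<in> X2")
      case j: True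
      have "mmul X2 A (E A') i j = mmul X2 A A' i j"
        by (rule mmul_cong) (use j in \<open>auto simp: E_def\<close>)
      then show ?thesis using row[OF ij(1)] True j AA by simp
    next
      case j: False
      have "mmul X2 A (E A') i j = 0"
        by (rule mmul_zero) (use j in \<open>auto simp: E_def\<close>)
      then show ?thesis using row[OF ij(1)] True j by auto
    qed
  next
    case False
    then show ?thesis using row[OF ij(1)] ij by (auto simp: E_def)
  qed
  have supp: "supported I S (E A)" for A
    unfolding supported_def
  proof (intro allI impI)
    fix i j assume "E A i j \<noteq> 0"
    then have "i = j \<and> i \<in> I \<or> i \<in> X2 \<and> j \<in> X2" by (auto simp: E_def split: if_splits)
    then show "i \<in> I \<and> j \<in> I \<and> S i j" using SXX refl X2I by blast
  qed
  let ?F = "mmul I (E M) (mmul I F (E B))"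
  have "rigid_by I S ?F"
    by (rule rigid_conj[OF finI trans supp supp inv[OF _ _ MB] inv[OF _ _ BM] rig])
  moreover have "?F i j = (if i = \<pi> j then 1 else 0)" if ij: "i \<in> Y2" "j \<in> X2" for i j
  proof -
    have r: "\<rho> i \<in> X2" "\<pi> (\<rho> i) = i" using \<rho> ij by auto
    have "?F i j = mmul X2 F B i j"
      using row[OF inI(4)[OF ij(1)]] neq(4)[OF ij(1)] col[OF ij(2)] by simp
    also have "\<dots> = mmul X2 M B (\<rho> i) j"
      by (simp add: mmul_def M_def r)
    also have "\<dots> = (if \<rho> i = j then 1 else 0)" using MB r ij by simp
    also have "\<rho> i = j \<longleftrightarrow> i = \<pi> j" using \<pi>(2)[OF ij(2)] r by auto
    finally show ?thesis .
  qed
  ultimately show thesis using that by blast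
qed

text \<open>
  Row and column operations with the matched block as pivot clear the unmatched rows \<open>Y1\<close> or
  columns \<open>X1\<close>. They are conjugations by \<open>1 + n\<close> with \<open>n\<close> of square zero, supported on
  \<open>Y1 \<times> Y2\<close> and \<open>X2 \<times> X1\<close>.
\<close>

lemma normalize_unipotent:
  fixes F :: "'i \<Rightarrow> 'i \<Rightarrow> 'k::field"
  assumes rig: "rigid_by I S F"
    and F22: "\<And>i j. \<lbrakk>i \<in> Y2; j \<in> X2\<rbrakk> \<Longrightarrow> F i j = (if i = \<pi> j then 1 else 0)"
  obtains F' :: "'i \<Rightarrow> 'i \<Rightarrow> 'k" where "rigid_by I S F'" "normal F'"
proof -
  \<comment> \<open>rows \<open>Y1\<close> are cleared from the left, columns \<open>X1\<close> from the right; by \<open>degenerate\<close> one of the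
      two is void\<close>
  define n where "n i j = (if i \<in> X2 \<and> j \<in> X1 then F (\<pi> i) j
     else if i \<in> Y1 \<and> j \<in> Y2 then - F i (\<rho> j) else 0)" for i j
  define U where "U c i j = (if i = j \<and> i \<in> I then 1 else 0) + c * n i j" for c :: 'k and i j
  have nn: "n i k * n k j = 0" for i j k
    using neq(1)[of k] neq(4)[of k] by (simp add: n_def)
  have n0: "n i j = 0" if "i \<notin> I \<or> j \<notin> I" for i j
    using that I_eq by (auto simp: n_def)
  have Urow: "mmul I (U c) C i j = C i j + c * mmul I n C i j" if "i \<in> I" for c C i j
  proof -
    have "mmul I (U c) C i j = (\<Sum>k\<in>I. (if k = i then C i j else 0) + c * (n i k * C k j))"
      unfolding mmul_def by (rule sum.cong) (use that in \<open>auto simp: U_def distrib_right mult.assoc\<close>)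
    then show ?thesis using finI that by (simp add: sum.distrib sum_distrib_left mmul_def)
  qed
  have Ucol: "mmul I C (U c) i j = C i j + c * mmul I C n i j" if "j \<in> I" for c C i j
  proof -
    have "mmul I C (U c) i j = (\<Sum>k\<in>I. (if k = j then C i j else 0) + c * (C i k * n k j))"
      unfolding mmul_def by (rule sum.cong) (use that in \<open>auto simp: U_def distrib_left mult.left_commute\<close>)
    then show ?thesis using finI that by (simp add: sum.distrib sum_distrib_left mmul_def)
  qed
  have inv: "mmul I (U c) (U (- c)) i j = (if i = j then 1 else 0)" if ij: "i \<in> I" "j \<in> I" for c i j
  proof -
    have "mmul I n n i j = 0" by (rule mmul_zero) (use nn in auto)
    then have "mmul I n (U (- c)) i j = n i j" using Ucol[OF ij(2)] by simp
    then show ?thesis using Urow[OF ij(1)] ij by (simp add: U_def)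
  qed
  have supp: "supported I S (U c)" for c
    unfolding supported_def
  proof (intro allI impI)
    fix i j assume "U c i j \<noteq> 0"
    then have "i = j \<and> i \<in> I \<or> i \<in> X2 \<and> j \<in> X1 \<or> i \<in> Y1 \<and> j \<in> Y2"
      by (auto simp: U_def n_def split: if_splits)
    then show "i \<in> I \<and> j \<in> I \<and> S i j" using SXX SY12 refl I_eq by blast
  qed
  let ?F = "mmul I (U 1) (mmul I F (U (- 1)))"
  have rigF: "rigid_by I S ?F"
    by (rule rigid_conj[OF finI trans supp supp _ _ rig]) (use inv[of _ _ 1] inv[of _ _ "-1"] in auto)
  have FYX: "?F i j = (if j \<in> X2 \<and> i = \<pi> j then 1 else 0)" if ij: "i \<in> Y" "j \<in> X" for i j
  proof -
    have iI: "i \<in> I" and jI: "j \<in> I" using ij I_eq by blast+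
    have F1: "?F i j = mmul I F (U (-1)) i j + mmul I n (mmul I F (U (-1))) i j"
      using Urow[OF iI] by simp
    consider "i \<in> Y1" "j \<in> X2" | "i \<in> Y2" "j \<in> X1" | "i \<in> Y2" "j \<in> X2"
      using ij degenerate by blast
    then show ?thesis
    proof cases
      case 1
      have j0: "mmul I C (U (-1)) k j = C k j" for C k
      proof -
        have "mmul I C n k j = 0"
          by (rule mmul_zero) (use 1 neq(2)[of j] in \<open>auto simp: n_def\<close>)
        then show ?thesis using Ucol[OF jI, of C "-1"] by simp
      qed
      have p: "\<pi> j \<in> Y2" "\<rho> (\<pi> j) = j" using \<pi> 1 by auto
      have "mmul I n F i j = (\<Sum>k\<in>I. if k = \<pi> j then n i (\<pi> j) else 0)"
        unfolding mmul_def
      proof (rule sum.cong)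
        fix k assume "k \<in> I"
        show "n i k * F k j = (if k = \<pi> j then n i (\<pi> j) else 0)"
        proof (cases "k \<in> Y2")
          case True
          then show ?thesis using F22[OF True] 1 by simp
        next
          case False
          then show ?thesis using 1 neq(3)[of i] p by (auto simp: n_def)
        qed
      qed simp
      then have "mmul I n F i j = n i (\<pi> j)" using finI inI(4)[OF p(1)] by simp
      also have "\<dots> = - F i j" using 1 p neq(3)[of i] by (simp add: n_def)
      finally have "mmul I n F i j = - F i j" .
      then have "?F i j = 0" unfolding F1 by (simp add: j0 mmul_assoc[symmetric])
      moreover have "i \<noteq> \<pi> j" using neq(3)[OF 1(1)] p by blast
      ultimately show ?thesis by simp
    next
      case 2
      have "mmul I n C i j = 0" for C
        by (rule mmul_zero) (use 2 neq(4)[of i] in \<open>auto simp: n_def\<close>)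
      then have F2: "?F i j = F i j - mmul I F n i j" unfolding F1 using Ucol[OF jI, of F "-1"] by simp
      have r: "\<rho> i \<in> X2" "\<pi> (\<rho> i) = i" using \<rho> 2 by auto
      have "mmul I F n i j = (\<Sum>k\<in>I. if k = \<rho> i then n k j else 0)"
        unfolding mmul_def
      proof (rule sum.cong)
        fix k assume "k \<in> I"
        show "F i k * n k j = (if k = \<rho> i then n k j else 0)"
        proof (cases "k \<in> X2")
          case True
          have "i = \<pi> k \<longleftrightarrow> k = \<rho> i" using \<pi>(2)[OF True] r by auto
          then show ?thesis using F22[OF 2(1) True] by simp
        next
          case False
          then show ?thesis using 2 neq(1)[of j] r by (auto simp: n_def)
        qed
      qed simp
      then have "mmul I F n i j = n (\<rho> i) j" using finI inI(2)[OF r(1)] by simp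
      also have "\<dots> = F i j" using 2 r by (simp add: n_def)
      finally show ?thesis using F2 neq(1)[OF 2(2)] by simp
    next
      case 3
      have "mmul I n C i j = 0" for C
        by (rule mmul_zero) (use 3 neq(4)[of i] in \<open>auto simp: n_def\<close>)
      moreover have "mmul I F n i j = 0"
        by (rule mmul_zero) (use 3 neq(2)[of j] in \<open>auto simp: n_def\<close>)
      ultimately have "?F i j = F i j" unfolding F1 using Ucol[OF jI, of F "-1"] by simp
      then show ?thesis using F22 3 by simp
    qed
  qed
  define F' where "F' i j = (if i \<in> I \<and> j \<in> I \<and> S j i then ?F i j else 0)" for i j
  have "stab I S F' = stab I S ?F" by (rule stab_cong[OF trans]) (auto simp: F'_def)
  then have "rigid_by I S F'" using rigF unfolding rigid_by_def by simp
  moreover have "normal F'"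
    unfolding normal_def
  proof (intro conjI ballI allI impI)
    fix i j assume "i \<in> Y" "j \<in> X"
    then show "F' i j = (if j \<in> X2 \<and> i = \<pi> j then 1 else 0)"
      using FYX SXY[of j i] I_eq unfolding F'_def by auto
  qed (auto simp: F'_def split: if_splits)
  ultimately show thesis using that by blast
qed

text \<open>
  From left to right, a generic point of the line from a rigid functional to the matching is both
  rigid and invertible on \<open>Y2 \<times> X2\<close>, hence can be normalised and reduced. From right to
  left, every functional on the smaller pattern is the reduction of a normal one.
\<close>

theorem rigid_reduction:
  assumes inf: "infinite (UNIV :: 'k::field set)"
  shows "(\<exists>F :: 'i \<Rightarrow> 'i \<Rightarrow> 'k. rigid_by I S F) \<longleftrightarrow> (\<exists>F :: 'i \<Rightarrow> 'i \<Rightarrow> 'k. rigid_by (I - X2) S' F)"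
proof
  assume "\<exists>F :: 'i \<Rightarrow> 'i \<Rightarrow> 'k. rigid_by I S F"
  then obtain F0 :: "'i \<Rightarrow> 'i \<Rightarrow> 'k" where F0: "rigid_by I S F0" by blast
  \<comment> \<open>the matching itself, as a functional that is invertible on \<open>Y2 \<times> X2\<close>\<close>
  define F1 where "F1 i j = (if i = \<pi> j then 1 else 0 :: 'k)" for i j
  define c where "c i j = [:F0 (\<pi> i) j, F1 (\<pi> i) j - F0 (\<pi> i) j:]" for i j
  have "finite {s. \<not> rigid_by I S (\<lambda>i j. F0 i j + s * (F1 i j - F0 i j))}" (is "finite ?A")
    by (rule rigid_generic[OF finI F0 refl])
  moreover have "finite {s. \<exists>v. (\<forall>i\<in>X2. (\<Sum>j\<in>X2. poly (c i j) s * v j) = 0) \<and> (\<exists>j\<in>X2. v j \<noteq> 0)}" (is "finite ?B")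
  proof (rule kernel_generic[OF fin(2), where z = 1])
    fix v assume v: "\<forall>i\<in>X2. (\<Sum>j\<in>X2. poly (c i j) 1 * v j) = 0"
    show "\<forall>j\<in>X2. v j = 0"
    proof
      fix i assume i: "i \<in> X2"
      have "(\<Sum>j\<in>X2. poly (c i j) 1 * v j) = (\<Sum>j\<in>X2. if j = i then v i else 0)"
      proof (rule sum.cong)
        fix j assume "j \<in> X2"
        then have "\<pi> i = \<pi> j \<longleftrightarrow> j = i" using \<pi>(2) i by metis
        then show "poly (c i j) 1 * v j = (if j = i then v i else 0)" by (simp add: c_def F1_def)
      qed simp
      then show "v i = 0" using v i fin by simp
    qed
  qed
  ultimately have "finite (?A \<union> ?B)" by (rule finite_UnI)
  then have "?A \<union> ?B \<noteq> UNIV" using inf by metis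
  then obtain s where s: "s \<notin> ?A" "s \<notin> ?B" by blast
  define F where "F i j = F0 i j + s * (F1 i j - F0 i j)" for i j
  have "rigid_by I S F" using s(1) by (simp add: F_def[abs_def])
  moreover have "\<forall>j\<in>X2. v j = 0" if "\<forall>i\<in>X2. (\<Sum>j\<in>X2. F (\<pi> i) j * v j) = 0" for v
    using s(2) that by (auto simp: F_def c_def algebra_simps)
  ultimately obtain F2 :: "'i \<Rightarrow> 'i \<Rightarrow> 'k" where "rigid_by I S F2"
    "\<And>i j. \<lbrakk>i \<in> Y2; j \<in> X2\<rbrakk> \<Longrightarrow> F2 i j = (if i = \<pi> j then 1 else 0)"
    using normalize_diagonal[of F] by blast
  then obtain F3 :: "'i \<Rightarrow> 'i \<Rightarrow> 'k" where "rigid_by I S F3" "normal F3"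
    using normalize_unipotent[of F2] by blast
  then show "\<exists>F :: 'i \<Rightarrow> 'i \<Rightarrow> 'k. rigid_by (I - X2) S' F" using reduced_rigid by blast
next
  assume "\<exists>F :: 'i \<Rightarrow> 'i \<Rightarrow> 'k. rigid_by (I - X2) S' F"
  then obtain F' :: "'i \<Rightarrow> 'i \<Rightarrow> 'k" where F': "rigid_by (I - X2) S' F'" by blast
  \<comment> \<open>The rows Y2 of F' restricted to X1 are stored in the rows X2, from where the reduction takes
      them back; otherwise the removed indices contribute nothing.\<close>
  define F where "F i j = (if i \<in> Y \<and> j \<in> X then if j \<in> X2 \<and> i = \<pi> j then 1 else 0
     else if i \<in> X2 \<and> j \<in> X1 then F' (\<pi> i) j
     else if i \<in> X2 \<or> j \<in> X2 then 0
     else if i \<in> I \<and> j \<in> I \<and> S j i then F' i j else 0)" for i j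
  have "i \<in> I \<and> j \<in> I \<and> S j i" if "F i j \<noteq> 0" for i j
  proof -
    have "i \<in> Y \<and> j \<in> X \<or> i \<in> X2 \<and> j \<in> X1 \<or> i \<in> I \<and> j \<in> I \<and> S j i"
      using that by (auto simp: F_def split: if_splits)
    then show ?thesis using SXY SXX I_eq by blast
  qed
  moreover have "F i j = (if j \<in> X2 \<and> i = \<pi> j then 1 else 0)" if "i \<in> Y" "j \<in> X" for i j
    using that by (simp add: F_def)
  ultimately have nF: "normal F" unfolding normal_def by blast
  have trans': "S' i k" if "i \<in> I - X2" "j \<in> I - X2" "k \<in> I - X2" "S' i j" "S' j k" for i j k
  proof -
    have "S i k" using that trans unfolding S'_def by blast
    moreover have "\<not> (i \<in> Y1 \<and> k \<in> Y2)"
    proof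
      assume ik: "i \<in> Y1 \<and> k \<in> Y2"
      then have "j \<notin> X" "j \<notin> Z" "j \<notin> Y2" "j \<notin> Y1"
        using that nSYX[of i j] nSYZ[of i j] unfolding S'_def by blast+
      then show False using that I_eq by blast
    qed
    ultimately show ?thesis by (simp add: S'_def)
  qed
  have "stab (I - X2) S' (reduced F) = stab (I - X2) S' F'"
  proof (rule stab_cong[OF trans'])
    fix i j assume ij: "i \<in> I - X2" "j \<in> I - X2" "S' j i"
    then consider "i \<in> X1" "j \<in> X1" | "i \<in> Y1" "j \<in> X1" | "i \<in> Y2" "j \<in> X1" | "i \<in> Y2" "j \<in> Y2"
      | "i \<in> Y1" "j \<in> Y" | "i \<in> Y" "j \<in> Z" | "i \<in> Z" "j \<in> Z"
      using I_eq nSYX[of j i] nSXZ[of j i] nSZX[of j i] nSYZ[of j i] unfolding S'_def by blast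
    then show "reduced F i j = F' i j"
    proof cases
      case 1
      then show ?thesis using neq(1)[of i] neq(1)[of j] ij by (simp add: reduced_def F_def S'_def)
    next
      case 2
      then show ?thesis using degenerate by blast
    next
      case 3
      then show ?thesis using neq(1)[of j] neq(2)[of "\<rho> i"] \<rho>[of i] by (simp add: reduced_def F_def)
    next
      case 4
      have "F (\<rho> i) (\<rho> j) = 0"
        using neq(2)[of "\<rho> i"] neq(2)[of "\<rho> j"] \<rho>(1)[OF 4(1)] \<rho>(1)[OF 4(2)] by (simp add: F_def)
      then show ?thesis using 4 neq(4)[of i] neq(4)[of j] ij by (simp add: reduced_def F_def S'_def)
    next
      case 5
      have "j \<notin> X" "i \<notin> X" "i \<notin> Y2" using 5 disj by blast+
      then show ?thesis using ij by (simp add: reduced_def F_def S'_def)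
    next
      case 6
      have "j \<notin> X" "i \<notin> X" "j \<notin> Y" using 6 disj by blast+
      then show ?thesis using ij by (simp add: reduced_def F_def S'_def)
    next
      case 7
      have "j \<notin> X" "i \<notin> X" "i \<notin> Y" using 7 disj by blast+
      then show ?thesis using ij by (simp add: reduced_def F_def S'_def)
    qed
  qed
  then have "rigid_by (I - X2) S' (reduced F)" using F' unfolding rigid_by_def by simp
  then show "\<exists>F :: 'i \<Rightarrow> 'i \<Rightarrow> 'k. rigid_by I S F" using rigid_if_reduced[OF nF] by blast
qed

end

section \<open>Seaweed patterns and meanders\<close>

text \<open>
  Reflects every block of a composition; the first equation fixes all indices beyond the last
  block.
\<close>

fun refl_in :: "nat list \<Rightarrow> nat \<Rightarrow> nat" where
  "refl_in [] i = i"
| "refl_in (x # a) i = (if i < x then x - 1 - i else x + refl_in a (i - x))"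

text \<open>
  Holds if the block of \<open>i\<close> is the block of \<open>j\<close> or comes before it, where all indices beyond the
  last part count as one more block.
\<close>

fun below :: "nat list \<Rightarrow> nat \<Rightarrow> nat \<Rightarrow> bool" where
  "below [] i j = True"
| "below (x # a) i j = (i < x \<or> \<not> j < x \<and> below a (i - x) (j - x))"

text \<open>
  The pattern of a seaweed (or biparabolic) subalgebra of \<open>gl\<^sub>n\<close>. For \<open>b = [n]\<close> the second
  condition holds for all indices below \<open>n\<close>, and the subalgebra is parabolic.
\<close>

definition seaweed :: "nat list \<Rightarrow> nat list \<Rightarrow> nat \<Rightarrow> nat \<Rightarrow> bool" where
  "seaweed a b i j \<longleftrightarrow> below a i j \<and> below b j i"

definition rigid :: "'k::field itself \<Rightarrow> nat list \<Rightarrow> nat list \<Rightarrow> bool" where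
  "rigid K a b \<longleftrightarrow> (\<exists>F :: nat \<Rightarrow> nat \<Rightarrow> 'k. rigid_by {..<sum_list a} (seaweed a b) F)"

text \<open>
  Connectedness of the graph that joins every \<open>x\<close> to \<open>s x\<close> and to \<open>t x\<close>, expressed by its closed
  subsets so that no walks are needed.
\<close>

definition connected_under :: "'i set \<Rightarrow> ('i \<Rightarrow> 'i) \<Rightarrow> ('i \<Rightarrow> 'i) \<Rightarrow> bool" where
  "connected_under I s t \<longleftrightarrow> I \<noteq> {} \<and> (\<forall>A\<subseteq>I. A \<noteq> {} \<longrightarrow> s ` A \<subseteq> A \<longrightarrow> t ` A \<subseteq> A \<longrightarrow> A = I)"

text \<open>
  A connected graph formed by two involutions is a path or a cycle. The ends of a path are fixed
  points of the reflections, and a reflection fixes a point exactly in a block of odd size; so the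
  second conjunct excludes the cycles.
\<close>

definition meander_path :: "nat list \<Rightarrow> nat list \<Rightarrow> bool" where
  "meander_path a b \<longleftrightarrow> connected_under {..<sum_list a} (refl_in a) (refl_in b) \<and> (\<exists>x\<in>set a \<union> set b. odd x)"

lemma below_mono: "i \<le> j \<Longrightarrow> below a i j"
  by (induction a i j rule: below.induct) auto

lemma below_trans: "below a i j \<Longrightarrow> below a j k \<Longrightarrow> below a i k"
proof (induction a arbitrary: i j k)
  case (Cons x a)
  then show ?case using Cons.IH[of "i - x" "j - x" "k - x"] by auto
qed simp

lemma seaweed_refl: "seaweed a b i i"
  by (simp add: seaweed_def below_mono)

lemma refl_in_less: "i < sum_list a \<Longrightarrow> refl_in a i < sum_list a"
proof (induction a arbitrary: i)
  case (Cons x a)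
  show ?case
  proof (cases "i < x")
    case False
    then have "refl_in a (i - x) < sum_list a" using Cons by (intro Cons.IH) auto
    then show ?thesis using False by simp
  qed simp
qed simp

lemma refl_in_invol: "refl_in a (refl_in a i) = i"
  by (induction a arbitrary: i) auto

lemma zero_block [simp]: "refl_in (0 # a) = refl_in a" "below (0 # a) = below a"
  by (auto simp: fun_eq_iff)

text \<open>
  Panyushev's reduction of seaweed subalgebras as an induction rule. Every step removes as many
  coordinates as the smaller of the first part of \<open>a\<close> and the surplus of the first part of \<open>b\<close>
  over it, until the first parts agree; \<open>swap\<close> covers the case where the first part of \<open>b\<close> is the
  smaller one.
\<close>

lemma seaweed_induct [consumes 1, case_names swap nil zero eq short long]:
  fixes a b :: "nat list"
  assumes "sum_list a = sum_list b"
    and swap: "\<And>a b. sum_list a = sum_list b \<Longrightarrow> P a b \<Longrightarrow> P b a"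
    and nil: "\<And>a b. sum_list a = 0 \<Longrightarrow> sum_list b = 0 \<Longrightarrow> P a b"
    and zero: "\<And>a b. sum_list a = sum_list b \<Longrightarrow> P a b \<Longrightarrow> P (0 # a) b"
    and eq: "\<And>d a b. 0 < d \<Longrightarrow> sum_list a = sum_list b \<Longrightarrow> P (d # a) (d # b)"
    and short: "\<And>d c a b. \<lbrakk>0 < d; d \<le> c; sum_list a = c + sum_list b; P a ((c - d) # d # b)\<rbrakk> \<Longrightarrow> P (d # a) ((d + c) # b)"
    and long: "\<And>d c a b. \<lbrakk>0 < c; c < d; sum_list a = c + sum_list b; P ((d - c) # a) (d # b)\<rbrakk> \<Longrightarrow> P (d # a) ((d + c) # b)"
  shows "P a b"
  using assms(1)
proof (induction "sum_list a + sum_list b + length a + length b" arbitrary: a b rule: less_induct)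
  case less
  note IH = less.hyps
  have step: "P (d # a) (e # b)" if d: "0 < d" "d < e" and s: "sum_list (d # a) = sum_list (e # b)"
    and IH: "\<And>a' b'. \<lbrakk>sum_list a' + sum_list b' + length a' + length b' < sum_list (d # a) + sum_list (e # b) + length (d # a) + length (e # b); sum_list a' = sum_list b'\<rbrakk> \<Longrightarrow> P a' b'"
    for d e a b
  proof -
    define c where "c = e - d"
    have e: "e = d + c" "0 < c" using d by (auto simp: c_def)
    have sa: "sum_list a = c + sum_list b" using s e by simp
    show ?thesis
    proof (cases "d \<le> c")
      case True
      then have "P a ((c - d) # d # b)" using d e sa by (intro IH) auto
      then show ?thesis unfolding e using short d True sa by blast
    next
      case False
      then have "P ((d - c) # a) (d # b)" using d e sa by (intro IH) auto
      then show ?thesis unfolding e using long e False sa by simp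
    qed
  qed
  show ?case
  proof (cases a)
    case Nil
    then show ?thesis using nil less.prems by simp
  next
    case a: (Cons d a')
    show ?thesis
    proof (cases b)
      case Nil
      then show ?thesis using nil less.prems by simp
    next
      case b: (Cons e b')
      consider "d = 0" | "e = 0" | "0 < d" "d = e" | "0 < d" "d < e" | "0 < e" "e < d" by linarith
      then show ?thesis
      proof cases
        case 1
        then have "P a' b" using less.prems a by (intro IH) auto
        then show ?thesis using zero 1 a less.prems by simp
      next
        case 2
        then have "P a b'" using less.prems b by (intro IH) auto
        then have "P b' a" using swap 2 b less.prems by simp
        then have "P b a" using zero 2 b less.prems by simp
        then show ?thesis using swap less.prems by simp
      next
        case 3
        then show ?thesis using eq a b less.prems by simp
      next
        case 4
        show ?thesis unfolding a b
          by (rule step[OF 4]) (use less.prems a b in \<open>auto intro!: IH\<close>)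
      next
        case 5
        have "P (e # b') (d # a')"
          by (rule step[OF 5]) (use less.prems a b in \<open>auto intro!: IH\<close>)
        then show ?thesis using swap a b less.prems by simp
      qed
    qed
  qed
qed

section \<open>Rigidity under the reduction of seaweed patterns\<close>

lemma rigid_by_reindex:
  assumes e: "bij_betw e I' I" and S: "\<And>i j. \<lbrakk>i \<in> I'; j \<in> I'\<rbrakk> \<Longrightarrow> S' i j \<longleftrightarrow> S (e i) (e j)"
    and rig: "rigid_by I S F"
  shows "rigid_by I' S' (\<lambda>i j. F (e i) (e j))"
  unfolding rigid_by_def
proof
  fix x assume x: "x \<in> stab I' S' (\<lambda>i j. F (e i) (e j))"
  define r where "r = inv_into I' e"
  have r: "\<And>i. i \<in> I \<Longrightarrow> r i \<in> I'" "\<And>i. i \<in> I \<Longrightarrow> e (r i) = i" "\<And>i. i \<in> I' \<Longrightarrow> r (e i) = i"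
    and eI: "\<And>i. i \<in> I' \<Longrightarrow> e i \<in> I"
    using e unfolding r_def bij_betw_def by (auto simp: f_inv_into_f inv_into_into)
  define y where "y i j = (if i \<in> I \<and> j \<in> I then x (r i) (r j) else 0)" for i j
  have sums: "(\<Sum>k\<in>I. f k) = (\<Sum>k\<in>I'. f (e k))" for f
    using sum.reindex_bij_betw[OF e, of f] by simp
  have "y \<in> stab I S F"
    unfolding stab_def mem_Collect_eq
  proof (intro conjI ballI impI)
    show "supported I S y"
      unfolding supported_def
    proof (intro allI impI)
      fix i j assume "y i j \<noteq> 0"
      then have "i \<in> I" "j \<in> I" "x (r i) (r j) \<noteq> 0" by (auto simp: y_def split: if_splits)
      moreover from this have "S' (r i) (r j)" using x unfolding stab_def supported_def by blast
      ultimately show "i \<in> I \<and> j \<in> I \<and> S i j" using S[of "r i" "r j"] r by simp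
    qed
  next
    fix i j assume ij: "i \<in> I" "j \<in> I" "S j i"
    have "mmul I F y i j = mmul I' (\<lambda>i j. F (e i) (e j)) x (r i) (r j)"
      "mmul I y F i j = mmul I' x (\<lambda>i j. F (e i) (e j)) (r i) (r j)"
      unfolding mmul_def sums by (rule sum.cong; use ij r eI in \<open>simp add: y_def\<close>)+
    moreover have "S' (r j) (r i)" using S ij r by simp
    ultimately show "mmul I F y i j = mmul I y F i j" using x r ij by (simp add: stab_def)
  qed
  then obtain c where c: "\<And>i j. \<lbrakk>i \<in> I; j \<in> I\<rbrakk> \<Longrightarrow> y i j = (if i = j then c else 0)"
    using rig unfolding rigid_by_def scalar_on_def by blast
  have "x i j = (if i = j then c else 0)" if "i \<in> I'" "j \<in> I'" for i j
  proof -
    have "e i = e j \<longleftrightarrow> i = j" using r(3) that by metis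
    then show ?thesis using c[of "e i" "e j"] that eI r by (simp add: y_def)
  qed
  then show "scalar_on I' x" unfolding scalar_on_def by blast
qed

lemma rigid_reindex:
  assumes e: "bij_betw e I' I" and S: "\<And>i j. \<lbrakk>i \<in> I'; j \<in> I'\<rbrakk> \<Longrightarrow> S' i j \<longleftrightarrow> S (e i) (e j)"
  shows "(\<exists>F :: _ \<Rightarrow> _ \<Rightarrow> 'k::field. rigid_by I S F) \<longleftrightarrow> (\<exists>F :: _ \<Rightarrow> _ \<Rightarrow> 'k. rigid_by I' S' F)"
proof
  assume "\<exists>F :: _ \<Rightarrow> _ \<Rightarrow> 'k. rigid_by I S F"
  then show "\<exists>F :: _ \<Rightarrow> _ \<Rightarrow> 'k. rigid_by I' S' F" using rigid_by_reindex[OF e, of S' S] S by blast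
next
  have r: "bij_betw (inv_into I' e) I I'" using e by (rule bij_betw_inv_into)
  have Sr: "S i j \<longleftrightarrow> S' (inv_into I' e i) (inv_into I' e j)" if "i \<in> I" "j \<in> I" for i j
    using S[of "inv_into I' e i" "inv_into I' e j"] e that bij_betw_apply[OF r]
    by (simp add: bij_betw_inv_into_right[OF e])
  assume "\<exists>F :: _ \<Rightarrow> _ \<Rightarrow> 'k. rigid_by I' S' F"
  then show "\<exists>F :: _ \<Rightarrow> _ \<Rightarrow> 'k. rigid_by I S F" using rigid_by_reindex[OF r, of S S'] Sr by blast
qed

lemma rigid_by_transpose:
  assumes "rigid_by I S F"
  shows "rigid_by I (\<lambda>i j. S j i) (\<lambda>i j. F j i)"
  unfolding rigid_by_def
proof
  fix x assume x: "x \<in> stab I (\<lambda>i j. S j i) (\<lambda>i j. F j i)"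
  have t: "mmul I (\<lambda>i j. A j i) B j i = mmul I (\<lambda>i j. B j i) A i j" for A B :: "'a \<Rightarrow> 'a \<Rightarrow> 'b" and i j
    by (simp add: mmul_def mult.commute)
  have "(\<lambda>i j. x j i) \<in> stab I S F"
    unfolding stab_def mem_Collect_eq
  proof (intro conjI ballI impI)
    show "supported I S (\<lambda>i j. x j i)" using x unfolding stab_def supported_def by blast
    fix i j assume ij: "i \<in> I" "j \<in> I" "S j i"
    then have "mmul I (\<lambda>i j. F j i) x j i = mmul I x (\<lambda>i j. F j i) j i"
      using x unfolding stab_def by blast
    then show "mmul I F (\<lambda>i j. x j i) i j = mmul I (\<lambda>i j. x j i) F i j"
      using t[of F x j i] t[of "\<lambda>i j. x j i" "\<lambda>i j. F j i" j i] by simp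
  qed
  then obtain c where "\<And>i j. \<lbrakk>i \<in> I; j \<in> I\<rbrakk> \<Longrightarrow> x j i = (if i = j then c else 0)"
    using assms unfolding rigid_by_def scalar_on_def by fast
  then show "scalar_on I x" unfolding scalar_on_def by metis
qed

text \<open>
  Transposition exchanges the two triangularity conditions.
\<close>

lemma rigid_swap: "sum_list a = sum_list b \<Longrightarrow> rigid K a b \<Longrightarrow> rigid K b a"
proof -
  assume s: "sum_list a = sum_list b" and "rigid K a b"
  then obtain F :: "nat \<Rightarrow> nat \<Rightarrow> 'a" where "rigid_by {..<sum_list a} (seaweed a b) F"
    unfolding rigid_def by blast
  from rigid_by_transpose[OF this] have "rigid_by {..<sum_list b} (seaweed b a) (\<lambda>i j. F j i)"
    unfolding s seaweed_def by (simp add: conj_commute)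
  then show "rigid K b a" unfolding rigid_def by blast
qed

text \<open>
  With at least as many coordinates left in the first block of \<open>b\<close> as in that of \<open>a\<close>, all of the
  latter are matched: the matching reaches the last \<open>d\<close> of the coordinates
  \<open>d, \<dots>, d + c - 1\<close>.
\<close>

lemma rigid_short:
  fixes K :: "'k::field itself"
  assumes inf: "infinite (UNIV :: 'k set)"
    and d: "0 < d" "d \<le> c" "sum_list a = c + sum_list b"
  shows "rigid K (d # a) ((d + c) # b) \<longleftrightarrow> rigid K a ((c - d) # d # b)"
proof -
  let ?n = "d + sum_list a"
  let ?S = "seaweed (d # a) ((d + c) # b)"
  interpret block_split "{..<?n}" "{}" "{..<d}" "{d..<c}" "{c..<c + d}" "{c + d..<?n}" ?S "\<lambda>i. c + i" "\<lambda>j. j - c"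
  proof
    show "{..<?n} = {} \<union> {..<d} \<union> {d..<c} \<union> {c..<c + d} \<union> {c + d..<?n}"
      using d by auto
  qed (use d in \<open>auto simp: seaweed_refl seaweed_def below_mono intro: below_trans\<close>)
  have "rigid K (d # a) ((d + c) # b) \<longleftrightarrow> (\<exists>F :: nat \<Rightarrow> nat \<Rightarrow> 'k. rigid_by ({..<?n} - {..<d}) S' F)"
    unfolding rigid_def using rigid_reduction[OF inf] by simp
  also have "\<dots> \<longleftrightarrow> (\<exists>F :: nat \<Rightarrow> nat \<Rightarrow> 'k. rigid_by {..<sum_list a} (seaweed a ((c - d) # d # b)) F)"
  proof (rule rigid_reindex)
    show "bij_betw (\<lambda>i. i + d) {..<sum_list a} ({..<?n} - {..<d})"
      by (rule bij_betw_byWitness[where f' = "\<lambda>i. i - d"]) auto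
  next
    fix i j
    have "below ((d + c) # b) (j + d) (i + d) \<and> \<not> (i + d \<in> {d..<c} \<and> j + d \<in> {c..<c + d})
       \<longleftrightarrow> below ((c - d) # d # b) j i"
    proof -
      consider "j < c - d" | "c - d \<le> j" "i < c - d" | "c - d \<le> j" "c - d \<le> i" "j < c" | "c \<le> j" "c - d \<le> i" "i < c" | "c \<le> j" "c \<le> i"
        by linarith
      then show ?thesis using d by cases (auto simp: below_mono)
    qed
    then show "seaweed a ((c - d) # d # b) i j \<longleftrightarrow> S' (i + d) (j + d)"
      unfolding S'_def seaweed_def by auto
  qed
  finally show ?thesis unfolding rigid_def .
qed

text \<open>
  Here the surplus \<open>c\<close> of the first block of \<open>b\<close> is smaller than \<open>d\<close>, so only the last \<open>c\<close>
  coordinates of the first block of \<open>a\<close> are matched, with all the surplus ones.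
\<close>

lemma rigid_long:
  fixes K :: "'k::field itself"
  assumes inf: "infinite (UNIV :: 'k set)"
    and d: "0 < c" "c < d" "sum_list a = c + sum_list b"
  shows "rigid K (d # a) ((d + c) # b) \<longleftrightarrow> rigid K ((d - c) # a) (d # b)"
proof -
  let ?n = "d + sum_list a"
  let ?S = "seaweed (d # a) ((d + c) # b)"
  interpret block_split "{..<?n}" "{..<d - c}" "{d - c..<d}" "{}" "{d..<d + c}" "{d + c..<?n}" ?S "\<lambda>i. i + c" "\<lambda>j. j - c"
  proof
    show "{..<?n} = {..<d - c} \<union> {d - c..<d} \<union> {} \<union> {d..<d + c} \<union> {d + c..<?n}"
      using d by auto
  qed (use d in \<open>auto simp: seaweed_refl seaweed_def below_mono intro: below_trans\<close>)
  define e where "e i = (if i < d - c then i else i + c)" for i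
  have "rigid K (d # a) ((d + c) # b) \<longleftrightarrow> (\<exists>F :: nat \<Rightarrow> nat \<Rightarrow> 'k. rigid_by ({..<?n} - {d - c..<d}) S' F)"
    unfolding rigid_def using rigid_reduction[OF inf] by simp
  also have "\<dots> \<longleftrightarrow> (\<exists>F :: nat \<Rightarrow> nat \<Rightarrow> 'k. rigid_by {..<sum_list ((d - c) # a)} (seaweed ((d - c) # a) (d # b)) F)"
  proof (rule rigid_reindex)
    show "bij_betw e {..<sum_list ((d - c) # a)} ({..<?n} - {d - c..<d})"
      by (rule bij_betw_byWitness[where f' = "\<lambda>i. if i < d - c then i else i - c"]) (use d in \<open>auto simp: e_def\<close>)
  next
    fix i j
    have "below (d # a) (e i) (e j) \<longleftrightarrow> below ((d - c) # a) i j"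
      using d by (auto simp: e_def)
    moreover have "below ((d + c) # b) (e j) (e i) \<longleftrightarrow> below (d # b) j i"
      using d by (auto simp: e_def)
    ultimately show "seaweed ((d - c) # a) (d # b) i j \<longleftrightarrow> S' (e i) (e j)"
      unfolding S'_def seaweed_def by simp
  qed
  finally show ?thesis unfolding rigid_def .
qed

text \<open>
  A common first block splits off a factor \<open>gl\<^sub>d\<close>, whose identity matrix stabilises
  everything; rigidity therefore leaves no other factor. In \<open>gl\<^sub>d\<close> the functional \<open>F\<close>
  commutes with itself, so it is scalar, but then all matrices stabilise it, and \<open>d = 1\<close>.
\<close>

lemma rigid_equal:
  fixes K :: "'k::field itself"
  assumes d: "0 < d" "sum_list a = sum_list b"
  shows "rigid K (d # a) (d # b) \<longleftrightarrow> d = 1 \<and> sum_list a = 0"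
proof
  let ?I = "{..<d + sum_list a}"
  let ?S = "seaweed (d # a) (d # b)"
  assume "rigid K (d # a) (d # b)"
  then obtain F :: "nat \<Rightarrow> nat \<Rightarrow> 'k" where F: "rigid_by ?I ?S F"
    unfolding rigid_def by auto
  have Sd: "i < d \<longleftrightarrow> j < d" if "?S i j" for i j
    using that by (auto simp: seaweed_def)
  have sc: "x 0 0 = x (d - 1) (d - 1)" "d \<noteq> 1 \<Longrightarrow> x 0 (d - 1) = 0" "sum_list a > 0 \<Longrightarrow> x 0 0 = x d d" if "x \<in> stab ?I ?S F" for x
    using that F d unfolding rigid_by_def scalar_on_def by force+
  \<comment> \<open>the identity of the first block\<close>
  define x :: "nat \<Rightarrow> nat \<Rightarrow> 'k" where "x i j = (if i = j \<and> i < d then 1 else 0)" for i j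
  have "x \<in> stab ?I ?S F"
    unfolding stab_def mem_Collect_eq
  proof (intro conjI ballI impI)
    show "supported ?I ?S x" by (auto simp: supported_def x_def seaweed_refl)
    fix i j assume ij: "i \<in> ?I" "j \<in> ?I" "?S j i"
    have "mmul ?I F x i j = (\<Sum>k\<in>?I. if k = j then (if j < d then F i j else 0) else 0)"
      unfolding mmul_def by (rule sum.cong) (auto simp: x_def)
    moreover have "mmul ?I x F i j = (\<Sum>k\<in>?I. if k = i then (if i < d then F i j else 0) else 0)"
      unfolding mmul_def by (rule sum.cong) (auto simp: x_def)
    ultimately show "mmul ?I F x i j = mmul ?I x F i j" using Sd[OF ij(3)] ij by simp
  qed
  note xs = this
  have "\<not> 0 < sum_list a"
  proof
    assume "0 < sum_list a"
    from sc(3)[OF xs this] show False using d by (simp add: x_def)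
  qed
  then have a0: "sum_list a = 0" by (simp only: not_gr_zero)
  then have I: "?I = {..<d}" and S: "\<And>i j. i < d \<Longrightarrow> j < d \<Longrightarrow> ?S i j" by (auto simp: seaweed_def)
  \<comment> \<open>F itself, cut down to the pattern\<close>
  define G where "G i j = (if i < d \<and> j < d then F i j else 0)" for i j
  have "G \<in> stab ?I ?S F"
    unfolding stab_def mem_Collect_eq I
  proof (intro conjI ballI impI)
    show "supported {..<d} ?S G" using S by (auto simp: supported_def G_def)
    fix i j assume "i \<in> {..<d}" "j \<in> {..<d}"
    then show "mmul {..<d} F G i j = mmul {..<d} G F i j"
      unfolding mmul_def by (intro sum.cong) (auto simp: G_def)
  qed
  then obtain c where c: "\<And>i j. \<lbrakk>i < d; j < d\<rbrakk> \<Longrightarrow> G i j = (if i = j then c else 0)"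
    using F unfolding rigid_by_def scalar_on_def I by fastforce
  \<comment> \<open>an elementary matrix that is not scalar unless d = 1\<close>
  define x :: "nat \<Rightarrow> nat \<Rightarrow> 'k" where "x i j = (if i = 0 \<and> j = d - 1 then 1 else 0)" for i j
  have "x \<in> stab ?I ?S F"
    unfolding stab_def mem_Collect_eq I
  proof (intro conjI ballI impI)
    show "supported {..<d} ?S x" using S d by (auto simp: supported_def x_def)
    fix i j assume ij: "i \<in> {..<d}" "j \<in> {..<d}"
    have Fc: "F i j = (if i = j then c else 0)" if "i < d" "j < d" for i j
      using c[OF that] that by (simp add: G_def)
    have "mmul {..<d} F x i j = (\<Sum>k\<in>{..<d}. if k = i then c * x i j else 0)"
      unfolding mmul_def by (rule sum.cong) (use ij Fc in auto)
    moreover have "mmul {..<d} x F i j = (\<Sum>k\<in>{..<d}. if k = j then c * x i j else 0)"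
      unfolding mmul_def by (rule sum.cong) (use ij Fc in auto)
    ultimately show "mmul {..<d} F x i j = mmul {..<d} x F i j" using ij by simp
  qed
  from sc(2)[OF this] have "d = 1" by (auto simp: x_def)
  then show "d = 1 \<and> sum_list a = 0" using a0 by simp
next
  assume "d = 1 \<and> sum_list a = 0"
  then have "sum_list (d # a) = Suc 0" by simp
  then have "{..<sum_list (d # a)} = {0}" by (simp only: lessThan_Suc lessThan_0)
  then show "rigid K (d # a) (d # b)"
    unfolding rigid_def rigid_by_def scalar_on_def by auto
qed

section \<open>Meander graphs under the same reduction\<close>

lemma connected_under_commute: "connected_under I s t \<longleftrightarrow> connected_under I t s"
  unfolding connected_under_def by blast

text \<open>
  A contraction of graphs: \<open>r\<close> collapses \<open>I\<close> onto \<open>I'\<close> so that edges go to edges or vertices, \<open>e\<close>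
  chooses a representative of every vertex of \<open>I'\<close>, each vertex is joined to its representative,
  and edges of \<open>I'\<close> lift to walks between representatives. Instead of being joined by a walk, the
  assumptions speak of lying in the same closed sets.
\<close>

lemma connected_contract:
  fixes e :: "'j \<Rightarrow> 'i" and r :: "'i \<Rightarrow> 'j"
  assumes ne: "I' \<noteq> {}"
    and e: "\<And>i. i \<in> I' \<Longrightarrow> e i \<in> I" "\<And>i. i \<in> I' \<Longrightarrow> r (e i) = i" and r: "\<And>x. x \<in> I \<Longrightarrow> r x \<in> I'"
    and s: "\<And>x. x \<in> I \<Longrightarrow> s x \<in> I" "\<And>x. x \<in> I \<Longrightarrow> s (s x) = x"
    and t: "\<And>x. x \<in> I \<Longrightarrow> t x \<in> I" "\<And>x. x \<in> I \<Longrightarrow> t (t x) = x"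
    and rs: "\<And>x. x \<in> I \<Longrightarrow> r (s x) = r x \<or> r (s x) = s' (r x) \<or> r (s x) = t' (r x)"
    and rt: "\<And>x. x \<in> I \<Longrightarrow> r (t x) = r x \<or> r (t x) = s' (r x) \<or> r (t x) = t' (r x)"
    and link: "\<And>A x. \<lbrakk>A \<subseteq> I; \<And>y. y \<in> A \<Longrightarrow> s y \<in> A; \<And>y. y \<in> A \<Longrightarrow> t y \<in> A; x \<in> A\<rbrakk> \<Longrightarrow> e (r x) \<in> A"
    and es: "\<And>A i. \<lbrakk>A \<subseteq> I; \<And>y. y \<in> A \<Longrightarrow> s y \<in> A; \<And>y. y \<in> A \<Longrightarrow> t y \<in> A; i \<in> I'; e i \<in> A\<rbrakk> \<Longrightarrow> s' i \<in> I' \<and> e (s' i) \<in> A"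
    and et: "\<And>A i. \<lbrakk>A \<subseteq> I; \<And>y. y \<in> A \<Longrightarrow> s y \<in> A; \<And>y. y \<in> A \<Longrightarrow> t y \<in> A; i \<in> I'; e i \<in> A\<rbrakk> \<Longrightarrow> t' i \<in> I' \<and> e (t' i) \<in> A"
  shows "connected_under I s t \<longleftrightarrow> connected_under I' s' t'"
proof
  assume c: "connected_under I s t"
  have "A' = I'" if A': "A' \<subseteq> I'" "A' \<noteq> {}" "s' ` A' \<subseteq> A'" "t' ` A' \<subseteq> A'" for A'
  proof -
    let ?A = "{x \<in> I. r x \<in> A'}"
    have "s x \<in> ?A" if "x \<in> ?A" for x
      using that s(1)[of x] rs[of x] A'(3,4) by (auto simp: image_subset_iff)
    moreover have "t x \<in> ?A" if "x \<in> ?A" for x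
      using that t(1)[of x] rt[of x] A'(3,4) by (auto simp: image_subset_iff)
    moreover have "?A \<noteq> {}" using A'(1,2) e by fastforce
    moreover have "?A \<subseteq> I" by blast
    ultimately have "?A = I" using c unfolding connected_under_def by blast
    then have "i \<in> A'" if "i \<in> I'" for i using e that by force
    then show ?thesis using A'(1) by blast
  qed
  then show "connected_under I' s' t'" unfolding connected_under_def using ne by blast
next
  assume c: "connected_under I' s' t'"
  \<comment> \<open>a closed set contains all representatives as soon as it is nonempty; so a proper closed set
      and its complement cannot both exist\<close>
  have full: "\<exists>x\<in>A. \<forall>i\<in>I'. e i \<in> A" if A: "A \<subseteq> I" "A \<noteq> {}" and sA: "\<And>y. y \<in> A \<Longrightarrow> s y \<in> A" and tA: "\<And>y. y \<in> A \<Longrightarrow> t y \<in> A" for A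
  proof -
    obtain x where x: "x \<in> A" using A by blast
    let ?A' = "{i \<in> I'. e i \<in> A}"
    have "r x \<in> ?A'" using link[OF A(1) sA tA x] r A x by blast
    moreover have "s' ` ?A' \<subseteq> ?A'" "t' ` ?A' \<subseteq> ?A'"
      using es[OF A(1) sA tA] et[OF A(1) sA tA] by blast+
    moreover have "?A' \<subseteq> I'" by blast
    ultimately have "?A' = I'" using c unfolding connected_under_def by blast
    then show ?thesis using x by blast
  qed
  have "A = I" if A: "A \<subseteq> I" "A \<noteq> {}" "s ` A \<subseteq> A" "t ` A \<subseteq> A" for A
  proof (rule ccontr)
    assume "A \<noteq> I"
    then have B: "I - A \<noteq> {}" using A by blast
    have sB: "s y \<in> I - A" if "y \<in> I - A" for y
    proof -
      have "s y \<notin> A"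
      proof
        assume "s y \<in> A"
        then have "s (s y) \<in> A" using A(3) by blast
        then show False using s(2) that by simp
      qed
      then show ?thesis using s(1) that by blast
    qed
    have tB: "t y \<in> I - A" if "y \<in> I - A" for y
    proof -
      have "t y \<notin> A"
      proof
        assume "t y \<in> A"
        then have "t (t y) \<in> A" using A(4) by blast
        then show False using t(2) that by simp
      qed
      then show ?thesis using t(1) that by blast
    qed
    have "\<forall>i\<in>I'. e i \<in> A" using full[OF A(1,2)] A(3,4) by blast
    moreover have "\<forall>i\<in>I'. e i \<in> I - A" using full[of "I - A"] B sB tB by blast
    ultimately show False using ne by blast
  qed
  moreover have "I \<noteq> {}" using ne e by blast
  ultimately show "connected_under I s t" unfolding connected_under_def by blast
qed

text \<open>
  The \<open>d\<close> vertices of the first block of \<open>a\<close> are contracted along the arcs of the first block of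
  \<open>b\<close>.
\<close>

lemma connected_short:
  assumes d: "0 < d" "d \<le> c" "sum_list a = c + sum_list b"
  shows "connected_under {..<sum_list (d # a)} (refl_in (d # a)) (refl_in ((d + c) # b)) \<longleftrightarrow>
    connected_under {..<sum_list a} (refl_in a) (refl_in ((c - d) # d # b))"
proof (rule connected_contract[where e = "\<lambda>i. i + d" and r = "\<lambda>x. if x < d then c - 1 - x else x - d"])
  let ?s = "refl_in (d # a)" and ?t = "refl_in ((d + c) # b)"
  show "{..<sum_list a} \<noteq> {}" using d by (auto simp: lessThan_empty_iff bot_nat_def)
  show "i \<in> {..<sum_list a} \<Longrightarrow> i + d \<in> {..<sum_list (d # a)}" for i by simp
  show "i \<in> {..<sum_list a} \<Longrightarrow> (if i + d < d then c - 1 - (i + d) else i + d - d) = i" for i by simp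
  show "x \<in> {..<sum_list (d # a)} \<Longrightarrow> (if x < d then c - 1 - x else x - d) \<in> {..<sum_list a}" for x
    using d by auto
  have s: "sum_list (d # a) = sum_list ((d + c) # b)" using d by simp
  show "x \<in> {..<sum_list (d # a)} \<Longrightarrow> ?s x \<in> {..<sum_list (d # a)}" for x
    using refl_in_less[of x "d # a"] by simp
  show "x \<in> {..<sum_list (d # a)} \<Longrightarrow> ?t x \<in> {..<sum_list (d # a)}" for x
    unfolding s using refl_in_less[of x "(d + c) # b"] by simp
  show "?s (?s x) = x" "?t (?t x) = x" for x by (rule refl_in_invol)+
  let ?r = "\<lambda>x. if x < d then c - 1 - x else x - d"
  let ?t' = "refl_in ((c - d) # d # b)"
  fix x assume x: "x \<in> {..<sum_list (d # a)}"
  show "?r (?s x) = ?r x \<or> ?r (?s x) = refl_in a (?r x) \<or> ?r (?s x) = ?t' (?r x)"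
    using d by auto
  show "?r (?t x) = ?r x \<or> ?r (?t x) = refl_in a (?r x) \<or> ?r (?t x) = ?t' (?r x)"
  proof -
    consider "x < d" | "d \<le> x" "x < c" | "c \<le> x" "x < c + d" | "c + d \<le> x" by linarith
    then show ?thesis using d by cases (auto simp: add.commute)
  qed
next
  let ?s = "refl_in (d # a)" and ?t = "refl_in ((d + c) # b)"
  let ?t' = "refl_in ((c - d) # d # b)"
  fix A
  assume A: "A \<subseteq> {..<sum_list (d # a)}" and sA: "\<And>y. y \<in> A \<Longrightarrow> ?s y \<in> A" and tA: "\<And>y. y \<in> A \<Longrightarrow> ?t y \<in> A"
  show "(if x < d then c - 1 - x else x - d) + d \<in> A" if "x \<in> A" for x
    using tA[OF that] that d by (cases "x < d") (auto simp: algebra_simps)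
  fix i assume i: "i \<in> {..<sum_list a}" and iA: "i + d \<in> A"
  show "refl_in a i \<in> {..<sum_list a} \<and> refl_in a i + d \<in> A"
    using sA[OF iA] refl_in_less[of i a] i by (simp add: algebra_simps)
  have "?t' i < sum_list a"
    using refl_in_less[of i "(c - d) # d # b"] i d by simp
  moreover have "?t' i + d \<in> A"
  proof -
    consider "i < c - d" | "c - d \<le> i" "i < c" | "c \<le> i" by linarith
    then show ?thesis
    proof cases
      case 1
      then have "?t (i + d) = ?t' i + d" using d by simp
      then show ?thesis using tA[OF iA] by simp
    next
      case 2
      have "?t (i + d) = c - 1 - i" using 2 d by simp
      moreover have "?s (c - 1 - i) = d + i - c" using 2 d by simp
      moreover have "?t (d + i - c) = 2 * c - 1 - i"
      proof -
        have "d + i - c < d + c" using 2 d by linarith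
        then show ?thesis using 2 d by simp
      qed
      moreover have "?t' i + d = 2 * c - 1 - i"
      proof -
        have "\<not> i < c - d" "i - (c - d) < d" using 2 d by linarith+
        then have "?t' i = (c - d) + (d - 1 - (i - (c - d)))" by simp
        then show ?thesis using 2 d by linarith
      qed
      ultimately have "?t (?s (?t (i + d))) = ?t' i + d" by simp
      then show ?thesis using tA[OF sA[OF tA[OF iA]]] by simp
    next
      case 3
      have "\<not> i < c - d" "\<not> i - (c - d) < d" "i - (c - d) - d = i - c" using 3 d by linarith+
      then have "?t' i = (c - d) + (d + refl_in b (i - c))" by (simp only: refl_in.simps if_False)
      moreover have "i + d - (d + c) = i - c" by linarith
      then have "?t (i + d) = d + c + refl_in b (i - c)" using 3 by simp
      ultimately have "?t (i + d) = ?t' i + d" using d by linarith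
      then show ?thesis using tA[OF iA] by simp
    qed
  qed
  ultimately show "?t' i \<in> {..<sum_list a} \<and> ?t' i + d \<in> A" by simp
qed

text \<open>
  The first \<open>c\<close> vertices are contracted along their arcs in the first block of \<open>b\<close>. The other
  vertices of the first block of \<open>a\<close> are numbered backwards, which exchanges the roles of the two
  reflections on them.
\<close>

lemma connected_long:
  assumes d: "0 < c" "c < d" "sum_list a = c + sum_list b"
  shows "connected_under {..<sum_list (d # a)} (refl_in (d # a)) (refl_in ((d + c) # b)) \<longleftrightarrow>
    connected_under {..<sum_list ((d - c) # a)} (refl_in ((d - c) # a)) (refl_in (d # b))"
proof (rule connected_contract[where e = "\<lambda>i. if i < d - c then d - 1 - i else i + c" and r = "\<lambda>x. if x < d then d - 1 - x else x - c"])
  let ?s = "refl_in (d # a)" and ?t = "refl_in ((d + c) # b)"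
  let ?s' = "refl_in ((d - c) # a)" and ?t' = "refl_in (d # b)"
  let ?e = "\<lambda>i. if i < d - c then d - 1 - i else i + c"
  let ?r = "\<lambda>x. if x < d then d - 1 - x else x - c"
  show "{..<sum_list ((d - c) # a)} \<noteq> {}" using d by (auto simp: lessThan_empty_iff bot_nat_def)
  show "i \<in> {..<sum_list ((d - c) # a)} \<Longrightarrow> ?e i \<in> {..<sum_list (d # a)}" for i using d by auto
  show "i \<in> {..<sum_list ((d - c) # a)} \<Longrightarrow> ?r (?e i) = i" for i using d by auto
  show "x \<in> {..<sum_list (d # a)} \<Longrightarrow> ?r x \<in> {..<sum_list ((d - c) # a)}" for x
    using d by auto
  have s: "sum_list (d # a) = sum_list ((d + c) # b)" using d by simp
  show "x \<in> {..<sum_list (d # a)} \<Longrightarrow> ?s x \<in> {..<sum_list (d # a)}" for x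
    using refl_in_less[of x "d # a"] by simp
  show "x \<in> {..<sum_list (d # a)} \<Longrightarrow> ?t x \<in> {..<sum_list (d # a)}" for x
    unfolding s using refl_in_less[of x "(d + c) # b"] by simp
  show "?s (?s x) = x" "?t (?t x) = x" for x by (rule refl_in_invol)+
  fix x assume x: "x \<in> {..<sum_list (d # a)}"
  consider "x < c" | "c \<le> x" "x < d" | "d \<le> x" "x < d + c" | "d + c \<le> x" by linarith
  note cs = this
  show "?r (?s x) = ?r x \<or> ?r (?s x) = ?s' (?r x) \<or> ?r (?s x) = ?t' (?r x)"
    using cs d by cases (auto simp: add.commute)
  show "?r (?t x) = ?r x \<or> ?r (?t x) = ?s' (?r x) \<or> ?r (?t x) = ?t' (?r x)"
    using cs d by cases (auto simp: add.commute)
next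
  let ?s = "refl_in (d # a)" and ?t = "refl_in ((d + c) # b)"
  let ?s' = "refl_in ((d - c) # a)" and ?t' = "refl_in (d # b)"
  let ?e = "\<lambda>i. if i < d - c then d - 1 - i else i + c"
  let ?r = "\<lambda>x. if x < d then d - 1 - x else x - c"
  fix A
  assume A: "A \<subseteq> {..<sum_list (d # a)}" and sA: "\<And>y. y \<in> A \<Longrightarrow> ?s y \<in> A" and tA: "\<And>y. y \<in> A \<Longrightarrow> ?t y \<in> A"
  show "?e (?r x) \<in> A" if "x \<in> A" for x
  proof -
    consider "x < c" | "c \<le> x" "x < d" | "d \<le> x" by linarith
    then show ?thesis
    proof cases
      case 1
      then have "?e (?r x) = ?t x" using d by auto
      then show ?thesis using tA[OF that] by simp
    next
      case 2
      then have "?e (?r x) = x" using d by auto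
      then show ?thesis using that by simp
    next
      case 3
      then have "?e (?r x) = x" using d by auto
      then show ?thesis using that by simp
    qed
  qed
  fix i assume i: "i \<in> {..<sum_list ((d - c) # a)}" and iA: "?e i \<in> A"
  have "?s' i < sum_list ((d - c) # a)"
    using refl_in_less[of i "(d - c) # a"] i by simp
  moreover have "?e (?s' i) \<in> A"
  proof (cases "i < d - c")
    case True
    then have "?e (?s' i) = ?t (?e i)" using d by auto
    then show ?thesis using tA[OF iA] by simp
  next
    case False
    then have "?e (?s' i) = ?s (?e i)" using d by auto
    then show ?thesis using sA[OF iA] by simp
  qed
  ultimately show "?s' i \<in> {..<sum_list ((d - c) # a)} \<and> ?e (?s' i) \<in> A" by simp
  have "?t' i < sum_list ((d - c) # a)"
    using refl_in_less[of i "d # b"] i d by simp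
  moreover have "?e (?t' i) \<in> A"
  proof -
    consider "i < d - c" "c \<le> i" | "i < c" "i < d - c" | "d - c \<le> i" "i < d" "i < c" | "d - c \<le> i" "i < d" "c \<le> i" | "d \<le> i" by linarith
    then show ?thesis
    proof cases
      case 1
      then have "?e (?t' i) = ?s (?e i)" using d by auto
      then show ?thesis using sA[OF iA] by simp
    next
      case 2
      then have "?e (?t' i) = ?t (?s (?e i))" using d by auto
      then show ?thesis using tA[OF sA[OF iA]] by simp
    next
      case 3
      then have "?e (?t' i) = ?t (?s (?t (?e i)))" using d by auto
      then show ?thesis using tA[OF sA[OF tA[OF iA]]] by simp
    next
      case 4
      then have "?e (?t' i) = ?s (?t (?e i))" using d by auto
      then show ?thesis using sA[OF tA[OF iA]] by simp
    next
      case 5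
      then have "?e (?t' i) = ?t (?e i)" using d by auto
      then show ?thesis using tA[OF iA] by simp
    qed
  qed
  ultimately show "?t' i \<in> {..<sum_list ((d - c) # a)} \<and> ?e (?t' i) \<in> A" by simp
qed

text \<open>
  A common first block is closed under both reflections, and so is the set of its two outermost
  vertices.
\<close>

lemma meander_equal:
  assumes d: "0 < d" "sum_list a = sum_list b"
  shows "meander_path (d # a) (d # b) \<longleftrightarrow> d = 1 \<and> sum_list a = 0"
proof
  let ?I = "{..<sum_list (d # a)}"
  assume m: "meander_path (d # a) (d # b)"
  then have c: "A = ?I" if "A \<subseteq> ?I" "A \<noteq> {}" "refl_in (d # a) ` A \<subseteq> A" "refl_in (d # b) ` A \<subseteq> A" for A
    using that unfolding meander_path_def connected_under_def by blast
  have "{..<d} = ?I" by (rule c) (use d in auto)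
  then have a0: "sum_list a = 0" by auto
  then have b0: "sum_list b = 0" using d by simp
  have I: "?I = {..<d}" using a0 by simp
  have "{0, d - 1} = ?I" unfolding I by (rule c[unfolded I]) (use d in auto)
  then have "card {0, d - 1} = d" unfolding I by simp
  moreover have "card {0, d - 1} \<le> 2" by (simp add: card_insert_if)
  ultimately have "d \<le> 2" by simp
  moreover have "odd d" using m a0 b0 unfolding meander_path_def by auto
  ultimately have "d = 1" by presburger
  then show "d = 1 \<and> sum_list a = 0" using a0 by blast
next
  assume "d = 1 \<and> sum_list a = 0"
  then have s: "d = 1" "sum_list (d # a) = Suc 0" by simp_all
  have I: "{..<sum_list (d # a)} = {0}" unfolding s(2) by (simp only: lessThan_Suc lessThan_0)
  show "meander_path (d # a) (d # b)"
    unfolding meander_path_def connected_under_def I using s(1) by auto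
qed

text \<open>
  Both properties obey the same reduction and agree where it ends.
\<close>

theorem rigid_iff_meander_path:
  fixes K :: "'k::field itself"
  assumes inf: "infinite (UNIV :: 'k set)" and "sum_list a = sum_list b" and "0 < sum_list a"
  shows "rigid K a b \<longleftrightarrow> meander_path a b"
  using assms(2,3)
proof (induction a b rule: seaweed_induct)
  case (swap a b)
  have "rigid K b a \<longleftrightarrow> rigid K a b"
    using rigid_swap[OF swap(1), of K] rigid_swap[OF swap(1)[symmetric], of K] by blast
  moreover have "meander_path b a \<longleftrightarrow> meander_path a b"
    unfolding meander_path_def swap(1) Un_commute[of "set b"]
    using connected_under_commute[of "{..<sum_list b}" "refl_in a" "refl_in b"] by simp
  ultimately show ?case using swap by simp
next
  case (zero a b)
  then have "rigid K a b \<longleftrightarrow> meander_path a b" by simp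
  moreover have "rigid K (0 # a) b \<longleftrightarrow> rigid K a b"
    unfolding rigid_def seaweed_def by simp
  moreover have "meander_path (0 # a) b \<longleftrightarrow> meander_path a b" unfolding meander_path_def by simp
  ultimately show ?case by simp
next
  case (eq d a b)
  show ?case unfolding rigid_equal[OF eq(1,2)] meander_equal[OF eq(1,2)] by (rule refl)
next
  case (short d c a b)
  have "(\<exists>x\<in>set (d # a) \<union> set ((d + c) # b). odd x) \<longleftrightarrow> (\<exists>x\<in>set a \<union> set ((c - d) # d # b). odd x)"
    using short(1,2) by auto
  then have "meander_path (d # a) ((d + c) # b) \<longleftrightarrow> meander_path a ((c - d) # d # b)"
    unfolding meander_path_def using connected_short[OF short(1-3)] by simp
  moreover have "0 < sum_list a" using short by simp
  ultimately show ?case using short.IH rigid_short[OF inf short(1-3), of K] by simp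
next
  case (long d c a b)
  have "(\<exists>x\<in>set (d # a) \<union> set ((d + c) # b). odd x) \<longleftrightarrow> (\<exists>x\<in>set ((d - c) # a) \<union> set (d # b). odd x)"
    using long(1,2) by (auto simp: even_diff_nat)
  then have "meander_path (d # a) ((d + c) # b) \<longleftrightarrow> meander_path ((d - c) # a) (d # b)"
    unfolding meander_path_def using connected_long[OF long(1-3)] by simp
  moreover have "0 < sum_list ((d - c) # a)" using long by simp
  ultimately show ?case using long.IH rigid_long[OF inf long(1-3), of K] by simp
next
  case (nil a b)
  then show ?case by linarith
qed

definition odd_parts :: "nat list \<Rightarrow> nat" where
  "odd_parts a = length (filter odd a)"

lemma odd_parts_zero: "sum_list a = 0 \<Longrightarrow> odd_parts a = 0"
  by (induction a) (auto simp: odd_parts_def)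

text \<open>
  The reduction preserves the number of odd parts, because \<open>c - d\<close> and \<open>d + c\<close> have the same
  parity, and so do \<open>d - c\<close> and \<open>d + c\<close>; it ends in \<open>(1 | 1)\<close>.
\<close>

lemma meander_path_odd_parts:
  assumes "sum_list a = sum_list b" "meander_path a b"
  shows "odd_parts a + odd_parts b = 2"
  using assms
proof (induction a b rule: seaweed_induct)
  case (swap a b)
  have "meander_path b a \<longleftrightarrow> meander_path a b"
    unfolding meander_path_def swap(1) Un_commute[of "set b"]
    using connected_under_commute[of "{..<sum_list b}" "refl_in a" "refl_in b"] by simp
  then show ?case using swap by simp
next
  case (nil a b)
  have "{..<sum_list a} = {}" unfolding nil(1) by simp
  then show ?case using nil(3) unfolding meander_path_def connected_under_def by blast
next
  case (zero a b)
  have "meander_path (0 # a) b \<longleftrightarrow> meander_path a b" unfolding meander_path_def by simp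
  then show ?case using zero by (simp add: odd_parts_def)
next
  case (eq d a b)
  then have "d = 1" "sum_list a = 0" using meander_equal by blast+
  then show ?case using odd_parts_zero[of a] odd_parts_zero[of b] eq by (simp add: odd_parts_def)
next
  case (short d c a b)
  have "(\<exists>x\<in>set (d # a) \<union> set ((d + c) # b). odd x) \<longleftrightarrow> (\<exists>x\<in>set a \<union> set ((c - d) # d # b). odd x)"
    using short(1,2) by auto
  then have "meander_path a ((c - d) # d # b)"
    using short.prems unfolding meander_path_def using connected_short[OF short(1-3)] by simp
  then show ?case using short.IH short(2) by (auto simp: odd_parts_def split: if_splits)
next
  case (long d c a b)
  have "(\<exists>x\<in>set (d # a) \<union> set ((d + c) # b). odd x) \<longleftrightarrow> (\<exists>x\<in>set ((d - c) # a) \<union> set (d # b). odd x)"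
    using long(1,2) by (auto simp: even_diff_nat)
  then have "meander_path ((d - c) # a) (d # b)"
    using long.prems unfolding meander_path_def using connected_long[OF long(1-3)] by simp
  then show ?case using long.IH long(2) by (auto simp: odd_parts_def split: if_splits)
qed

section \<open>The index of a standard parabolic subalgebra\<close>

text \<open>
  The independent subsets of a subspace have bounded size, and a maximal one generates.
\<close>

lemma (in vectorspace) fin_dim_subspace:
  assumes fd: fin_dim and W: "subspace K W V"
  shows "vectorspace.fin_dim K (vs W)"
proof -
  interpret W: vectorspace K "vs W" by (rule subspace_is_vs[OF W])
  have WV: "W \<subseteq> carrier V" using W unfolding subspace_def submodule_def by blast
  define P where "P S \<longleftrightarrow> S \<subseteq> W \<and> W.lin_indpt S" for S
  have "\<exists>S. finite S \<and> maximal S P"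
  proof (rule maximal_exists[where N = dim])
    fix S assume S: "P S"
    then have "lin_indpt S" using span_li_not_depend(2)[of S W] W unfolding P_def by (simp add: subspace_def)
    then show "finite S \<and> card S \<le> dim" using li_le_dim[OF fd, of S] S WV unfolding P_def by blast
  next
    show "P {}" unfolding P_def using W.finite_lin_indpt2[of "{}"] by simp
  qed
  then obtain S where S: "finite S" "maximal S P" by blast
  have "W.gen_set S" by (rule W.max_li_is_gen) (use S(2) in \<open>simp add: P_def[abs_def]\<close>)
  moreover have "S \<subseteq> W" using S(2) unfolding maximal_def P_def by blast
  ultimately show ?thesis unfolding W.fin_dim_def using S(1) by auto
qed

lemma (in vectorspace) dim_eq_0_iff:
  assumes fd: fin_dim
  shows "dim = 0 \<longleftrightarrow> carrier V = {\<zero>\<^bsub>V\<^esub>}"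
proof
  assume "dim = 0"
  obtain b where b: "finite b" "basis b" using finite_basis_exists[OF fd] by blast
  then have "card b = 0" using dim_basis \<open>dim = 0\<close> by simp
  then have "b = {}" using b by simp
  then have "gen_set {}" using b unfolding basis_def by simp
  then show "carrier V = {\<zero>\<^bsub>V\<^esub>}" using span_empty by simp
next
  assume c: "carrier V = {\<zero>\<^bsub>V\<^esub>}"
  have "gen_set {\<zero>\<^bsub>V\<^esub>}" using span_zero c span_closed[of "{\<zero>\<^bsub>V\<^esub>}"]
    by (metis c in_own_span span_is_subset2 subset_antisym order_refl)
  then show "dim = 0" by (rule dim0I)
qed

text \<open>
  The space of matrices is the image of the vectors of length \<open>n * n\<close>.
\<close>

lemma module_mat_fin_dim:
  "vectorspace.fin_dim class_ring (module_mat TYPE('a::field) n n)"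
proof -
  let ?V = "module_vec TYPE('a) (n * n)" and ?W = "module_mat TYPE('a) n n"
  let ?T = "\<lambda>v. mat n n (\<lambda>(i, j). vec_index v (i * n + j)) :: 'a mat"
  interpret V: vec_space "TYPE('a)" "n * n" .
  interpret W: vectorspace class_ring ?W by (rule matrix_vs)
  have lt: "i * n + j < n * n" if "i < n" "j < n" for i j
  proof -
    have "i * n + j < Suc i * n" using that by simp
    also have "\<dots> \<le> n * n" using that by (intro mult_le_mono1) simp
    finally show ?thesis .
  qed
  interpret T: linear_map class_ring ?V ?W ?T
  proof unfold_locales
    show "?T \<in> LinearCombinations.module_hom class_ring ?V ?W"
      unfolding module_hom_def
      by (auto simp: module_mat_simps module_vec_simps class_ring_simps lt)
  qed
  have "?T ` carrier ?V = carrier ?W"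
  proof
    show "?T ` carrier ?V \<subseteq> carrier ?W" by (auto simp: module_mat_simps)
    show "carrier ?W \<subseteq> ?T ` carrier ?V"
    proof
      fix A assume A: "A \<in> carrier ?W"
      then have "A = ?T (vec (n * n) (\<lambda>k. A $$ (k div n, k mod n)))"
        by (intro eq_matI) (auto simp: module_mat_simps lt)
      then show "A \<in> ?T ` carrier ?V" by (auto simp: module_vec_simps)
    qed
  qed
  then show ?thesis by (rule T.surj_fin_dim[OF V.fin_dim])
qed

text \<open>
  A recursive description of the block structure replaces the partial sums.
\<close>

lemma separating_boundary_iff:
  "(\<exists>s \<le> length a. j < sum_list (take s a) \<and> sum_list (take s a) \<le> i) \<longleftrightarrow> \<not> below a i j"
  if "i < sum_list a" for i j :: nat
  using that
proof (induction a arbitrary: i j)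
  case Nil
  then show ?case by simp
next
  case (Cons x a)
  have "(\<exists>s \<le> length (x # a). j < sum_list (take s (x # a)) \<and> sum_list (take s (x # a)) \<le> i) \<longleftrightarrow>
      (\<exists>s \<le> length a. j < x + sum_list (take s a) \<and> x + sum_list (take s a) \<le> i)" (is "?L \<longleftrightarrow> ?R")
  proof
    assume ?L
    then obtain s where s: "s \<le> length (x # a)" "j < sum_list (take s (x # a))" "sum_list (take s (x # a)) \<le> i" by blast
    then obtain s' where "s = Suc s'" by (cases s) auto
    then show ?R using s by auto
  next
    assume ?R
    then obtain s where "s \<le> length a" "j < x + sum_list (take s a)" "x + sum_list (take s a) \<le> i" by blast
    then show ?L by (intro exI[of _ "Suc s"]) simp
  qed
  also have "\<dots> \<longleftrightarrow> x \<le> i \<and> (j < x \<or> \<not> below a (i - x) (j - x))"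
  proof (cases "x \<le> i")
    case False
    then show ?thesis by auto
  next
    case True
    show ?thesis
    proof (cases "j < x")
      case j: True
      then show ?thesis using True by (auto intro!: exI[of _ 0])
    next
      case False
      have "i - x < sum_list a" using Cons.prems True by simp
      from Cons.IH[OF this, of "j - x"] this show ?thesis using True False
        by (auto simp: le_diff_conv2 less_diff_conv2 add.commute less_diff_conv)
    qed
  qed
  finally show ?case using Cons.prems by auto
qed

lemma block_upper_triangular_iff:
  assumes "A \<in> carrier_mat (sum_list a) (sum_list a)"
  shows "block_upper_triangular a A \<longleftrightarrow>
    (\<forall>i<sum_list a. \<forall>j<sum_list a. A $$ (i, j) \<noteq> 0 \<longrightarrow> below a i j)"
  using assms separating_boundary_iff[of _ a] unfolding block_upper_triangular_def by auto

lemma commutator_mat_index: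
  fixes A B :: "'k::field mat"
  assumes "A \<in> carrier_mat n n" "B \<in> carrier_mat n n" "i < n" "j < n"
  shows "commutator_mat A B $$ (i, j) = (\<Sum>k<n. A $$ (i, k) * B $$ (k, j)) - (\<Sum>k<n. B $$ (i, k) * A $$ (k, j))"
  using assms unfolding commutator_mat_def
  by (simp add: scalar_prod_def atLeast0LessThan)

lemma commutator_mat_carrier:
  assumes "A \<in> carrier_mat n n" "B \<in> carrier_mat n n"
  shows "commutator_mat A B \<in> carrier_mat n n"
  using assms unfolding commutator_mat_def by auto

definition entries :: "'k::zero mat \<Rightarrow> nat \<Rightarrow> nat \<Rightarrow> 'k" where
  "entries A i j = (if i < dim_row A \<and> j < dim_col A then A $$ (i, j) else 0)"

text \<open>
  Invariance of the trace form: \<open>tr (F [x, y]) = tr ([F, x] y)\<close>.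
\<close>

lemma trace_form_commutator:
  fixes x y :: "'k::field mat"
  assumes x: "x \<in> carrier_mat n n" and y: "y \<in> carrier_mat n n"
  shows "(\<Sum>i<n. \<Sum>j<n. F j i * commutator_mat x y $$ (i, j)) =
    (\<Sum>i<n. \<Sum>j<n. (mmul {..<n} F (entries x) i j - mmul {..<n} (entries x) F i j) * y $$ (j, i))"
proof -
  have "(\<Sum>i<n. \<Sum>j<n. F j i * commutator_mat x y $$ (i, j)) =
      (\<Sum>i<n. \<Sum>j<n. \<Sum>k<n. F j i * (x $$ (i, k) * y $$ (k, j))) -
      (\<Sum>i<n. \<Sum>j<n. \<Sum>k<n. F j i * (y $$ (i, k) * x $$ (k, j)))"
    using x y by (simp add: commutator_mat_index right_diff_distrib sum_subtractf sum_distrib_left)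
  also have "(\<Sum>i<n. \<Sum>j<n. \<Sum>k<n. F j i * (x $$ (i, k) * y $$ (k, j))) =
      (\<Sum>i<n. \<Sum>j<n. mmul {..<n} F (entries x) i j * y $$ (j, i))"
  proof -
    have "(\<Sum>i<n. \<Sum>j<n. \<Sum>k<n. F j i * (x $$ (i, k) * y $$ (k, j))) =
       (\<Sum>j<n. \<Sum>i<n. \<Sum>k<n. F j i * (x $$ (i, k) * y $$ (k, j)))" by (rule sum.swap)
    also have "\<dots> = (\<Sum>j<n. \<Sum>k<n. \<Sum>i<n. F j i * (x $$ (i, k) * y $$ (k, j)))"
      by (rule sum.cong[OF refl], rule sum.swap)
    also have "\<dots> = (\<Sum>j<n. \<Sum>k<n. mmul {..<n} F (entries x) j k * y $$ (k, j))"
      using x by (intro sum.cong) (auto simp: mmul_def sum_distrib_right entries_def mult.assoc)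
    finally show ?thesis .
  qed
  also have "(\<Sum>i<n. \<Sum>j<n. \<Sum>k<n. F j i * (y $$ (i, k) * x $$ (k, j))) =
      (\<Sum>i<n. \<Sum>j<n. mmul {..<n} (entries x) F i j * y $$ (j, i))"
  proof -
    have "(\<Sum>i<n. \<Sum>j<n. \<Sum>k<n. F j i * (y $$ (i, k) * x $$ (k, j))) =
       (\<Sum>i<n. \<Sum>k<n. \<Sum>j<n. F j i * (y $$ (i, k) * x $$ (k, j)))"
      by (rule sum.cong[OF refl], rule sum.swap)
    also have "\<dots> = (\<Sum>k<n. \<Sum>i<n. \<Sum>j<n. F j i * (y $$ (i, k) * x $$ (k, j)))" by (rule sum.swap)
    also have "\<dots> = (\<Sum>k<n. \<Sum>i<n. mmul {..<n} (entries x) F k i * y $$ (i, k))"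
      using x by (intro sum.cong) (auto simp: mmul_def sum_distrib_left sum_distrib_right entries_def mult_ac)
    finally show ?thesis .
  qed
  finally show ?thesis by (simp add: left_diff_distrib sum_subtractf)
qed

context
  fixes K :: "'k :: field_char_0 itself" and a :: "nat list" and n :: nat
  assumes n: "sum_list a = n" "0 < n"
begin

abbreviation "S \<equiv> seaweed a [n]"

lemma carrier_parabolic:
  "carrier (parabolic K a) = {A \<in> carrier_mat n n. trace_mat A = 0 \<and> (\<forall>i<n. \<forall>j<n. A $$ (i, j) \<noteq> 0 \<longrightarrow> below a i j)}"
  unfolding parabolic_def using n block_upper_triangular_iff[of _ a] by auto

lemma parabolic_ops:
  "add (parabolic K a) = (+)" "smult (parabolic K a) = (\<cdot>\<^sub>m)" "zero (parabolic K a) = 0\<^sub>m n n"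
  unfolding parabolic_def using n by (auto simp: module_mat_simps)

lemma parabolic_carrier_update: "(parabolic K a)\<lparr>carrier := W\<rparr> = (module_mat K n n)\<lparr>carrier := W\<rparr>"
  unfolding parabolic_def using n by simp

lemma module_mat_type: "module_mat K n n = module_mat TYPE('k) n n"
  unfolding module_mat_def by simp

lemma mat_vs: "vectorspace class_ring (module_mat K n n)"
  unfolding module_mat_type by (rule matrix_vs)

lemma S_iff: "i < n \<Longrightarrow> j < n \<Longrightarrow> S i j \<longleftrightarrow> below a i j"
  by (simp add: seaweed_def)

lemma trace_commutator:
  fixes x y :: "'k mat"
  assumes "x \<in> carrier_mat n n" "y \<in> carrier_mat n n"
  shows "trace_mat (commutator_mat x y) = 0"
proof -
  have "trace_mat (commutator_mat x y) = (\<Sum>i<n. commutator_mat x y $$ (i, i))"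
    using commutator_mat_carrier[OF assms] by (simp add: trace_mat_def)
  also have "\<dots> = (\<Sum>i<n. \<Sum>k<n. x $$ (i, k) * y $$ (k, i)) - (\<Sum>i<n. \<Sum>k<n. y $$ (i, k) * x $$ (k, i))"
    using commutator_mat_index[OF assms] by (simp add: sum_subtractf)
  also have "(\<Sum>i<n. \<Sum>k<n. y $$ (i, k) * x $$ (k, i)) = (\<Sum>i<n. \<Sum>k<n. x $$ (i, k) * y $$ (k, i))"
    by (subst sum.swap) (simp add: mult.commute)
  finally show ?thesis by simp
qed

lemma commutator_closed:
  assumes x: "x \<in> carrier (parabolic K a)" and y: "y \<in> carrier (parabolic K a)"
  shows "commutator_mat x y \<in> carrier (parabolic K a)"
proof -
  have xy: "x \<in> carrier_mat n n" "y \<in> carrier_mat n n" using x y by (auto simp: carrier_parabolic)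
  have b: "below a i j" if ij: "i < n" "j < n" and nz: "(\<Sum>k<n. u $$ (i, k) * v $$ (k, j)) \<noteq> 0"
    and u: "u \<in> carrier (parabolic K a)" and v: "v \<in> carrier (parabolic K a)" for u v i j
  proof -
    obtain k where "k < n" "u $$ (i, k) * v $$ (k, j) \<noteq> 0"
      using nz by (metis (mono_tags, lifting) lessThan_iff sum.neutral)
    then have "below a i k" "below a k j" using u v ij by (auto simp: carrier_parabolic)
    then show ?thesis by (rule below_trans)
  qed
  have "below a i j" if ij: "i < n" "j < n" and nz: "commutator_mat x y $$ (i, j) \<noteq> 0" for i j
  proof -
    have "(\<Sum>k<n. x $$ (i, k) * y $$ (k, j)) \<noteq> 0 \<or> (\<Sum>k<n. y $$ (i, k) * x $$ (k, j)) \<noteq> 0"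
      using nz commutator_mat_index[OF xy ij] by auto
    then show ?thesis using b[OF ij] x y by blast
  qed
  then show ?thesis using commutator_mat_carrier[OF xy] trace_commutator[OF xy]
    unfolding carrier_parabolic by blast
qed

lemma parabolic_closed:
  assumes "x \<in> carrier (parabolic K a)" "y \<in> carrier (parabolic K a)"
  shows "x + y \<in> carrier (parabolic K a)" "c \<cdot>\<^sub>m x \<in> carrier (parabolic K a)"
proof -
  have xy: "x \<in> carrier_mat n n" "y \<in> carrier_mat n n" using assms by (auto simp: carrier_parabolic)
  have "trace_mat (x + y) = trace_mat x + trace_mat y"
    using xy by (simp add: trace_mat_def sum.distrib)
  moreover have "x $$ (i, j) \<noteq> 0 \<or> y $$ (i, j) \<noteq> 0" if "i < n" "j < n" "(x + y) $$ (i, j) \<noteq> 0" for i j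
    using that xy by auto
  ultimately show "x + y \<in> carrier (parabolic K a)"
    using assms unfolding carrier_parabolic by fastforce
  have "trace_mat (c \<cdot>\<^sub>m x) = c * trace_mat x"
    using xy by (simp add: trace_mat_def sum_distrib_left)
  moreover have "x $$ (i, j) \<noteq> 0" if "i < n" "j < n" "(c \<cdot>\<^sub>m x) $$ (i, j) \<noteq> 0" for i j
    using that xy by auto
  ultimately show "c \<cdot>\<^sub>m x \<in> carrier (parabolic K a)"
    using assms unfolding carrier_parabolic by fastforce
qed

lemma zero_parabolic: "0\<^sub>m n n \<in> carrier (parabolic K a)"
  unfolding carrier_parabolic by (auto simp: trace_mat_def)

lemma stabilizer_subspace:
  assumes f: "f \<in> dual_space (parabolic K a)"
  shows "subspace class_ring (lie_stabilizer (parabolic K a) commutator_mat f) (module_mat K n n)"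
proof -
  let ?P = "carrier (parabolic K a)" and ?W = "lie_stabilizer (parabolic K a) commutator_mat f"
  have add: "f (x + y) = f x + f y" and smult: "f (c \<cdot>\<^sub>m x) = c * f x" if "x \<in> ?P" "y \<in> ?P" for x y c
    using f that unfolding dual_space_def parabolic_ops by auto
  have PM: "x \<in> carrier_mat n n" if "x \<in> ?P" for x using that by (simp add: carrier_parabolic)
  have "submodule class_ring ?W (module_mat K n n)"
  proof (rule submodule.intro)
    interpret vectorspace class_ring "module_mat K n n" by (rule mat_vs)
    show "?W \<subseteq> carrier (module_mat K n n)"
      by (auto simp: lie_stabilizer_def module_mat_simps PM)
    fix v w assume v: "v \<in> ?W" and w: "w \<in> ?W"
    then have vw: "v \<in> ?P" "w \<in> ?P" by (auto simp: lie_stabilizer_def)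
    have "commutator_mat (v + w) y = commutator_mat v y + commutator_mat w y" if "y \<in> ?P" for y
      using PM[OF that] PM[OF vw(1)] PM[OF vw(2)] unfolding commutator_mat_def
      by (intro eq_matI) (auto simp: add_mult_distrib_mat[of v n n] mult_add_distrib_mat[of y n n])
    then show "v \<oplus>\<^bsub>module_mat K n n\<^esub> w \<in> ?W"
      using v w vw parabolic_closed(1)[OF vw] add commutator_closed
      by (auto simp: lie_stabilizer_def module_mat_simps)
  next
    have "commutator_mat (0\<^sub>m n n) y = 0\<^sub>m n n" if "y \<in> ?P" for y
      using PM[OF that] unfolding commutator_mat_def by auto
    moreover have "f (0\<^sub>m n n) = 0"
      using smult[OF zero_parabolic zero_parabolic, of 0] by simp
    ultimately show "\<zero>\<^bsub>module_mat K n n\<^esub> \<in> ?W"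
      using zero_parabolic by (auto simp: lie_stabilizer_def module_mat_simps)
  next
    fix c :: 'k and v assume v: "v \<in> ?W"
    then have vP: "v \<in> ?P" by (auto simp: lie_stabilizer_def)
    have "commutator_mat (c \<cdot>\<^sub>m v) y = c \<cdot>\<^sub>m commutator_mat v y" if "y \<in> ?P" for y
      using PM[OF that] PM[OF vP] unfolding commutator_mat_def
      by (intro eq_matI) (auto simp: mult_smult_distrib[of y n n] mult_smult_assoc_mat[of v n n] right_diff_distrib)
    then show "c \<odot>\<^bsub>module_mat K n n\<^esub> v \<in> ?W"
      using v vP parabolic_closed(2)[OF vP vP] smult commutator_closed
      by (auto simp: lie_stabilizer_def module_mat_simps)
  next
    show "Module.module class_ring (module_mat K n n)" using mat_vs unfolding vectorspace_def by blast
  qed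
  then show ?thesis unfolding subspace_def using mat_vs by blast
qed

text \<open>
  Dimension zero means the zero space only in finite dimension; the ambient space of all matrices
  provides it.
\<close>

lemma stabilizer_dim_eq_0:
  assumes f: "f \<in> dual_space (parabolic K a)"
  shows "vectorspace.dim class_ring ((parabolic K a)\<lparr>carrier := lie_stabilizer (parabolic K a) commutator_mat f\<rparr>) = 0
    \<longleftrightarrow> lie_stabilizer (parabolic K a) commutator_mat f = {0\<^sub>m n n}"
proof -
  let ?W = "lie_stabilizer (parabolic K a) commutator_mat f"
  interpret V: vectorspace class_ring "module_mat K n n" by (rule mat_vs)
  interpret W: vectorspace class_ring "(module_mat K n n)\<lparr>carrier := ?W\<rparr>"
    by (rule V.subspace_is_vs[OF stabilizer_subspace[OF f]])
  have "V.fin_dim" using module_mat_fin_dim[where 'a = 'k, of n] unfolding module_mat_type .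
  then have "W.fin_dim" by (rule V.fin_dim_subspace[OF _ stabilizer_subspace[OF f]])
  from W.dim_eq_0_iff[OF this] show ?thesis
    unfolding parabolic_carrier_update by (simp add: module_mat_simps)
qed

lemma lie_index_eq_0:
  "lie_index (parabolic K a) commutator_mat = 0 \<longleftrightarrow>
    (\<exists>f\<in>dual_space (parabolic K a). lie_stabilizer (parabolic K a) commutator_mat f = {0\<^sub>m n n})"
proof -
  let ?Q = "\<lambda>d. \<exists>f \<in> dual_space (parabolic K a).
     d = vectorspace.dim class_ring ((parabolic K a)\<lparr>carrier := lie_stabilizer (parabolic K a) commutator_mat f\<rparr>)"
  have "(\<lambda>_. 0) \<in> dual_space (parabolic K a)" by (auto simp: dual_space_def)
  then have ex: "\<exists>d. ?Q d" by blast
  have "(LEAST d. ?Q d) = 0 \<longleftrightarrow> ?Q 0"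
  proof
    assume "(LEAST d. ?Q d) = 0"
    then show "?Q 0" using LeastI_ex[OF ex] by (simp only:)
  next
    assume "?Q 0"
    then have "(LEAST d. ?Q d) \<le> 0" by (rule Least_le)
    then show "(LEAST d. ?Q d) = 0" by blast
  qed
  also have "\<dots> \<longleftrightarrow> (\<exists>f\<in>dual_space (parabolic K a). lie_stabilizer (parabolic K a) commutator_mat f = {0\<^sub>m n n})"
    using stabilizer_dim_eq_0 by (intro bex_cong refl) (simp add: eq_commute[of "0::nat"])
  finally show ?thesis unfolding lie_index_def .
qed

lemma trace_functional_dual:
  "(\<lambda>A. \<Sum>i<n. \<Sum>j<n. F j i * A $$ (i, j)) \<in> dual_space (parabolic K a)"
  unfolding dual_space_def parabolic_ops carrier_parabolic
  by (auto simp: distrib_left sum.distrib sum_distrib_left mult.left_commute)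

text \<open>
  The traceless block upper triangular matrices are spanned by the elementary matrices of the
  pattern, where those on the diagonal are corrected by subtracting the first of them. Every \<open>A\<close>
  is the combination of these with its own entries as coefficients, since the corrections add up
  to the trace of \<open>A\<close>. So the values of the functional on them are the entries of \<open>F\<close>.
\<close>

lemma dual_trace_functional:
  assumes f: "f \<in> dual_space (parabolic K a)"
  obtains F :: "nat \<Rightarrow> nat \<Rightarrow> 'k" where
    "\<And>A. A \<in> carrier (parabolic K a) \<Longrightarrow> f A = (\<Sum>i<n. \<Sum>j<n. F j i * A $$ (i, j))"
proof -
  let ?P = "carrier (parabolic K a)"
  have add: "f (x + y) = f x + f y" and smult: "f (c \<cdot>\<^sub>m x) = c * f x" if "x \<in> ?P" "y \<in> ?P" for x y c
    using f that unfolding dual_space_def parabolic_ops by auto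
  \<comment> \<open>the elementary matrices, those on the diagonal made traceless\<close>
  define B where "B = (\<lambda>(i, j). mat n n (\<lambda>(p, q). (if p = i \<and> q = j then 1 else 0)
      - (if i = j \<and> p = 0 \<and> q = 0 then 1 else 0 :: 'k)))"
  define T where "T = {(i, j). i < n \<and> j < n \<and> below a i j}"
  have T: "finite T" by (rule finite_subset[of _ "{..<n} \<times> {..<n}"]) (auto simp: T_def)
  have BP: "B ij \<in> ?P" if "ij \<in> T" for ij
  proof -
    obtain i j where ij: "ij = (i, j)" "i < n" "j < n" "below a i j" using \<open>ij \<in> T\<close> by (auto simp: T_def)
    have "trace_mat (B (i, j)) = (\<Sum>p<n. (if p = i then (if i = j then 1 else 0) else 0)) - (\<Sum>p<n. if p = 0 then (if i = j then 1 else 0) else 0)"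
      unfolding sum_subtractf[symmetric] by (auto simp: trace_mat_def B_def intro!: sum.cong)
    also have "\<dots> = 0" using ij n by simp
    finally have "trace_mat (B (i, j)) = 0" .
    then show ?thesis unfolding carrier_parabolic ij(1) using ij
      by (auto simp: B_def below_mono split: if_splits)
  qed
  have lin: "mat n n (\<lambda>pq. \<Sum>ij\<in>U. c ij * B ij $$ pq) \<in> ?P \<and>
      f (mat n n (\<lambda>pq. \<Sum>ij\<in>U. c ij * B ij $$ pq)) = (\<Sum>ij\<in>U. c ij * f (B ij))"
    if "U \<subseteq> T" for U and c :: "nat \<times> nat \<Rightarrow> 'k"
    using finite_subset[OF that T] that
  proof (induction U rule: finite_induct)
    case empty
    have e: "mat n n (\<lambda>_. 0) = (0\<^sub>m n n :: 'k mat)" by auto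
    then show ?case using zero_parabolic smult[OF zero_parabolic zero_parabolic, of 0] by (simp add: e)
  next
    case (insert ij U)
    let ?M = "mat n n (\<lambda>pq. \<Sum>ij\<in>U. c ij * B ij $$ pq)"
    have IH: "?M \<in> ?P" "f ?M = (\<Sum>ij\<in>U. c ij * f (B ij))" using insert by auto
    have b: "B ij \<in> ?P" using BP insert by blast
    then have bc: "B ij \<in> carrier_mat n n" by (simp add: carrier_parabolic)
    have "mat n n (\<lambda>pq. \<Sum>ij\<in>insert ij U. c ij * B ij $$ pq) = c ij \<cdot>\<^sub>m B ij + ?M"
      using bc insert by (intro eq_matI) auto
    then show ?case
      using IH b parabolic_closed(2)[OF b b, of "c ij"] parabolic_closed(1)[OF parabolic_closed(2)[OF b b, of "c ij"] IH(1)]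
        add[OF parabolic_closed(2)[OF b b, of "c ij"] IH(1)] smult[OF b b] insert by simp
  qed
  define F where "F j i = (if (i, j) \<in> T then f (B (i, j)) else 0)" for i j
  have "f A = (\<Sum>i<n. \<Sum>j<n. F j i * A $$ (i, j))" if A: "A \<in> ?P" for A
  proof -
    have Ac: "A \<in> carrier_mat n n" "trace_mat A = 0" using A by (auto simp: carrier_parabolic)
    have A0: "A $$ (i, j) = 0" if "i < n" "j < n" "(i, j) \<notin> T" for i j
      using A that by (auto simp: carrier_parabolic T_def)
    have toT: "(\<Sum>ij\<in>T. h ij) = (\<Sum>i<n. \<Sum>j<n. h (i, j))"
      if "\<And>i j. \<lbrakk>i < n; j < n; (i, j) \<notin> T\<rbrakk> \<Longrightarrow> h (i, j) = 0" for h :: "nat \<times> nat \<Rightarrow> 'k"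
    proof -
      have "(\<Sum>ij\<in>T. h ij) = (\<Sum>ij\<in>{..<n} \<times> {..<n}. h ij)"
        by (rule sum.mono_neutral_left) (use that in \<open>auto simp: T_def\<close>)
      then show ?thesis by (simp add: sum.cartesian_product split_beta)
    qed
    have "(\<Sum>ij\<in>T. A $$ ij * B ij $$ (p, q)) = A $$ (p, q)" if pq: "p < n" "q < n" for p q
    proof -
      have "(\<Sum>ij\<in>T. A $$ ij * B ij $$ (p, q)) = (\<Sum>i<n. \<Sum>j<n. A $$ (i, j) * B (i, j) $$ (p, q))"
        by (rule toT) (simp add: A0)
      also have "\<dots> = (\<Sum>i<n. \<Sum>j<n. (if j = q then if i = p then A $$ (p, q) else 0 else 0)
          - (if j = i then if p = 0 \<and> q = 0 then A $$ (i, i) else 0 else 0))"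
        by (intro sum.cong refl) (use pq in \<open>auto simp: B_def\<close>)
      also have "\<dots> = (\<Sum>i<n. (if i = p then A $$ (p, q) else 0)) - (\<Sum>i<n. if p = 0 \<and> q = 0 then A $$ (i, i) else 0)"
        using pq by (simp add: sum_subtractf)
      also have "(\<Sum>i<n. if p = 0 \<and> q = 0 then A $$ (i, i) else 0) = 0"
        using Ac by (cases "p = 0 \<and> q = 0") (auto simp: trace_mat_def intro!: sum.neutral)
      finally show ?thesis using pq by simp
    qed
    then have "A = mat n n (\<lambda>pq. \<Sum>ij\<in>T. A $$ ij * B ij $$ pq)"
      using Ac by (intro eq_matI) auto
    then have "f A = (\<Sum>ij\<in>T. A $$ ij * f (B ij))"
      using lin[of T "\<lambda>ij. A $$ ij"] by simp
    also have "\<dots> = (\<Sum>i<n. \<Sum>j<n. F j i * A $$ (i, j))"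
    proof -
      have "(\<Sum>ij\<in>T. A $$ ij * f (B ij)) = (\<Sum>i<n. \<Sum>j<n. A $$ (i, j) * f (B (i, j)))"
        by (rule toT) (simp add: A0)
      also have "\<dots> = (\<Sum>i<n. \<Sum>j<n. F j i * A $$ (i, j))"
        by (intro sum.cong refl) (auto simp: F_def A0)
      finally show ?thesis .
    qed
    finally show ?thesis .
  qed
  then show thesis using that by blast
qed

text \<open>
  The bracket is tested against traceless \<open>y\<close> only. Nothing is lost, because \<open>[F, x]\<close> has trace
  zero, so that \<open>y\<close> may be shifted by a scalar; this division by \<open>n\<close>, and the absence of traceless
  scalars other than zero, need characteristic zero.
\<close>

lemma rigid_imp_trivial_stabilizer:
  fixes F :: "nat \<Rightarrow> nat \<Rightarrow> 'k"
  assumes rig: "rigid_by {..<n} S F"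
  shows "lie_stabilizer (parabolic K a) commutator_mat (\<lambda>A. \<Sum>i<n. \<Sum>j<n. F j i * A $$ (i, j)) = {0\<^sub>m n n}"
    (is "lie_stabilizer ?V ?br ?f = _")
proof
  have "?f (commutator_mat (0\<^sub>m n n) y) = 0" if "y \<in> carrier ?V" for y
  proof -
    have "commutator_mat (0\<^sub>m n n) y = 0\<^sub>m n n"
      using that unfolding commutator_mat_def carrier_parabolic by auto
    then show ?thesis by simp
  qed
  then show "{0\<^sub>m n n} \<subseteq> lie_stabilizer ?V ?br ?f"
    using zero_parabolic unfolding lie_stabilizer_def by blast
  show "lie_stabilizer ?V ?br ?f \<subseteq> {0\<^sub>m n n}"
  proof
    fix x assume x: "x \<in> lie_stabilizer ?V ?br ?f"
    then have xP: "x \<in> carrier ?V" and fx: "\<And>y. y \<in> carrier ?V \<Longrightarrow> ?f (commutator_mat x y) = 0"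
      by (auto simp: lie_stabilizer_def)
    have xc: "x \<in> carrier_mat n n" "trace_mat x = 0" using xP by (auto simp: carrier_parabolic)
    define D where "D i j = mmul {..<n} F (entries x) i j - mmul {..<n} (entries x) F i j" for i j
    have trD: "(\<Sum>i<n. D i i) = 0"
    proof -
      have "(\<Sum>i<n. mmul {..<n} F (entries x) i i) = (\<Sum>i<n. mmul {..<n} (entries x) F i i)"
        unfolding mmul_def by (subst sum.swap) (simp add: mult.commute)
      then show ?thesis by (simp add: D_def sum_subtractf)
    qed
    have "D i j = 0" if ij: "i < n" "j < n" "S j i" for i j
    proof -
      \<comment> \<open>an elementary matrix, made traceless by a multiple of the identity\<close>
      define y :: "'k mat" where "y = mat n n (\<lambda>(p, q). (if p = j \<and> q = i then 1 else 0)
        - (if i = j \<and> p = q then 1 / of_nat n else 0))"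
      have yc: "y \<in> carrier_mat n n" by (simp add: y_def)
      have "trace_mat y = (\<Sum>p<n. (if p = j then if i = j then 1 else 0 else 0) - (if i = j then 1 / of_nat n else 0))"
        using yc by (auto simp: trace_mat_def y_def intro!: sum.cong)
      also have "\<dots> = 0" using ij n by (simp add: sum_subtractf)
      finally have "y \<in> carrier ?V"
        using yc ij unfolding carrier_parabolic
        by (auto simp: y_def S_iff below_mono split: if_splits)
      then have "?f (commutator_mat x y) = 0" by (rule fx)
      then have "0 = (\<Sum>p<n. \<Sum>q<n. D p q * y $$ (q, p))"
        unfolding trace_form_commutator[OF xc(1) yc] D_def by simp
      also have "\<dots> = (\<Sum>p<n. \<Sum>q<n. (if q = j then if p = i then D i j else 0 else 0)
          - (if q = p then if i = j then D p p / of_nat n else 0 else 0))"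
        by (intro sum.cong refl) (auto simp: y_def right_diff_distrib)
      also have "\<dots> = D i j - (if i = j then (\<Sum>p<n. D p p) / of_nat n else 0)"
        using ij by (simp add: sum_subtractf sum_divide_distrib)
      also have "\<dots> = D i j" using trD by simp
      finally show ?thesis by simp
    qed
    moreover have "supported {..<n} S (entries x)"
      using xP unfolding supported_def entries_def carrier_parabolic by (auto simp: S_iff split: if_splits)
    ultimately have "entries x \<in> stab {..<n} S F" by (simp add: stab_def D_def)
    then obtain c where c: "\<And>i j. \<lbrakk>i < n; j < n\<rbrakk> \<Longrightarrow> x $$ (i, j) = (if i = j then c else 0)"
      using rig xc unfolding rigid_by_def scalar_on_def entries_def by fastforce
    have "trace_mat x = of_nat n * c" using xc c by (simp add: trace_mat_def)
    then have "c = 0" using xc n by simp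
    then have "x = 0\<^sub>m n n" using xc c by (intro eq_matI) auto
    then show "x \<in> {0\<^sub>m n n}" by simp
  qed
qed

text \<open>
  Subtracting the mean of the diagonal makes a stabilising matrix traceless.
\<close>

lemma trivial_stabilizer_imp_rigid:
  fixes F :: "nat \<Rightarrow> nat \<Rightarrow> 'k"
  assumes fF: "\<And>A. A \<in> carrier (parabolic K a) \<Longrightarrow> f A = (\<Sum>i<n. \<Sum>j<n. F j i * A $$ (i, j))"
    and triv: "lie_stabilizer (parabolic K a) commutator_mat f = {0\<^sub>m n n}"
  shows "rigid_by {..<n} S F"
  unfolding rigid_by_def
proof
  fix x assume x: "x \<in> stab {..<n} S F"
  define c where "c = (\<Sum>i<n. x i i) / of_nat n"
  define X where "X = mat n n (\<lambda>(i, j). x i j - (if i = j then c else 0))"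
  have Xc: "X \<in> carrier_mat n n" by (simp add: X_def)
  have "trace_mat X = (\<Sum>i<n. x i i - c)" using Xc by (simp add: trace_mat_def X_def)
  also have "\<dots> = 0" using n by (simp add: sum_subtractf c_def)
  finally have "trace_mat X = 0" .
  moreover have "below a i j" if "i < n" "j < n" "X $$ (i, j) \<noteq> 0" for i j
  proof (cases "i = j")
    case True
    then show ?thesis by (simp add: below_mono)
  next
    case False
    then have "x i j \<noteq> 0" using that by (simp add: X_def)
    then have "S i j" using x unfolding stab_def supported_def by blast
    then show ?thesis using S_iff that by blast
  qed
  ultimately have XP: "X \<in> carrier (parabolic K a)"
    using Xc unfolding carrier_parabolic by blast
  have D: "mmul {..<n} F (entries X) i j = mmul {..<n} (entries X) F i j" if ij: "i < n" "j < n" "S j i" for i j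
  proof -
    have "mmul {..<n} F (entries X) i j = (\<Sum>k<n. F i k * x k j - (if k = j then F i j * c else 0))"
      unfolding mmul_def by (rule sum.cong) (use ij in \<open>auto simp: entries_def X_def right_diff_distrib\<close>)
    moreover have "mmul {..<n} (entries X) F i j = (\<Sum>k<n. x i k * F k j - (if k = i then F i j * c else 0))"
      unfolding mmul_def by (rule sum.cong) (use ij in \<open>auto simp: entries_def X_def left_diff_distrib\<close>)
    moreover have "(\<Sum>k<n. F i k * x k j) = (\<Sum>k<n. x i k * F k j)"
      using x ij unfolding stab_def mmul_def by auto
    ultimately show ?thesis using ij by (simp add: sum_subtractf)
  qed
  have "f (commutator_mat X y) = 0" if y: "y \<in> carrier (parabolic K a)" for y
  proof -
    have yc: "y \<in> carrier_mat n n" using y by (simp add: carrier_parabolic)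
    have "f (commutator_mat X y) = (\<Sum>i<n. \<Sum>j<n. (mmul {..<n} F (entries X) i j - mmul {..<n} (entries X) F i j) * y $$ (j, i))"
      using fF[OF commutator_closed[OF XP y]] trace_form_commutator[OF Xc yc, of F] by simp
    also have "\<dots> = 0"
    proof (intro sum.neutral ballI)
      fix i j assume "i \<in> {..<n}" "j \<in> {..<n}"
      then show "(mmul {..<n} F (entries X) i j - mmul {..<n} (entries X) F i j) * y $$ (j, i) = 0"
        using D[of i j] y by (cases "y $$ (j, i) = 0") (auto simp: carrier_parabolic S_iff)
    qed
    finally show ?thesis .
  qed
  then have "X \<in> lie_stabilizer (parabolic K a) commutator_mat f"
    using XP by (simp add: lie_stabilizer_def)
  then have X0: "X = 0\<^sub>m n n" using triv by blast
  have "x i j = (if i = j then c else 0)" if "i < n" "j < n" for i j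
  proof -
    have "X $$ (i, j) = 0" using X0 that by simp
    then show ?thesis using that by (auto simp: X_def)
  qed
  then show "scalar_on {..<n} x" unfolding scalar_on_def by blast
qed

theorem lie_index_eq_0_iff_rigid:
  "lie_index (parabolic K a) commutator_mat = 0 \<longleftrightarrow> rigid K a [n]"
proof
  assume "lie_index (parabolic K a) commutator_mat = 0"
  then obtain f where f: "f \<in> dual_space (parabolic K a)"
    "lie_stabilizer (parabolic K a) commutator_mat f = {0\<^sub>m n n}"
    unfolding lie_index_eq_0 by blast
  obtain F :: "nat \<Rightarrow> nat \<Rightarrow> 'k" where
    "\<And>A. A \<in> carrier (parabolic K a) \<Longrightarrow> f A = (\<Sum>i<n. \<Sum>j<n. F j i * A $$ (i, j))"
    using dual_trace_functional[OF f(1)] by blast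
  from trivial_stabilizer_imp_rigid[OF this f(2)] show "rigid K a [n]"
    unfolding rigid_def n(1) by blast
next
  assume "rigid K a [n]"
  then obtain F :: "nat \<Rightarrow> nat \<Rightarrow> 'k" where "rigid_by {..<n} S F"
    unfolding rigid_def n(1) by blast
  from rigid_imp_trivial_stabilizer[OF this] trace_functional_dual[of F]
  show "lie_index (parabolic K a) commutator_mat = 0"
    unfolding lie_index_eq_0 by blast
qed

end

section \<open>Meander paths of compositions\<close>

text \<open>
  The meander of the parabolic subalgebra: the second reflection is \<open>y \<mapsto> n - 1 - y\<close>.
\<close>

definition path_comp :: "nat list \<Rightarrow> bool" where
  "path_comp a \<longleftrightarrow> meander_path a [sum_list a]"

lemma refl_in_append:
  "refl_in (a @ b) i = (if i < sum_list a then refl_in a i else sum_list a + refl_in b (i - sum_list a))"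
  by (induction a arbitrary: i) (auto simp: less_diff_conv2 add.commute)

lemma refl_in_rev:
  "i < sum_list a \<Longrightarrow> refl_in (rev a) (sum_list a - 1 - i) = sum_list a - 1 - refl_in a i"
proof (induction a arbitrary: i)
  case (Cons x a)
  show ?case
  proof (cases "i < x")
    case True
    have "refl_in (rev a @ [x]) (x + sum_list a - 1 - i) = sum_list a + refl_in [x] (x - 1 - i)"
    proof -
      have "\<not> x + sum_list a - 1 - i < sum_list a" "x + sum_list a - 1 - i - sum_list a = x - 1 - i"
        using True by linarith+
      then show ?thesis by (simp only: refl_in_append sum_list_rev if_False)
    qed
    then show ?thesis using True by simp
  next
    case False
    then have i: "i - x < sum_list a" using Cons.prems by simp
    have e: "x + sum_list a - 1 - i = sum_list a - 1 - (i - x)" using False by simp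
    have "refl_in (rev a @ [x]) (x + sum_list a - 1 - i) = refl_in (rev a) (sum_list a - 1 - (i - x))"
      unfolding e using i by (simp add: refl_in_append sum_list_rev)
    then show ?thesis using Cons.IH[OF i] False refl_in_less[OF i] by simp
  qed
qed simp

text \<open>
  Complements of closed sets are closed, so a disconnected graph has a closed set that avoids \<open>v\<close>.
\<close>

lemma connected_avoid:
  assumes v: "v \<in> I"
    and s: "\<And>x. x \<in> I \<Longrightarrow> s x \<in> I" "\<And>x. x \<in> I \<Longrightarrow> s (s x) = x"
    and t: "\<And>x. x \<in> I \<Longrightarrow> t x \<in> I" "\<And>x. x \<in> I \<Longrightarrow> t (t x) = x"
  shows "connected_under I s t \<longleftrightarrow>
    (\<forall>A\<subseteq>I. (\<forall>y\<in>A. s y \<in> A) \<longrightarrow> (\<forall>y\<in>A. t y \<in> A) \<longrightarrow> v \<notin> A \<longrightarrow> A = {})"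
proof
  assume "connected_under I s t"
  then show "\<forall>A\<subseteq>I. (\<forall>y\<in>A. s y \<in> A) \<longrightarrow> (\<forall>y\<in>A. t y \<in> A) \<longrightarrow> v \<notin> A \<longrightarrow> A = {}"
    unfolding connected_under_def image_subset_iff using v by blast
next
  assume R: "\<forall>A\<subseteq>I. (\<forall>y\<in>A. s y \<in> A) \<longrightarrow> (\<forall>y\<in>A. t y \<in> A) \<longrightarrow> v \<notin> A \<longrightarrow> A = {}"
  have "A = I" if A: "A \<subseteq> I" "A \<noteq> {}" "\<forall>y\<in>A. s y \<in> A" "\<forall>y\<in>A. t y \<in> A" for A
  proof -
    have "v \<in> A" using R A by blast
    have "s y \<in> I - A" if "y \<in> I - A" for y
    proof -
      have "s y \<notin> A"
      proof
        assume "s y \<in> A"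
        then have "s (s y) \<in> A" using A(3) by blast
        then show False using s(2) that by simp
      qed
      then show ?thesis using s(1) that by blast
    qed
    moreover have "t y \<in> I - A" if "y \<in> I - A" for y
    proof -
      have "t y \<notin> A"
      proof
        assume "t y \<in> A"
        then have "t (t y) \<in> A" using A(4) by blast
        then show False using t(2) that by simp
      qed
      then show ?thesis using t(1) that by blast
    qed
    ultimately have "\<forall>y\<in>I - A. s y \<in> I - A" "\<forall>y\<in>I - A. t y \<in> I - A" by blast+
    then have "I - A = {}" using R[THEN spec, of "I - A"] \<open>v \<in> A\<close> by simp
    then show ?thesis using A by blast
  qed
  then show "connected_under I s t" unfolding connected_under_def image_subset_iff using v by blast
qed

definition invariant :: "nat list \<Rightarrow> nat set \<Rightarrow> bool" where
  "invariant a A \<longleftrightarrow> A \<subseteq> {..<sum_list a} \<and> (\<forall>y\<in>A. refl_in a y \<in> A) \<and> (\<forall>y\<in>A. sum_list a - 1 - y \<in> A)"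

text \<open>
  An odd sum has an odd summand, so the parity condition is one on the parts of \<open>a\<close>. For \<open>v\<close> one
  can take the vertex at which the graph is to be cut.
\<close>

lemma path_comp_avoid:
  assumes "v < sum_list a"
  shows "path_comp a \<longleftrightarrow> (\<forall>A. invariant a A \<longrightarrow> v \<notin> A \<longrightarrow> A = {}) \<and> (\<exists>x\<in>set a. odd x)"
proof -
  let ?n = "sum_list a"
  have "connected_under {..<?n} (refl_in a) (refl_in [?n]) \<longleftrightarrow>
     (\<forall>A\<subseteq>{..<?n}. (\<forall>y\<in>A. refl_in a y \<in> A) \<longrightarrow> (\<forall>y\<in>A. refl_in [?n] y \<in> A) \<longrightarrow> v \<notin> A \<longrightarrow> A = {})"
  proof (rule connected_avoid)
    show "x \<in> {..<?n} \<Longrightarrow> refl_in a x \<in> {..<?n}" for x using refl_in_less[of x a] by simp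
  qed (use assms refl_in_invol in \<open>auto\<close>)
  also have "\<dots> \<longleftrightarrow> (\<forall>A. invariant a A \<longrightarrow> v \<notin> A \<longrightarrow> A = {})"
  proof -
    have "(\<forall>y\<in>A. refl_in [?n] y \<in> A) \<longleftrightarrow> (\<forall>y\<in>A. ?n - 1 - y \<in> A)" if "A \<subseteq> {..<?n}" for A
      using that by (intro ball_cong) auto
    then show ?thesis unfolding invariant_def by (metis (no_types, lifting))
  qed
  moreover have "(\<exists>x\<in>set a \<union> set [?n]. odd x) \<longleftrightarrow> (\<exists>x\<in>set a. odd x)"
  proof -
    have "odd (sum_list a) \<Longrightarrow> \<exists>x\<in>set a. odd x" by (induction a) auto
    then show ?thesis by auto
  qed
  ultimately show ?thesis unfolding path_comp_def meander_path_def by simp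
qed

lemma path_comp_invariant:
  assumes "path_comp a" "invariant a A" "A \<noteq> {}" "v < sum_list a"
  shows "v \<in> A"
  using path_comp_avoid[OF assms(4)] assms by blast

lemma path_comp_odd: "path_comp a \<Longrightarrow> \<exists>x\<in>set a. odd x"
proof -
  assume p: "path_comp a"
  then have "0 < sum_list a" unfolding path_comp_def meander_path_def connected_under_def
    by (metis gr0I lessThan_0)
  then show ?thesis using path_comp_avoid p by blast
qed

lemma path_comp_sum_pos: "path_comp a \<Longrightarrow> 0 < sum_list a"
  unfolding path_comp_def meander_path_def connected_under_def
    by (metis gr0I lessThan_0)

lemma path_comp_odd_parts: "path_comp a \<Longrightarrow> odd_parts a + (if odd (sum_list a) then 1 else 0) = 2"
  using meander_path_odd_parts[of a "[sum_list a]"] unfolding path_comp_def by (auto simp: odd_parts_def)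

lemma invariant_rev: "invariant (rev a) A \<longleftrightarrow> invariant a A"
proof -
  have 1: "invariant (rev a) A" if A: "invariant a A" for a A
  proof -
    let ?n = "sum_list a"
    have "refl_in (rev a) y \<in> A" if y: "y \<in> A" for y
    proof -
      have "y < ?n" using A y unfolding invariant_def by blast
      then have e: "refl_in (rev a) y = ?n - 1 - refl_in a (?n - 1 - y)"
        using refl_in_rev[of "?n - 1 - y" a] by simp
      show ?thesis unfolding e using A y unfolding invariant_def by blast
    qed
    then show ?thesis using A unfolding invariant_def by (simp add: sum_list_rev)
  qed
  show ?thesis using 1[of a A] 1[of "rev a" A] by auto
qed

lemma path_comp_rev: "path_comp (rev a) \<longleftrightarrow> path_comp a"
proof -
  have 1: "path_comp (rev a)" if p: "path_comp a" for a
  proof -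
    have s: "0 < sum_list a" "0 < sum_list (rev a)" using path_comp_sum_pos[OF p] by (auto simp: sum_list_rev)
    show ?thesis using p unfolding path_comp_avoid[OF s(1)] path_comp_avoid[OF s(2)] invariant_rev by simp
  qed
  show ?thesis using 1[of a] 1[of "rev a"] by auto
qed

lemma refl_glue:
  assumes "sum_list L = x" "sum_list M = m"
  shows "refl_in (L @ M @ 2 # R) i = (if i < x then refl_in L i else if i < x + m then x + refl_in M (i - x)
     else if i = x + m then x + m + 1 else if i = x + m + 1 then x + m else x + m + 2 + refl_in R (i - (x + m + 2)))"
  using assms by (auto simp: refl_in_append)

text \<open>
  Put \<open>x = sum_list L\<close> and \<open>m = sum_list M\<close>. The 2 occupies the positions \<open>x + m\<close> and \<open>x + m + 1\<close>.
  The positions \<open>x, \<dots>, x + m\<close> are permuted by \<open>y \<mapsto> 2 * x + m - y\<close> like the vertices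
  of \<open>M @ [1]\<close>, with \<open>x + m\<close> in the role of the last part 1; all others behave like \<open>L @ 1 # R\<close>,
  with \<open>x + m + 1\<close> in the role of the part 1. Thus the arc of the 2 joins an end of one graph to
  an end of the other, and the whole is a path iff both are.
\<close>

lemma path_comp_cut:
  assumes LR: "sum_list L = sum_list R + 1"
  shows "path_comp (L @ M @ 2 # R) \<longleftrightarrow> path_comp (L @ 1 # R) \<and> path_comp (M @ [1])"
proof -
  note One_nat_def [simp del]
  define x m where "x = sum_list L" and "m = sum_list M"
  let ?W = "L @ M @ 2 # R" and ?O = "L @ 1 # R" and ?C = "M @ [1]"
  have n: "sum_list ?W = 2 * x + m + 1" "sum_list ?O = 2 * x" "sum_list ?C = m + 1" "0 < x"
    using LR by (auto simp: x_def m_def)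
  have rW: "refl_in ?W i = (if i < x then refl_in L i else if i < x + m then x + refl_in M (i - x)
     else if i = x + m then x + m + 1 else if i = x + m + 1 then x + m else x + m + 2 + refl_in R (i - (x + m + 2)))" for i
    by (rule refl_glue) (auto simp: x_def m_def)
  have rO: "refl_in ?O i = (if i < x then refl_in L i else if i = x then x else x + 1 + refl_in R (i - (x + 1)))" for i
    by (auto simp: refl_in_append x_def)
  have rC: "refl_in ?C i = (if i < m then refl_in M i else i)" for i
    by (auto simp: refl_in_append m_def)
  \<comment> \<open>the embedding of the outer graph around the middle piece\<close>
  define e where "e i = (if i < x then i else i + m + 1)" for i
  have eW: "refl_in ?W (e i) = e (refl_in ?O i)" if "i < 2 * x" "i \<noteq> x" for i
  proof (cases "i < x")
    case True
    then have "refl_in L i < x" using refl_in_less[of i L] by (simp add: x_def)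
    then show ?thesis using True by (simp add: rW rO e_def)
  next
    case False
    then have "i > x" using that by simp
    moreover from this have "i + m + 1 - (x + m + 2) = i - (x + 1)" by simp
    ultimately show ?thesis using False by (simp add: rW rO e_def)
  qed
  have eR: "2 * x + m - e i = e (2 * x - 1 - i)" if "i < 2 * x" for i
    using that by (auto simp: e_def)
  have CW: "refl_in ?W (x + i) = x + refl_in ?C i" if "i < m" for i
    using that by (simp add: rW rC)
  have Cless: "refl_in M i < m" if "i < m" for i using refl_in_less[of i M] that by (simp add: m_def)
  \<comment> \<open>The three graphs are tested by closed sets avoiding the ends of the bridge: \<open>x + m\<close> in the
      whole, x and m in the two pieces.\<close>
  have "(\<forall>A. invariant ?W A \<longrightarrow> x + m \<notin> A \<longrightarrow> A = {}) \<longleftrightarrow>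
     (\<forall>A. invariant ?O A \<longrightarrow> x \<notin> A \<longrightarrow> A = {}) \<and> (\<forall>A. invariant ?C A \<longrightarrow> m \<notin> A \<longrightarrow> A = {})"
    (is "?PW \<longleftrightarrow> ?PO \<and> ?PC")
  proof (intro iffI conjI allI impI)
    fix A assume W: ?PW and A: "invariant ?O A" "x \<notin> A"
    have "invariant ?W (e ` A)"
      unfolding invariant_def n
    proof (intro conjI ballI)
      show "e ` A \<subseteq> {..<2 * x + m + 1}" using A n by (auto simp: invariant_def e_def)
      fix y assume "y \<in> e ` A"
      then obtain i where i: "i \<in> A" "y = e i" by blast
      then have "i < 2 * x" "i \<noteq> x" using A n unfolding invariant_def by auto
      then show "refl_in ?W y \<in> e ` A" using eW i A unfolding invariant_def by simp
      have "2 * x - 1 - i \<in> A" using A(1) i unfolding invariant_def n by blast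
      then show "2 * x + m + 1 - 1 - y \<in> e ` A" using eR[OF \<open>i < 2 * x\<close>] i by simp
    qed
    moreover have "x + m \<notin> e ` A" using A(2) by (auto simp: e_def)
    ultimately show "A = {}" using W by blast
  next
    fix A assume W: ?PW and A: "invariant ?C A" "m \<notin> A"
    have "invariant ?W ((+) x ` A)"
      unfolding invariant_def n
    proof (intro conjI ballI)
      show "(+) x ` A \<subseteq> {..<2 * x + m + 1}" using A n by (auto simp: invariant_def)
      fix y assume "y \<in> (+) x ` A"
      then obtain i where i: "i \<in> A" "y = x + i" by blast
      then have "i < m + 1" "i \<noteq> m" using A unfolding invariant_def n by auto
      then have im: "i < m" by linarith
      then show "refl_in ?W y \<in> (+) x ` A" using CW i A unfolding invariant_def by simp
      have "m + 1 - 1 - i \<in> A" using A(1) i unfolding invariant_def n by blast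
      moreover have "2 * x + m + 1 - 1 - y = x + (m + 1 - 1 - i)" using i im by simp
      ultimately show "2 * x + m + 1 - 1 - y \<in> (+) x ` A" by blast
    qed
    moreover have "x + m \<notin> (+) x ` A" using A(2) by auto
    ultimately show "A = {}" using W by blast
  next
    fix A assume OC: "?PO \<and> ?PC" and A: "invariant ?W A" "x + m \<notin> A"
    have sA: "refl_in ?W y \<in> A" "2 * x + m - y \<in> A" "y < 2 * x + m + 1" if "y \<in> A" for y
      using A(1) that unfolding invariant_def n by auto
    have nA: "x + m + 1 \<notin> A"
    proof
      assume "x + m + 1 \<in> A"
      from sA(1)[OF this] A(2) show False by (simp add: rW)
    qed
    have "invariant ?O {i. i < 2 * x \<and> e i \<in> A}"
      unfolding invariant_def n
    proof (intro conjI ballI)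
      fix i assume "i \<in> {i. i < 2 * x \<and> e i \<in> A}"
      then have i: "i < 2 * x" "e i \<in> A" by auto
      then have "i \<noteq> x" using nA by (auto simp: e_def add.assoc)
      then show "refl_in ?O i \<in> {i. i < 2 * x \<and> e i \<in> A}"
        using sA(1)[OF i(2)] eW[OF i(1)] refl_in_less[of i ?O] i n by simp
      show "2 * x - 1 - i \<in> {i. i < 2 * x \<and> e i \<in> A}"
        using sA(2)[OF i(2)] eR[OF i(1)] i by simp
    qed auto
    moreover have "x \<notin> {i. i < 2 * x \<and> e i \<in> A}" using nA by (simp add: e_def)
    ultimately have O: "{i. i < 2 * x \<and> e i \<in> A} = {}" using OC by blast
    have "invariant ?C {i. i < m \<and> x + i \<in> A}"
      unfolding invariant_def n
    proof (intro conjI ballI)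
      fix i assume "i \<in> {i. i < m \<and> x + i \<in> A}"
      then have i: "i < m" "x + i \<in> A" by auto
      then show "refl_in ?C i \<in> {i. i < m \<and> x + i \<in> A}"
        using sA(1)[OF i(2)] CW[OF i(1)] Cless[OF i(1)] by (simp add: rC)
      have e: "2 * x + m - (x + i) = x + (m - i)" using i by simp
      then have "x + (m - i) \<in> A" using sA(2)[OF i(2)] by simp
      moreover from this have "i \<noteq> 0" using A(2) by (metis diff_zero)
      ultimately show "m + 1 - 1 - i \<in> {i. i < m \<and> x + i \<in> A}" using i by simp
    qed auto
    then have C: "{i. i < m \<and> x + i \<in> A} = {}" using OC by blast
    have "y \<notin> A" for y
    proof
      assume y: "y \<in> A"
      consider "y < x" | "x \<le> y" "y < x + m" | "y = x + m" | "x + m < y" by linarith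
      then show False
      proof cases
        case 1
        then have "y \<in> {i. i < 2 * x \<and> e i \<in> A}" using y by (simp add: e_def)
        then show False using O by blast
      next
        case 2
        then have "y - x \<in> {i. i < m \<and> x + i \<in> A}" using y by auto
        then show False using C by blast
      next
        case 3
        then show False using y A by blast
      next
        case 4
        then have "y - m - 1 \<in> {i. i < 2 * x \<and> e i \<in> A}" using y sA(3)[OF y] by (auto simp: e_def)
        then show False using O by blast
      qed
    qed
    then show "A = {}" by blast
  qed
  moreover have "\<exists>y\<in>set ?W. odd y"
  proof -
    have "odd (sum_list (L @ R))" using LR by simp
    moreover have "odd (sum_list a) \<Longrightarrow> \<exists>y\<in>set a. odd y" for a :: "nat list" by (induction a) auto
    ultimately show ?thesis by fastforce
  qed
  ultimately show ?thesis
    using path_comp_avoid[of "x + m" ?W, unfolded n] path_comp_avoid[of x ?O, unfolded n] path_comp_avoid[of m ?C, unfolded n] n(4) by simp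
qed

text \<open>
  The positions of the two parts 2 form a cycle.
\<close>

lemma not_path_aligned:
  assumes LR: "sum_list L = sum_list R"
  shows "\<not> path_comp (L @ 2 # M @ 2 # R)"
proof
  assume p: "path_comp (L @ 2 # M @ 2 # R)" (is "path_comp ?W")
  define x m where "x = sum_list L" and "m = sum_list M"
  have n: "sum_list ?W = 2 * x + m + 4" using LR by (simp add: x_def m_def)
  have r: "refl_in ?W x = x + 1" "refl_in ?W (x + 1) = x" "refl_in ?W (x + m + 2) = x + m + 3" "refl_in ?W (x + m + 3) = x + m + 2"
    by (auto simp: refl_in_append x_def m_def)
  let ?A = "{x, x + 1, x + m + 2, x + m + 3}"
  have inv: "invariant ?W ?A"
    unfolding invariant_def n by (simp add: r[simplified])
  have "0 \<in> ?A" using path_comp_invariant[OF p inv, of 0] n by simp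
  then have x0: "x = 0" by simp
  have "m = 0"
  proof (rule ccontr)
    assume "m \<noteq> 0"
    then have "2 \<notin> ?A" "2 < sum_list ?W" using x0 n by auto
    then show False using path_comp_invariant[OF p inv] by blast
  qed
  then have "sum_list L = 0" "sum_list R = 0" "sum_list M = 0" using x0 LR by (simp_all only: x_def m_def)
  then have "\<forall>y\<in>set ?W. even y" by auto
  then show False using path_comp_odd[OF p] by blast
qed

text \<open>
  The two positions of the central 2 form a cycle.
\<close>

lemma not_path_central:
  assumes LR: "sum_list L = sum_list R"
  shows "\<not> path_comp (L @ 2 # R)"
proof
  assume p: "path_comp (L @ 2 # R)" (is "path_comp ?W")
  define x where "x = sum_list L"
  have n: "sum_list ?W = 2 * x + 2" using LR by (simp add: x_def)
  have r: "refl_in ?W x = x + 1" "refl_in ?W (x + 1) = x"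
    by (auto simp: refl_in_append x_def)
  have inv: "invariant ?W {x, x + 1}"
    unfolding invariant_def n by (simp add: r[simplified])
  have "0 \<in> {x, x + 1}" using path_comp_invariant[OF p inv, of 0] n by simp
  then have "x = 0" by simp
  then have "sum_list L = 0" "sum_list R = 0" using LR by (simp_all only: x_def)
  then have "\<forall>y\<in>set ?W. even y" by auto
  then show False using path_comp_odd[OF p] by blast
qed

text \<open>
  The inner positions of the 4 and the positions of the 2 form a cycle.
\<close>

lemma not_path_4_21: "\<not> path_comp (4 # M @ [2, 1])"
proof
  assume p: "path_comp (4 # M @ [2, 1])" (is "path_comp ?W")
  define m where "m = sum_list M"
  have n: "sum_list ?W = m + 7" by (simp add: m_def)
  have r: "refl_in ?W 1 = 2" "refl_in ?W 2 = 1" "refl_in ?W (m + 4) = m + 5" "refl_in ?W (m + 5) = m + 4"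
    by (auto simp: refl_in_append m_def)
  have inv: "invariant ?W {1, 2, m + 4, m + 5}"
    unfolding invariant_def n by (simp add: r[simplified])
  show False using path_comp_invariant[OF p inv, of 0] n by simp
qed

lemma path_comp_I:
  assumes "0 < sum_list a" "\<exists>x\<in>set a. odd x"
    "\<And>A y. \<lbrakk>\<And>y. y \<in> A \<Longrightarrow> refl_in a y \<in> A; \<And>y. y \<in> A \<Longrightarrow> sum_list a - 1 - y \<in> A; y \<in> A; y < sum_list a\<rbrakk> \<Longrightarrow> 0 \<in> A"
  shows "path_comp a"
  unfolding path_comp_avoid[OF assms(1)]
proof (rule conjI[OF _ assms(2)], intro allI impI)
  fix A assume A: "invariant a A" "0 \<notin> A"
  show "A = {}"
  proof (rule ccontr)
    assume "A \<noteq> {}"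
    then obtain y where y: "y \<in> A" by blast
    then have "y < sum_list a" using A unfolding invariant_def by blast
    have cl: "\<And>y. y \<in> A \<Longrightarrow> refl_in a y \<in> A" "\<And>y. y \<in> A \<Longrightarrow> sum_list a - 1 - y \<in> A"
      using A(1) unfolding invariant_def by blast+
    have "0 \<in> A" using cl y \<open>y < sum_list a\<close> by (rule assms(3))
    then show False using A by blast
  qed
qed

text \<open>
  Some small paths, each checked by following the graph from every vertex to vertex 0.
\<close>

lemma path_comp_1: "path_comp [1]"
proof (rule path_comp_I)
  fix A :: "nat set" and y assume "y \<in> A" "y < sum_list [1]"
  then show "0 \<in> A" by simp
qed auto

lemma path_comp_11: "path_comp [1, 1]"
proof (rule path_comp_I)
  fix A :: "nat set" and y assume c: "\<And>y. y \<in> A \<Longrightarrow> refl_in [1,1] y \<in> A" "\<And>y. y \<in> A \<Longrightarrow> sum_list [1,1] - 1 - y \<in> A" "y \<in> A" "y < sum_list [1,1]"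
  have "y = 0 \<or> y = 1" using c(4) by auto
  moreover have "1 \<in> A \<Longrightarrow> 0 \<in> A" using c(2)[of 1] by simp
  ultimately show "0 \<in> A" using c(3) by blast
qed auto

lemma path_comp_31: "path_comp [3, 1]"
proof (rule path_comp_I)
  fix A :: "nat set" and y assume c: "\<And>y. y \<in> A \<Longrightarrow> refl_in [3,1] y \<in> A" "\<And>y. y \<in> A \<Longrightarrow> sum_list [3,1] - 1 - y \<in> A" "y \<in> A" "y < sum_list [3,1]"
  have "y = 0 \<or> y = 1 \<or> y = 2 \<or> y = 3" using c(4) by auto
  moreover have "1 \<in> A \<Longrightarrow> 2 \<in> A" using c(2)[of 1] by simp
  moreover have "2 \<in> A \<Longrightarrow> 0 \<in> A" using c(1)[of 2] by simp
  moreover have "3 \<in> A \<Longrightarrow> 0 \<in> A" using c(2)[of 3] by simp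
  ultimately show "0 \<in> A" using c(3) by blast
qed auto

lemma path_comp_41: "path_comp [4, 1]"
proof (rule path_comp_I)
  fix A :: "nat set" and y assume c: "\<And>y. y \<in> A \<Longrightarrow> refl_in [4,1] y \<in> A" "\<And>y. y \<in> A \<Longrightarrow> sum_list [4,1] - 1 - y \<in> A" "y \<in> A" "y < sum_list [4,1]"
  have "y = 0 \<or> y = 1 \<or> y = 2 \<or> y = 3 \<or> y = 4" using c(4) by auto
  moreover have "4 \<in> A \<Longrightarrow> 0 \<in> A" using c(2)[of 4] by simp
  moreover have "3 \<in> A \<Longrightarrow> 0 \<in> A" using c(1)[of 3] by simp
  moreover have "1 \<in> A \<Longrightarrow> 3 \<in> A" using c(2)[of 1] by simp
  moreover have "2 \<in> A \<Longrightarrow> 1 \<in> A" using c(1)[of 2] by simp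
  ultimately show "0 \<in> A" using c(3) by blast
qed auto

lemma path_comp_1414: "path_comp [1, 4, 1, 4]"
proof (rule path_comp_I)
  fix A :: "nat set" and y assume c: "\<And>y. y \<in> A \<Longrightarrow> refl_in [1,4,1,4] y \<in> A" "\<And>y. y \<in> A \<Longrightarrow> sum_list [1,4,1,4] - 1 - y \<in> A" "y \<in> A" "y < sum_list [1,4,1,4]"
  have "y = 0 \<or> y = 1 \<or> y = 2 \<or> y = 3 \<or> y = 4 \<or> y = 5 \<or> y = 6 \<or> y = 7 \<or> y = 8 \<or> y = 9" using c(4) by auto
  moreover have "9 \<in> A \<Longrightarrow> 0 \<in> A" using c(2)[of 9] by (simp add: numeral_eq_Suc)
  moreover have "6 \<in> A \<Longrightarrow> 9 \<in> A" using c(1)[of 6] by (simp add: numeral_eq_Suc)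
  moreover have "3 \<in> A \<Longrightarrow> 6 \<in> A" using c(2)[of 3] by (simp add: numeral_eq_Suc)
  moreover have "2 \<in> A \<Longrightarrow> 3 \<in> A" using c(1)[of 2] by (simp add: numeral_eq_Suc)
  moreover have "7 \<in> A \<Longrightarrow> 2 \<in> A" using c(2)[of 7] by (simp add: numeral_eq_Suc)
  moreover have "8 \<in> A \<Longrightarrow> 7 \<in> A" using c(1)[of 8] by (simp add: numeral_eq_Suc)
  moreover have "1 \<in> A \<Longrightarrow> 8 \<in> A" using c(2)[of 1] by (simp add: numeral_eq_Suc)
  moreover have "4 \<in> A \<Longrightarrow> 1 \<in> A" using c(1)[of 4] by (simp add: numeral_eq_Suc)
  moreover have "5 \<in> A \<Longrightarrow> 4 \<in> A" using c(2)[of 5] by (simp add: numeral_eq_Suc)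
  ultimately show "0 \<in> A" using c(3) by blast
qed auto

section \<open>Cuts of a composition\<close>

text \<open>
  Measures how far a composition is from having as many parts as possible, see \<open>sum_excess\<close>.
\<close>

definition excess :: "nat list \<Rightarrow> nat" where
  "excess a = (\<Sum>x\<leftarrow>a. (x - 1) div 2)"

definition positive :: "nat list \<Rightarrow> bool" where
  "positive a \<longleftrightarrow> (\<forall>x\<in>set a. 0 < x)"

lemma excess_simps [simp]: "excess [] = 0" "excess (x # a) = (x - 1) div 2 + excess a"
  "excess (a @ b) = excess a + excess b" "excess (rev a) = excess a"
  by (auto simp: excess_def rev_map[symmetric] sum_list_rev)

lemma positive_simps [simp]: "positive []" "positive (x # a) \<longleftrightarrow> 0 < x \<and> positive a"
  "positive (a @ b) \<longleftrightarrow> positive a \<and> positive b" "positive (rev a) \<longleftrightarrow> positive a"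
  by (auto simp: positive_def)

lemma odd_parts_simps [simp]: "odd_parts [] = 0" "odd_parts (x # a) = (if odd x then 1 else 0) + odd_parts a"
  "odd_parts (a @ b) = odd_parts a + odd_parts b" "odd_parts (rev a) = odd_parts a"
  by (auto simp: odd_parts_def rev_filter[symmetric])

lemma positive_sum_0: "positive a \<Longrightarrow> sum_list a = 0 \<Longrightarrow> a = []"
  by (cases a) auto

lemma sum_excess: "positive a \<Longrightarrow> sum_list a + odd_parts a = 2 * length a + 2 * excess a"
proof (induction a)
  case (Cons x a)
  have "0 < x" using Cons.prems by simp
  then have "x + (if odd x then 1 else 0) = 2 + 2 * ((x - 1) div 2)" by presburger
  then show ?case using Cons by simp
qed simp

lemma prefix_sum:
  assumes "L @ B = L' @ B'" "positive (L @ B)" "sum_list L \<le> sum_list L'"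
  obtains X where "L' = L @ X" "B = X @ B'"
proof -
  from assms(1) obtain us where "L = L' @ us \<and> us @ B = B' \<or> L @ us = L' \<and> B = us @ B'"
    unfolding append_eq_append_conv2 by blast
  then show thesis
  proof
    assume u: "L = L' @ us \<and> us @ B = B'"
    then have "us = []" using assms positive_sum_0[of us] by auto
    then show thesis using that[of "[]"] u by simp
  next
    assume "L @ us = L' \<and> B = us @ B'"
    then show thesis using that[of us] by simp
  qed
qed

lemma prefix_unique:
  assumes "L @ B = L' @ B'" "positive (L @ B)" "sum_list L = sum_list L'"
  shows "L = L'" "B = B'"
proof -
  obtain X where X: "L' = L @ X" "B = X @ B'"
    using prefix_sum[OF assms(1,2)] assms(3) by auto
  then have "X = []" using assms positive_sum_0[of X] by auto
  then show "L = L'" "B = B'" using X by auto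
qed

text \<open>
  The decomposition of \<open>path_comp_cut\<close>, with the size of the left piece recorded as the depth of
  the cut.
\<close>

definition cut :: "nat list \<Rightarrow> nat \<Rightarrow> bool" where
  "cut a x \<longleftrightarrow> (\<exists>L M R. a = L @ M @ 2 # R \<and> sum_list L = x \<and> sum_list R + 1 = x)"

definition reducible :: "nat list \<Rightarrow> bool" where
  "reducible a \<longleftrightarrow> (\<exists>x. cut a x \<or> cut (rev a) x)"

lemma cut_less: "cut a x \<Longrightarrow> 2 * x < sum_list a"
  unfolding cut_def by auto

lemma reducible_rev: "reducible (rev a) \<longleftrightarrow> reducible a"
  unfolding reducible_def by auto

lemma not_reducible_no_2: "2 \<notin> set a \<Longrightarrow> \<not> reducible a"
proof
  assume a: "2 \<notin> set a" "reducible a"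
  then obtain L M R where "a = L @ M @ 2 # R \<or> rev a = L @ M @ 2 # R"
    unfolding reducible_def cut_def by blast
  then have "2 \<in> set a \<or> 2 \<in> set (rev a)" by (metis in_set_conv_decomp append.assoc)
  then show False using a by simp
qed

fun two_at :: "nat list \<Rightarrow> nat \<Rightarrow> bool" where
  "two_at [] i = False"
| "two_at (x # a) i = (if i < x then x = 2 else two_at a (i - x))"

lemma two_at_split:
  "two_at a i \<Longrightarrow> \<exists>L R. a = L @ 2 # R \<and> (i = sum_list L \<or> i = sum_list L + 1)"
proof (induction a arbitrary: i)
  case (Cons x a)
  show ?case
  proof (cases "i < x")
    case True
    then have "x # a = [] @ 2 # a" "i = sum_list [] \<or> i = sum_list [] + 1" using Cons.prems by auto
    then show ?thesis by blast
  next
    case False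
    then obtain L R where LR: "a = L @ 2 # R" "i - x = sum_list L \<or> i - x = sum_list L + 1"
      using Cons.IH[of "i - x"] Cons.prems by auto
    then have "x # a = (x # L) @ 2 # R" "i = sum_list (x # L) \<or> i = sum_list (x # L) + 1" using False by auto
    then show ?thesis by blast
  qed
qed simp

text \<open>
  A part 1 contributes one position and no excess, and any part \<open>x > 2\<close> at most 4 positions per
  unit of excess, with one more if it is odd.
\<close>

lemma card_not_two_at:
  "positive a \<Longrightarrow> card {i. i < sum_list a \<and> \<not> two_at a i} \<le> 4 * excess a + odd_parts a"
proof (induction a)
  case (Cons x a)
  let ?N = "\<lambda>a. {i. i < sum_list a \<and> \<not> two_at a i}"
  have fin: "finite (?N a)" for a by simp
  have "?N (x # a) \<subseteq> (if x = 2 then {} else {..<x}) \<union> (+) x ` ?N a"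
  proof
    fix i assume i: "i \<in> ?N (x # a)"
    show "i \<in> (if x = 2 then {} else {..<x}) \<union> (+) x ` ?N a"
    proof (cases "i < x")
      case True
      then show ?thesis using i by auto
    next
      case False
      then have "i = x + (i - x)" "i - x \<in> ?N a" using i by auto
      then show ?thesis by blast
    qed
  qed
  then have "card (?N (x # a)) \<le> card ((if x = 2 then {} else {..<x}) \<union> (+) x ` ?N a)"
    using fin by (intro card_mono) auto
  also have "\<dots> \<le> card (if x = 2 then {} else {..<x}) + card ((+) x ` ?N a)" by (rule card_Un_le)
  also have "card ((+) x ` ?N a) \<le> card (?N a)" by (rule card_image_le[OF fin])
  also have "card (if x = 2 then {} else {..<x}) \<le> 4 * ((x - 1) div 2) + (if odd x then 1 else 0)"
    using Cons.prems by auto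
  finally have "card (?N (x # a)) \<le> 4 * ((x - 1) div 2) + (if odd x then 1 else 0) + card (?N a)" by simp
  then show ?case using Cons by simp
qed simp

text \<open>
  Two parts 2 that meet opposite positions are aligned, or the same central part, or shifted by
  one position against each other. The first two cases give a cycle, the last one is a cut of \<open>a\<close>
  or of its reversal.
\<close>

lemma facing_twos_reducible:
  assumes p: "path_comp a" "positive a" and i: "2 * i < sum_list a"
    and two: "two_at a i" "two_at a (sum_list a - 1 - i)"
  shows "reducible a"
proof -
  let ?n = "sum_list a"
  obtain L R where LR: "a = L @ 2 # R" "i = sum_list L \<or> i = sum_list L + 1"
    using two_at_split[OF two(1)] by blast
  obtain L' R' where LR': "a = L' @ 2 # R'" "?n - 1 - i = sum_list L' \<or> ?n - 1 - i = sum_list L' + 1"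
    using two_at_split[OF two(2)] by blast
  define u w where "u = sum_list L" and "w = sum_list R'"
  have n: "?n = sum_list L' + 2 + w" using LR'(1) by (simp add: w_def)
  have w: "w = i \<or> w + 1 = i" using LR'(2) n i by auto
  have u: "u = i \<or> u + 1 = i" using LR(2) by (auto simp: u_def)
  have "sum_list L \<le> sum_list L'"
  proof (rule ccontr)
    assume "\<not> sum_list L \<le> sum_list L'"
    then have l: "sum_list L = sum_list L' + 1" using u w n i by (auto simp: u_def)
    obtain X where X: "L = L' @ X" "2 # R' = X @ 2 # R"
      using prefix_sum[of L' "2 # R'" L "2 # R"] LR(1) LR'(1) p(2) l by auto
    then have "sum_list X = 1" using l by simp
    then show False using X(2) by (cases X) auto
  qed
  then obtain X where X: "L' = L @ X" "2 # R = X @ 2 # R'"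
    using prefix_sum[of L "2 # R" L' "2 # R'"] LR LR' p(2) by metis
  consider "u = w" | "u = w + 1" | "w = u + 1" using u w by auto
  then show ?thesis
  proof cases
    case 1
    show ?thesis
    proof (cases X)
      case Nil
      then have "R = R'" using X by simp
      then show ?thesis using not_path_central[of L R] 1 p LR by (simp add: u_def w_def)
    next
      case (Cons y X')
      then have "a = L @ 2 # X' @ 2 # R'" using X LR by simp
      then show ?thesis using not_path_aligned[of L R' X'] 1 p by (simp add: u_def w_def)
    qed
  next
    case 2
    have "cut a u" unfolding cut_def using LR' X 2 by (auto simp: u_def w_def)
    then show ?thesis unfolding reducible_def by blast
  next
    case 3
    obtain M where "rev a = rev R' @ M @ 2 # rev L"
    proof (cases X)
      case Nil
      then show thesis using that[of "[]"] X LR by simp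
    next
      case (Cons y X')
      then show thesis using that[of "2 # rev X'"] X LR by simp
    qed
    then have "cut (rev a) w" unfolding cut_def using 3
      by (intro exI[of _ "rev R'"] exI[of _ M] exI[of _ "rev L"]) (simp add: u_def w_def sum_list_rev)
    then show ?thesis unfolding reducible_def by blast
  qed
qed

text \<open>
  Of any two opposite positions one lies outside the parts 2, so the size is at most twice the
  number of such positions, which is at most \<open>4 * excess a + 2\<close>.
\<close>

theorem irreducible_bound:
  assumes p: "path_comp a" "positive a" and irr: "\<not> reducible a"
  shows "sum_list a \<le> 8 * excess a + 4"
proof -
  let ?n = "sum_list a"
  let ?N = "{i. i < ?n \<and> \<not> two_at a i}"
  have nt: "\<not> two_at a i \<or> \<not> two_at a (?n - 1 - i)" if "i < ?n" for i
  proof (cases "2 * i < ?n")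
    case True
    then show ?thesis using facing_twos_reducible[OF p True] irr by blast
  next
    case False
    have "2 * (?n - 1 - i) < ?n" "?n - 1 - (?n - 1 - i) = i" using False that by auto
    then show ?thesis using facing_twos_reducible[OF p, of "?n - 1 - i"] irr by auto
  qed
  have "{..<?n} \<subseteq> ?N \<union> (\<lambda>i. ?n - 1 - i) ` ?N"
  proof
    fix i assume i: "i \<in> {..<?n}"
    show "i \<in> ?N \<union> (\<lambda>i. ?n - 1 - i) ` ?N"
    proof (cases "two_at a i")
      case False
      then show ?thesis using i by simp
    next
      case True
      then have "?n - 1 - i \<in> ?N" using nt i by auto
      moreover have "i = ?n - 1 - (?n - 1 - i)" using i by auto
      ultimately show ?thesis by blast
    qed
  qed
  then have "card {..<?n} \<le> card (?N \<union> (\<lambda>i. ?n - 1 - i) ` ?N)"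
    by (intro card_mono) auto
  also have "\<dots> \<le> card ?N + card ((\<lambda>i. ?n - 1 - i) ` ?N)" by (rule card_Un_le)
  also have "card ((\<lambda>i. ?n - 1 - i) ` ?N) \<le> card ?N" by (rule card_image_le) simp
  finally have "?n \<le> 2 * card ?N" by simp
  moreover have "odd_parts a \<le> 2" using path_comp_odd_parts[OF p(1)] by simp
  ultimately show ?thesis using card_not_two_at[OF p(2)] by linarith
qed

section \<open>Decomposition at the outermost cut\<close>

definition paths :: "nat \<Rightarrow> nat \<Rightarrow> nat list set" where
  "paths N t = {a. positive a \<and> sum_list a = N \<and> path_comp a \<and> excess a = t}"

text \<open>
  The inner factors of cuts.
\<close>

definition cores :: "nat \<Rightarrow> nat \<Rightarrow> nat list set" where
  "cores N t = {M. M @ [1] \<in> paths N t}"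

text \<open>
  The outer factors of outermost cuts. By \<open>irreducible_bound\<close> there are only finitely many of
  them.
\<close>

definition outers :: "nat \<Rightarrow> (nat list \<times> nat list) set" where
  "outers t = {(L, R). positive (L @ 1 # R) \<and> sum_list L = sum_list R + 1 \<and> path_comp (L @ 1 # R) \<and>
     \<not> reducible (L @ 1 # R) \<and> excess (L @ R) \<le> t}"

text \<open>
  Outermost among the cuts of both orientations.
\<close>

definition first_cut :: "nat list \<Rightarrow> nat \<Rightarrow> bool" where
  "first_cut a x \<longleftrightarrow> cut a x \<and> (\<forall>x'<x. \<not> cut a x' \<and> \<not> cut (rev a) x')"

lemma positive_length: "positive a \<Longrightarrow> length a \<le> sum_list a"
  by (induction a) auto

lemma finite_positive: "finite {a. positive a \<and> sum_list a \<le> N}"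
proof (rule finite_subset)
  show "{a. positive a \<and> sum_list a \<le> N} \<subseteq> {a. set a \<subseteq> {..N} \<and> length a \<le> N}"
    using positive_length member_le_sum_list by fastforce
qed (rule finite_lists_length_le, simp)

lemma finite_paths: "finite (paths N t)"
  by (rule finite_subset[OF _ finite_positive[of N]]) (auto simp: paths_def)

lemma finite_cores: "finite (cores N t)"
proof -
  have "(\<lambda>M. M @ [1]) ` cores N t \<subseteq> paths N t" by (auto simp: cores_def)
  then show ?thesis using finite_paths finite_subset by (metis finite_imageD inj_on_def append_same_eq)
qed

lemma outers_bound: "(L, R) \<in> outers t \<Longrightarrow> 2 * sum_list L \<le> 8 * t + 4"
  using irreducible_bound[of "L @ 1 # R"] by (auto simp: outers_def)

lemma finite_outers: "finite (outers t)"
proof (rule finite_subset)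
  show "outers t \<subseteq> {a. positive a \<and> sum_list a \<le> 8 * t + 4} \<times> {a. positive a \<and> sum_list a \<le> 8 * t + 4}"
    using outers_bound by (fastforce simp: outers_def)
qed (simp add: finite_positive)

text \<open>
  Whether there is a cut of depth \<open>x\<close> is decided by the \<open>x\<close> positions at either end. Hence the
  cuts outside a given one are those of its outer factor.
\<close>

lemma cut_local:
  assumes pos: "positive (L @ Y @ R)" and x: "x \<le> sum_list L" "x \<le> sum_list R"
  shows "cut (L @ Y @ R) x \<longleftrightarrow> (\<exists>L1 L2. L = L1 @ L2 \<and> sum_list L1 = x) \<and> (\<exists>R1 R2. R = R1 @ 2 # R2 \<and> sum_list R2 + 1 = x)"
proof
  assume "cut (L @ Y @ R) x"
  then obtain L' M' R' where c: "L @ Y @ R = L' @ M' @ 2 # R'" "sum_list L' = x" "sum_list R' + 1 = x"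
    unfolding cut_def by blast
  obtain X where X: "L = L' @ X"
    using prefix_sum[of L' "M' @ 2 # R'" L "Y @ R"] c x pos by metis
  have "rev (2 # R') @ rev (L' @ M') = rev R @ rev (L @ Y)"
    using arg_cong[OF c(1), of rev] by simp
  moreover have "rev R @ rev (L @ Y) = rev (2 # R') @ rev (L' @ M')" using calculation by simp
  ultimately have e: "rev (R') @ ([2] @ rev (L' @ M')) = rev R @ rev (L @ Y)" by simp
  have pr: "positive (rev R' @ [2] @ rev (L' @ M'))" using pos c(1) by (metis e positive_simps(3,4) append.assoc)
  obtain X' where X': "rev R = rev R' @ X'" "[2] @ rev (L' @ M') = X' @ rev (L @ Y)"
    using prefix_sum[OF e pr] c x by (auto simp: sum_list_rev)
  have "X' \<noteq> []" using X' c x by (metis Suc_eq_plus1 append_Nil2 not_less_eq_eq order_refl rev_rev_ident)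
  then obtain X'' where "X' = 2 # X''" using X' by (cases X') auto
  then have "R = rev X'' @ 2 # R'" using X' by (metis append.assoc append_Cons append_Nil rev.simps(2) rev_append rev_rev_ident)
  then show "(\<exists>L1 L2. L = L1 @ L2 \<and> sum_list L1 = x) \<and> (\<exists>R1 R2. R = R1 @ 2 # R2 \<and> sum_list R2 + 1 = x)"
    using X c by blast
next
  assume "(\<exists>L1 L2. L = L1 @ L2 \<and> sum_list L1 = x) \<and> (\<exists>R1 R2. R = R1 @ 2 # R2 \<and> sum_list R2 + 1 = x)"
  then obtain L1 L2 R1 R2 where "L = L1 @ L2" "sum_list L1 = x" "R = R1 @ 2 # R2" "sum_list R2 + 1 = x" by blast
  then show "cut (L @ Y @ R) x" unfolding cut_def
    by (intro exI[of _ L1] exI[of _ "L2 @ Y @ R1"] exI[of _ R2]) simp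
qed

lemma cut_transfer:
  assumes "positive (L @ M @ 2 # R)" "sum_list L = sum_list R + 1" "x < sum_list L"
  shows "cut (L @ M @ 2 # R) x \<longleftrightarrow> cut (L @ 1 # R) x"
    "cut (rev (L @ M @ 2 # R)) x \<longleftrightarrow> cut (rev (L @ 1 # R)) x"
proof -
  have x: "x \<le> sum_list L" "x \<le> sum_list R" using assms by auto
  show "cut (L @ M @ 2 # R) x \<longleftrightarrow> cut (L @ 1 # R) x"
    using cut_local[of L "M @ [2]" R x] cut_local[of L "[1]" R x] assms x by simp
  show "cut (rev (L @ M @ 2 # R)) x \<longleftrightarrow> cut (rev (L @ 1 # R)) x"
    using cut_local[of "rev R" "2 # rev M" "rev L" x] cut_local[of "rev R" "[1]" "rev L" x] assms x
    by (simp add: sum_list_rev)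
qed

lemma first_cut_glue:
  assumes pos: "positive (L @ M @ 2 # R)" and LR: "sum_list L = sum_list R + 1"
  shows "first_cut (L @ M @ 2 # R) (sum_list L) \<longleftrightarrow> \<not> reducible (L @ 1 # R)"
proof -
  have "cut (L @ M @ 2 # R) (sum_list L)" unfolding cut_def using LR by auto
  moreover have "(\<forall>x'<sum_list L. \<not> cut (L @ M @ 2 # R) x' \<and> \<not> cut (rev (L @ M @ 2 # R)) x') \<longleftrightarrow>
      \<not> reducible (L @ 1 # R)"
  proof -
    have "x < sum_list L" if "cut (L @ 1 # R) x \<or> cut (rev (L @ 1 # R)) x" for x
      using that cut_less[of "L @ 1 # R" x] cut_less[of "rev (L @ 1 # R)" x] LR by (auto simp: sum_list_rev)
    then show ?thesis unfolding reducible_def using cut_transfer[OF pos LR] by blast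
  qed
  ultimately show ?thesis unfolding first_cut_def by blast
qed

lemma first_cut_unique: "first_cut a x \<Longrightarrow> first_cut a y \<Longrightarrow> x = y"
  unfolding first_cut_def by (meson linorder_neqE_nat)

text \<open>
  A cut and a cut of the reversal of the same depth would put a boundary between two parts in the
  middle of a part 2.
\<close>

lemma cut_not_both:
  assumes "positive a" "cut a x" "cut (rev a) x"
  shows False
proof -
  obtain L M R where 1: "a = L @ M @ 2 # R" "sum_list L = x" "sum_list R + 1 = x"
    using assms(2) unfolding cut_def by blast
  obtain L' M' R' where 2: "rev a = L' @ M' @ 2 # R'" "sum_list L' = x" "sum_list R' + 1 = x"
    using assms(3) unfolding cut_def by blast
  have e: "rev R @ (2 # rev M @ rev L) = L' @ (M' @ 2 # R')" using 1(1) 2(1) by simp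
  obtain X where X: "L' = rev R @ X" "2 # rev M @ rev L = X @ (M' @ 2 # R')"
    using prefix_sum[OF e] assms(1) 1 2 by (auto simp: sum_list_rev)
  have "sum_list X = 1" using X(1) 1 2 by (simp add: sum_list_rev)
  then show False using X(2) by (cases X) auto
qed

text \<open>
  Cutting at the outermost cut is a bijection onto pairs of an outer and an inner factor. A
  property \<open>Q\<close> of the whole that depends on the outer factor alone is carried along, in order to
  count also the paths that end in 1.
\<close>

lemma card_first_cut:
  assumes N: "8 * t + 4 < N"
    and Q: "\<And>L M R. (L, R) \<in> outers t \<Longrightarrow> Q (L @ M @ 2 # R) \<longleftrightarrow> q L R"
  shows "card {a \<in> paths N t. Q a \<and> (\<exists>x. first_cut a x)} =
    (\<Sum>(L, R)\<in>{(L, R) \<in> outers t. q L R}. card (cores (N - 2 * sum_list L) (t - excess (L @ R))))"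
proof -
  let ?O = "{(L, R) \<in> outers t. q L R}"
  let ?C = "\<lambda>(L, R). cores (N - 2 * sum_list L) (t - excess (L @ R))"
  let ?g = "\<lambda>((L, R), M). L @ M @ 2 # R"
  have fc: "positive (L @ M @ 2 # R)" "first_cut (L @ M @ 2 # R) (sum_list L)" "L @ M @ 2 # R \<in> paths N t"
    if o: "(L, R) \<in> outers t" and M: "M \<in> cores (N - 2 * sum_list L) (t - excess (L @ R))" for L R M
  proof -
    show pos: "positive (L @ M @ 2 # R)" using o M by (auto simp: outers_def cores_def paths_def)
    have LR: "sum_list L = sum_list R + 1" using o by (simp add: outers_def)
    show "first_cut (L @ M @ 2 # R) (sum_list L)"
      using first_cut_glue[OF pos LR] o by (simp add: outers_def)
    have "sum_list (L @ M @ 2 # R) = N"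
      using M LR outers_bound[OF o] N by (auto simp: cores_def paths_def)
    moreover have "path_comp (L @ M @ 2 # R)"
      using path_comp_cut[OF LR] o M by (simp add: outers_def cores_def paths_def)
    moreover have "excess (L @ M @ 2 # R) = t"
      using o M by (auto simp: outers_def cores_def paths_def)
    ultimately show "L @ M @ 2 # R \<in> paths N t" using pos by (simp add: paths_def)
  qed
  have "bij_betw ?g (Sigma ?O ?C) {a \<in> paths N t. Q a \<and> (\<exists>x. first_cut a x)}"
    unfolding bij_betw_def
  proof
    show "inj_on ?g (Sigma ?O ?C)"
    proof (rule inj_onI, clarsimp)
      fix L R M L' R' M'
      assume o: "(L, R) \<in> outers t" "(L', R') \<in> outers t"
        and M: "M \<in> cores (N - 2 * sum_list L) (t - (excess L + excess R))" "M' \<in> cores (N - 2 * sum_list L') (t - (excess L' + excess R'))"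
        and e: "L @ M @ 2 # R = L' @ M' @ 2 # R'"
      have f: "first_cut (L @ M @ 2 # R) (sum_list L)" "first_cut (L' @ M' @ 2 # R') (sum_list L')"
        using fc(2)[OF o(1), of M] fc(2)[OF o(2), of M'] M by simp_all
      then have s: "sum_list L = sum_list L'" using first_cut_unique e by metis
      have pos: "positive (L @ M @ 2 # R)" using fc(1)[OF o(1), of M] M by simp
      have L: "L = L'" "M @ 2 # R = M' @ 2 # R'" using prefix_unique[OF e pos s] by auto
      have e': "rev R @ (2 # rev M) = rev R' @ (2 # rev M')" using arg_cong[OF L(2), of rev] by simp
      have "sum_list (rev R) = sum_list (rev R')" using s o by (simp add: sum_list_rev outers_def)
      moreover have "positive (rev R @ (2 # rev M))" using pos by simp
      ultimately have "rev R = rev R'" "2 # rev M = 2 # rev M'" using prefix_unique[OF e'] by auto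
      then show "L = L' \<and> R = R' \<and> M = M'" using L by simp
    qed
    show "?g ` Sigma ?O ?C = {a \<in> paths N t. Q a \<and> (\<exists>x. first_cut a x)}"
    proof
      show "?g ` Sigma ?O ?C \<subseteq> {a \<in> paths N t. Q a \<and> (\<exists>x. first_cut a x)}"
        using fc(2,3) Q by fastforce
      show "{a \<in> paths N t. Q a \<and> (\<exists>x. first_cut a x)} \<subseteq> ?g ` Sigma ?O ?C"
      proof
        fix a assume "a \<in> {a \<in> paths N t. Q a \<and> (\<exists>x. first_cut a x)}"
        then obtain x where a: "a \<in> paths N t" "Q a" "first_cut a x" by blast
        then obtain L M R where LMR: "a = L @ M @ 2 # R" "sum_list L = x" "sum_list R + 1 = x"
          unfolding first_cut_def cut_def by blast
        have LR: "sum_list L = sum_list R + 1" using LMR by simp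
        have pos: "positive (L @ M @ 2 # R)" using a LMR by (simp add: paths_def)
        have "\<not> reducible (L @ 1 # R)" using first_cut_glue[OF pos LR] a LMR by simp
        then have o: "(L, R) \<in> outers t"
          using a LMR pos path_comp_cut[OF LR, of M] by (auto simp: outers_def paths_def)
        moreover have "M \<in> cores (N - 2 * sum_list L) (t - excess (L @ R))"
          using a LMR pos path_comp_cut[OF LR, of M] by (auto simp: cores_def paths_def)
        moreover have "q L R" using Q[OF o, of M] a LMR by simp
        ultimately have "((L, R), M) \<in> Sigma ?O ?C" by simp
        then show "a \<in> ?g ` Sigma ?O ?C" using LMR(1) by force
      qed
    qed
  qed
  then have "card {a \<in> paths N t. Q a \<and> (\<exists>x. first_cut a x)} = card (Sigma ?O ?C)"
    by (simp add: bij_betw_same_card)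
  also have "\<dots> = (\<Sum>p\<in>?O. card (?C p))"
  proof (rule card_SigmaI)
    show "finite ?O" by (rule finite_subset[OF _ finite_outers[of t]]) auto
    show "\<forall>p\<in>?O. finite (?C p)" using finite_cores by auto
  qed
  finally show ?thesis by (simp add: split_beta)
qed

lemma paths_rev: "rev a \<in> paths N t \<longleftrightarrow> a \<in> paths N t"
  by (simp add: paths_def path_comp_rev sum_list_rev)

text \<open>
  A path of size above \<open>8 * t + 4\<close> is reducible, and its outermost cut belongs to exactly one of
  the two orientations; reversal exchanges them.
\<close>

lemma card_paths_decompose:
  assumes N: "8 * t + 4 < N"
    and Q1: "\<And>L M R. (L, R) \<in> outers t \<Longrightarrow> Q (L @ M @ 2 # R) \<longleftrightarrow> q1 L R"
    and Q2: "\<And>L M R. (L, R) \<in> outers t \<Longrightarrow> Q (rev (L @ M @ 2 # R)) \<longleftrightarrow> q2 L R"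
  shows "card {a \<in> paths N t. Q a} =
    (\<Sum>(L, R)\<in>{(L, R) \<in> outers t. q1 L R}. card (cores (N - 2 * sum_list L) (t - excess (L @ R)))) +
    (\<Sum>(L, R)\<in>{(L, R) \<in> outers t. q2 L R}. card (cores (N - 2 * sum_list L) (t - excess (L @ R))))"
proof -
  let ?A = "{a \<in> paths N t. Q a \<and> (\<exists>x. first_cut a x)}"
  let ?B = "{a \<in> paths N t. Q (rev a) \<and> (\<exists>x. first_cut a x)}"
  have ex: "(\<exists>x. first_cut a x) \<or> (\<exists>x. first_cut (rev a) x)" if a: "a \<in> paths N t" for a
  proof -
    have "reducible a" using irreducible_bound[of a] a N by (auto simp: paths_def)
    then obtain x where "cut a x \<or> cut (rev a) x" unfolding reducible_def by blast
    then obtain y where y: "cut a y \<or> cut (rev a) y" "\<forall>z<y. \<not> (cut a z \<or> cut (rev a) z)"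
      using exists_least_iff[of "\<lambda>x. cut a x \<or> cut (rev a) x"] by blast
    then show ?thesis unfolding first_cut_def by auto
  qed
  have dis: "\<not> ((\<exists>x. first_cut a x) \<and> (\<exists>x. first_cut (rev a) x))" if a: "a \<in> paths N t" for a
  proof
    assume "(\<exists>x. first_cut a x) \<and> (\<exists>x. first_cut (rev a) x)"
    then obtain x y where xy: "first_cut a x" "first_cut (rev a) y" by blast
    then have "\<not> x < y" "\<not> y < x" unfolding first_cut_def by auto
    then have "x = y" by simp
    then show False using cut_not_both[of a x] xy a unfolding first_cut_def paths_def by simp
  qed
  have "{a \<in> paths N t. Q a} = ?A \<union> rev ` ?B"
  proof
    show "{a \<in> paths N t. Q a} \<subseteq> ?A \<union> rev ` ?B"
    proof
      fix a assume a: "a \<in> {a \<in> paths N t. Q a}"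
      then consider "\<exists>x. first_cut a x" | "\<exists>x. first_cut (rev a) x" using ex by blast
      then show "a \<in> ?A \<union> rev ` ?B"
      proof cases
        case 1
        then show ?thesis using a by blast
      next
        case 2
        then have "rev a \<in> ?B" using a paths_rev by simp
        then have "rev (rev a) \<in> rev ` ?B" by (rule imageI)
        then show ?thesis by (simp only: rev_rev_ident Un_iff simp_thms)
      qed
    qed
    show "?A \<union> rev ` ?B \<subseteq> {a \<in> paths N t. Q a}" using paths_rev by blast
  qed
  moreover have "?A \<inter> rev ` ?B = {}"
  proof -
    have False if a1: "a \<in> ?A" and a2: "a \<in> rev ` ?B" for a
    proof -
      obtain b where "b \<in> ?B" "a = rev b" using a2 by blast
      then have "\<exists>x. first_cut (rev a) x" by simp
      then show False using dis[of a] a1 by blast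
    qed
    then show ?thesis by blast
  qed
  moreover have "finite ?A" "finite ?B" using finite_paths by auto
  ultimately have "card {a \<in> paths N t. Q a} = card ?A + card (rev ` ?B)"
    by (simp add: card_Un_disjoint)
  also have "card (rev ` ?B) = card ?B" by (rule card_image) (simp add: inj_on_def)
  also have "card ?A = (\<Sum>(L, R)\<in>{(L, R) \<in> outers t. q1 L R}. card (cores (N - 2 * sum_list L) (t - excess (L @ R))))"
    by (rule card_first_cut[OF N]) (rule Q1)
  also have "card ?B = (\<Sum>(L, R)\<in>{(L, R) \<in> outers t. q2 L R}. card (cores (N - 2 * sum_list L) (t - excess (L @ R))))"
    by (rule card_first_cut[OF N]) (rule Q2)
  finally show ?thesis .
qed

text \<open>
  A first part 2 opposite a final 1 would be a cut, so the first part is at least 4 and has excess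
  one already. A total excess of one leaves only the ends 4 and 2, 1, which contain a cycle.
\<close>

lemma no_path_even_ends:
  assumes p: "path_comp (h # m @ [k, 1])" and pos: "positive (h # m @ [k, 1])"
    and irr: "\<not> reducible (h # m @ [k, 1])" and ev: "even h" "even k"
  shows "2 \<le> excess (h # m @ [k, 1])"
proof (rule ccontr)
  assume ex: "\<not> 2 \<le> excess (h # m @ [k, 1])"
  have "h \<noteq> 2"
  proof
    assume "h = 2"
    then have "rev (h # m @ [k, 1]) = [1] @ (k # rev m) @ 2 # []" by simp
    then have "cut (rev (h # m @ [k, 1])) 1" unfolding cut_def
      by (intro exI[of _ "[1]"] exI[of _ "k # rev m"] exI[of _ "[]"]) simp
    then show False using irr unfolding reducible_def by blast
  qed
  moreover have "0 < h" "0 < k" using pos by auto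
  ultimately have "h \<ge> 4" using ev(1) by presburger
  moreover have "(h - 1) div 2 + (k - 1) div 2 < 2" using ex by simp
  ultimately have "h = 4" "k = 2" using ev \<open>0 < k\<close> by presburger+
  then show False using not_path_4_21[of m] p by simp
qed

text \<open>
  The part 1 in the middle and the last part 1 are the two odd parts of \<open>L @ 1 # R\<close>, so all others
  are even and \<open>no_path_even_ends\<close> applies. The case \<open>R = [1]\<close> forces \<open>L = [2]\<close>, which is
  reducible.
\<close>

lemma outers_last:
  assumes o: "(L, R) \<in> outers t" and R: "R \<noteq> []" "last R = 1"
  shows "2 \<le> excess (L @ R)"
proof -
  let ?a = "L @ 1 # R"
  have a: "positive ?a" "sum_list L = sum_list R + 1" "path_comp ?a" "\<not> reducible ?a"
    using o by (auto simp: outers_def)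
  define R0 where "R0 = butlast R"
  have R0: "R = R0 @ [1]" using R append_butlast_last_id[of R] by (simp add: R0_def)
  have "odd_parts ?a = 2" using path_comp_odd_parts[OF a(3)] a(2) by simp
  then have ev: "odd_parts L = 0" "odd_parts R0 = 0" using R0 by auto
  obtain h L0 where L: "L = h # L0" using a(2) by (cases L) auto
  have h: "even h" using ev L by (auto split: if_splits)
  show ?thesis
  proof (cases R0 rule: rev_cases)
    case Nil
    then have "h + sum_list L0 = 2" using a(2) L R0 by simp
    moreover have "0 < h" using a(1) L by simp
    ultimately have "h = 2" using h by presburger
    then have "rev ?a = [1] @ (1 # rev L0) @ 2 # []" using L R0 Nil by simp
    then have "cut (rev ?a) 1" unfolding cut_def
      by (intro exI[of _ "[1]"] exI[of _ "1 # rev L0"] exI[of _ "[]"]) simp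
    then show ?thesis using a(4) unfolding reducible_def by blast
  next
    case (snoc R1 k)
    then have k: "even k" using ev by (auto split: if_splits)
    have e: "?a = h # (L0 @ 1 # R1) @ [k, 1]" using L R0 snoc by simp
    have "2 \<le> excess ?a" unfolding e
      by (rule no_path_even_ends[OF a(3)[unfolded e] a(1)[unfolded e] a(4)[unfolded e] h k])
    then show ?thesis by simp
  qed
qed

text \<open>
  The mirror image of \<open>outers_last\<close>; here the path \<open>[1, 1]\<close> is the one exception.
\<close>

lemma outers_hd:
  assumes o: "(L, R) \<in> outers t" and hd: "hd L = 1"
  shows "(L, R) = ([1], []) \<or> 2 \<le> excess (L @ R)"
proof -
  let ?a = "L @ 1 # R"
  have a: "positive ?a" "sum_list L = sum_list R + 1" "path_comp ?a" "\<not> reducible ?a"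
    using o by (auto simp: outers_def)
  obtain L0 where L: "L = 1 # L0" using a(2) hd by (cases L) auto
  have "odd_parts ?a = 2" using path_comp_odd_parts[OF a(3)] a(2) by simp
  then have ev: "odd_parts L0 = 0" "odd_parts R = 0" using L by auto
  have s: "sum_list L0 = sum_list R" using a(2) L by simp
  show ?thesis
  proof (cases R rule: rev_cases)
    case Nil
    then have "L0 = []" using s a(1) L positive_sum_0[of L0] by simp
    then show ?thesis using Nil L by simp
  next
    case (snoc R1 h)
    have h: "even h" "0 < h" using ev snoc a(1) by (auto split: if_splits)
    then obtain k L1 where L0: "L0 = k # L1" using s snoc by (cases L0) auto
    have k: "even k" using ev L0 by (auto split: if_splits)
    have e: "rev ?a = h # (rev R1 @ 1 # rev L1) @ [k, 1]" using L L0 snoc by simp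
    have "positive (rev ?a)" "path_comp (rev ?a)" "\<not> reducible (rev ?a)"
      using a reducible_rev path_comp_rev positive_simps(4) by blast+
    then have "2 \<le> excess (rev ?a)" unfolding e by (intro no_path_even_ends h k)
    then show ?thesis by simp
  qed
qed

lemma outers_1: "([1], []) \<in> outers t"
  using not_reducible_no_2[of "[1, 1]"] path_comp_11 by (simp add: outers_def)

lemma outers_14: "2 \<le> t \<Longrightarrow> ([1, 4], [4]) \<in> outers t"
  using not_reducible_no_2[of "[1, 4, 1, 4]"] path_comp_1414 by (simp add: outers_def)

definition core_count :: "nat \<Rightarrow> nat \<Rightarrow> nat" where
  "core_count N t = card (cores N t)"

lemma core_count_eq: "0 < N \<Longrightarrow> core_count N t = card {a \<in> paths N t. last a = 1}"
proof -
  assume N: "0 < N"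
  have "bij_betw (\<lambda>M. M @ [1]) (cores N t) {a \<in> paths N t. last a = 1}"
    unfolding bij_betw_def
  proof
    show "inj_on (\<lambda>M. M @ [1]) (cores N t)" by (simp add: inj_on_def)
    show "(\<lambda>M. M @ [1]) ` cores N t = {a \<in> paths N t. last a = 1}"
    proof
      show "(\<lambda>M. M @ [1]) ` cores N t \<subseteq> {a \<in> paths N t. last a = 1}" by (auto simp: cores_def)
      show "{a \<in> paths N t. last a = 1} \<subseteq> (\<lambda>M. M @ [1]) ` cores N t"
      proof
        fix a assume a: "a \<in> {a \<in> paths N t. last a = 1}"
        then have "a \<noteq> []" using N by (auto simp: paths_def)
        then have "a = butlast a @ [1]" using a append_butlast_last_id[of a] by simp
        then show "a \<in> (\<lambda>M. M @ [1]) ` cores N t" using a unfolding cores_def by (metis (mono_tags, lifting) image_eqI mem_Collect_eq)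
      qed
    qed
  qed
  then show ?thesis unfolding core_count_def by (rule bij_betw_same_card)
qed

definition outer_sum :: "(nat list \<times> nat list) set \<Rightarrow> nat \<Rightarrow> nat \<Rightarrow> nat" where
  "outer_sum O' N t = (\<Sum>(L, R)\<in>O'. core_count (N - 2 * sum_list L) (t - excess (L @ R)))"

lemma card_paths_rec:
  assumes "8 * t + 4 < N"
  shows "card (paths N t) = 2 * outer_sum (outers t) N t"
  using card_paths_decompose[OF assms, of "\<lambda>_. True" "\<lambda>_ _. True" "\<lambda>_ _. True"]
  by (simp add: outer_sum_def core_count_def)

text \<open>
  For a path ending in 1, or the reversal of one, the outermost cut shows that 1 at an end of the
  outer factor. The outer factor \<open>[1, 1]\<close> cuts off only the two outermost parts 1 and 2 and
  preserves the excess.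
\<close>

lemma core_count_rec:
  assumes "8 * t + 4 < N"
  shows "core_count N t = core_count (N - 2) t +
    outer_sum {(L, R) \<in> outers t. R \<noteq> [] \<and> last R = 1} N t +
    outer_sum ({(L, R) \<in> outers t. hd L = 1} - {([1], [])}) N t"
proof -
  have "core_count N t = outer_sum {(L, R) \<in> outers t. R \<noteq> [] \<and> last R = 1} N t +
      outer_sum {(L, R) \<in> outers t. hd L = 1} N t"
    unfolding outer_sum_def core_count_def[symmetric] core_count_eq[of N t, OF order.strict_trans1[OF _ assms, of 0, simplified]]
    unfolding core_count_def
  proof (rule card_paths_decompose[OF assms])
    fix L M R assume "(L, R) \<in> outers t"
    show "last (L @ M @ 2 # R) = 1 \<longleftrightarrow> R \<noteq> [] \<and> last R = 1" by auto
    have "L \<noteq> []" using \<open>(L, R) \<in> outers t\<close> by (auto simp: outers_def)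
    then show "last (rev (L @ M @ 2 # R)) = 1 \<longleftrightarrow> hd L = 1"
      by (metis hd_append2 last_rev append_is_Nil_conv)
  qed
  moreover have "outer_sum {(L, R) \<in> outers t. hd L = 1} N t =
      core_count (N - 2) t + outer_sum ({(L, R) \<in> outers t. hd L = 1} - {([1], [])}) N t"
  proof -
    have "finite {(L, R) \<in> outers t. hd L = 1}" by (rule finite_subset[OF _ finite_outers[of t]]) auto
    moreover have "([1], []) \<in> {(L, R) \<in> outers t. hd L = 1}" using outers_1 by simp
    ultimately show ?thesis unfolding outer_sum_def by (subst sum.remove) auto
  qed
  ultimately show ?thesis by simp
qed

text \<open>
  If \<open>M @ [1]\<close> is a path, so is \<open>1 # M @ [2]\<close>, by the cut with outer factor \<open>[1, 1]\<close>, and hence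
  the reversal of the latter, which ends in 1.
\<close>

lemma core_count_pos_step: "0 < core_count N t \<Longrightarrow> 0 < core_count (N + 2) t"
proof -
  assume "0 < core_count N t"
  then obtain M where M: "M \<in> cores N t" unfolding core_count_def by (metis card_gt_0_iff equals0I)
  have "path_comp ([1] @ M @ 2 # [])" using path_comp_cut[of "[1]" "[]" M] M path_comp_11 by (simp add: cores_def paths_def)
  then have "path_comp (rev ([1] @ M @ 2 # []))" by (simp only: path_comp_rev)
  then have "2 # rev M \<in> cores (N + 2) t" using M by (auto simp: cores_def paths_def sum_list_rev)
  then show "0 < core_count (N + 2) t" unfolding core_count_def using finite_cores by (metis card_gt_0_iff empty_iff)
qed

text \<open>
  Repeated extension of the paths \<open>[1, 1]\<close>, \<open>[1]\<close>, \<open>[3, 1]\<close> and \<open>[4, 1]\<close>, which cover excess 0 and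
  1 in both parities of the size.
\<close>

lemma core_count_pos:
  assumes "\<epsilon> \<in> {0, 1}" "t \<le> 1" "2 \<le> n"
  shows "0 < core_count (2 * n + \<epsilon>) t"
proof -
  have pos: "0 < core_count N t" if "M \<in> cores N t" for M N t
    unfolding core_count_def using that finite_cores by (metis card_gt_0_iff empty_iff)
  have "0 < core_count (4 + \<epsilon>) t"
  proof -
    have "t = 0 \<or> t = 1" using assms(2) by auto
    moreover have "0 < core_count 2 0" by (rule pos[of "[1]"]) (use path_comp_11 in \<open>simp add: cores_def paths_def\<close>)
    then have "0 < core_count (2 + 2) 0" by (rule core_count_pos_step)
    moreover have "0 < core_count 1 0" by (rule pos[of "[]"]) (use path_comp_1 in \<open>simp add: cores_def paths_def\<close>)
    then have "0 < core_count (1 + 2 + 2) 0" by (intro core_count_pos_step)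
    then have "0 < core_count 5 0" by (simp add: numeral_eq_Suc)
    moreover have "0 < core_count 4 1" by (rule pos[of "[3]"]) (use path_comp_31 in \<open>simp add: cores_def paths_def\<close>)
    moreover have "0 < core_count 5 1" by (rule pos[of "[4]"]) (use path_comp_41 in \<open>simp add: cores_def paths_def\<close>)
    ultimately show ?thesis using assms(1) by auto
  qed
  note start = this
  show ?thesis
    using assms(3)
  proof (induction n rule: dec_induct)
    case base
    show ?case using start by simp
  next
    case (step n)
    then show ?case using core_count_pos_step[of "2 * n + \<epsilon>" t] by (simp add: add.commute add.left_commute)
  qed
qed

section \<open>Eventually polynomial sequences\<close>

text \<open>
  Asking for the exact degree and a positive leading coefficient makes the notion stable under
  sums, because leading terms cannot cancel.
\<close>

definition eventually_poly :: "(nat \<Rightarrow> nat) \<Rightarrow> nat \<Rightarrow> bool" where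
  "eventually_poly f d \<longleftrightarrow> (\<exists>P :: rat poly. degree P = d \<and> 0 < lead_coeff P \<and>
     (\<forall>\<^sub>F n in sequentially. of_nat (f n) = poly P (of_nat n)))"

lemma eventually_poly_cong:
  assumes "\<forall>\<^sub>F n in sequentially. f n = g n" "eventually_poly g d"
  shows "eventually_poly f d"
proof -
  obtain P :: "rat poly" where P: "degree P = d" "0 < lead_coeff P"
    "\<forall>\<^sub>F n in sequentially. of_nat (g n) = poly P (of_nat n)"
    using assms(2) unfolding eventually_poly_def by blast
  have "\<forall>\<^sub>F n in sequentially. of_nat (f n) = poly P (of_nat n)"
    using assms(1) P(3) by eventually_elim simp
  then show ?thesis unfolding eventually_poly_def using P by blast
qed

lemma lead_coeff_add_pos:
  fixes P Q :: "rat poly"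
  assumes "0 < lead_coeff P" "0 < lead_coeff Q" "degree Q \<le> degree P"
  shows "degree (P + Q) = degree P" "0 < lead_coeff (P + Q)"
proof -
  have "0 \<le> coeff Q (degree P)"
    using assms by (cases "degree Q = degree P") (auto simp: coeff_eq_0)
  then have c: "0 < coeff (P + Q) (degree P)" using assms by simp
  have "degree (P + Q) \<le> degree P" using assms by (simp add: degree_add_le)
  moreover have "degree P \<le> degree (P + Q)" by (rule le_degree) (use c in simp)
  ultimately show "degree (P + Q) = degree P" by simp
  then show "0 < lead_coeff (P + Q)" using c by simp
qed

lemma eventually_poly_add:
  assumes "eventually_poly f d" "eventually_poly g e"
  shows "eventually_poly (\<lambda>n. f n + g n) (max d e)"
proof -
  obtain P :: "rat poly" where P: "degree P = d" "0 < lead_coeff P"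
    "\<forall>\<^sub>F n in sequentially. of_nat (f n) = poly P (of_nat n)"
    using assms(1) unfolding eventually_poly_def by blast
  obtain Q :: "rat poly" where Q: "degree Q = e" "0 < lead_coeff Q"
    "\<forall>\<^sub>F n in sequentially. of_nat (g n) = poly Q (of_nat n)"
    using assms(2) unfolding eventually_poly_def by blast
  have "degree (P + Q) = max d e" "0 < lead_coeff (P + Q)"
  proof -
    have "degree (P + Q) = max d e \<and> 0 < lead_coeff (P + Q)"
    proof (cases "e \<le> d")
      case True
      then show ?thesis using lead_coeff_add_pos[of P Q] P Q by (simp add: max_def)
    next
      case False
      then show ?thesis using lead_coeff_add_pos[of Q P] P Q by (simp add: max_def add.commute)
    qed
    then show "degree (P + Q) = max d e" "0 < lead_coeff (P + Q)" by auto
  qed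
  moreover have "\<forall>\<^sub>F n in sequentially. of_nat (f n + g n) = poly (P + Q) (of_nat n)"
    using P(3) Q(3) by eventually_elim simp
  ultimately show ?thesis unfolding eventually_poly_def by blast
qed

text \<open>
  One summand of the top degree suffices.
\<close>

lemma eventually_poly_sum:
  assumes "finite A" "a \<in> A" "eventually_poly (f a) D"
    and "\<And>x. x \<in> A \<Longrightarrow> \<exists>d\<le>D. eventually_poly (f x) d"
  shows "eventually_poly (\<lambda>n. \<Sum>x\<in>A. f x n) D"
proof -
  have "eventually_poly (\<lambda>n. f a n + (\<Sum>x\<in>B. f x n)) D" if "finite B" "B \<subseteq> A" for B
    using that
  proof (induction B rule: finite_induct)
    case empty
    then show ?case using assms(3) by simp
  next
    case (insert x B)
    obtain d where d: "d \<le> D" "eventually_poly (f x) d" using assms(4) insert.prems by blast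
    have "eventually_poly (\<lambda>n. (f a n + (\<Sum>x\<in>B. f x n)) + f x n) (max D d)"
      by (rule eventually_poly_add) (use insert d in auto)
    moreover have "max D d = D" using d by simp
    ultimately show ?case using insert.hyps by (simp add: add_ac)
  qed
  from this[of "A - {a}"] show ?thesis using assms(1,2) by (simp add: sum.remove)
qed

lemma eventually_poly_shift:
  assumes "eventually_poly f d"
  shows "eventually_poly (\<lambda>n. f (n - k)) d"
proof -
  obtain P :: "rat poly" where P: "degree P = d" "0 < lead_coeff P"
    "\<forall>\<^sub>F n in sequentially. of_nat (f n) = poly P (of_nat n)"
    using assms unfolding eventually_poly_def by blast
  let ?Q = "pcompose P [:- of_nat k, 1:]"
  have "degree ?Q = d" using P(1) by (simp add: degree_pcompose)
  moreover have "lead_coeff ?Q = lead_coeff P"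
    using lead_coeff_comp[of "[:- of_nat k, 1:]" P] by simp
  moreover have "\<forall>\<^sub>F n in sequentially. of_nat (f (n - k)) = poly ?Q (of_nat n)"
  proof -
    obtain N where N: "\<And>n. n \<ge> N \<Longrightarrow> of_nat (f n) = poly P (of_nat n)"
      using P(3) unfolding eventually_sequentially by blast
    show ?thesis unfolding eventually_sequentially
    proof (intro exI[of _ "N + k"] allI impI)
      fix n assume "N + k \<le> n"
      then show "of_nat (f (n - k)) = poly ?Q (of_nat n)"
        using N[of "n - k"] by (simp add: poly_pcompose of_nat_diff)
    qed
  qed
  ultimately show ?thesis unfolding eventually_poly_def using P(2) by metis
qed

text \<open>
  The backward difference of \<open>c T\<^sup>d\<^sup>+\<^sup>1\<close> has leading term \<open>c (d + 1) T\<^sup>d\<close>,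
  so a suitable \<open>c\<close> removes the leading term of \<open>P\<close>, and induction on the degree removes the rest.
\<close>

lemma poly_antidifference:
  fixes P :: "rat poly"
  assumes "P \<noteq> 0"
  shows "\<exists>Q. degree Q = Suc (degree P) \<and> lead_coeff Q = lead_coeff P / of_nat (Suc (degree P)) \<and>
    Q - pcompose Q [:-1, 1:] = P"
  using assms
proof (induction "degree P" arbitrary: P rule: less_induct)
  case less
  define d c where "d = degree P" and "c = lead_coeff P / of_nat (Suc d)"
  have c0: "c \<noteq> 0" using less.prems by (simp add: c_def)
  define Q0 where "Q0 = monom c (Suc d)"
  define R where "R = P - (Q0 - pcompose Q0 [:-1, 1:])"
  have pc: "pcompose Q0 [:-1, 1:] = Polynomial.smult c ([:-1, 1:] ^ Suc d)"
    unfolding poly_eq_poly_eq_iff[symmetric]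
    by (simp add: fun_eq_iff poly_pcompose Q0_def poly_monom poly_power algebra_simps)
  have coeffR: "coeff R i = 0" if id: "i \<ge> d" for i
  proof -
    have b: "coeff ([:-1, 1:] ^ Suc d) i = of_nat (Suc d choose i) * (- 1 :: rat) ^ (Suc d - i)"
      if "i \<le> Suc d"
      using coeff_linear_poly_power[of i "Suc d" "-1 :: rat" 1] that by simp
    have cR: "coeff R i = coeff P i - coeff Q0 i + c * coeff ([:-1, 1:] ^ Suc d) i"
      by (simp add: R_def pc del: power_Suc)
    have cQ0: "coeff Q0 i = (if i = Suc d then c else 0)" by (simp add: Q0_def)
    consider "i = d" | "i = Suc d" | "i > Suc d" using id by linarith
    then show ?thesis
    proof cases
      case 1
      have e: "coeff ([:-1, 1:] ^ Suc d) i = - (of_nat (Suc d) :: rat)" using b 1 by simp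
      have "coeff R i = coeff P d - c * of_nat (Suc d)" unfolding cR cQ0 e using 1 by (simp add: algebra_simps)
      also have "\<dots> = 0" by (simp add: c_def d_def del: of_nat_Suc)
      finally show ?thesis .
    next
      case 2
      have e: "coeff ([:-1, 1:] ^ Suc d) i = (1 :: rat)" using b 2 by simp
      have "coeff P i = 0" using 2 by (simp add: d_def coeff_eq_0)
      then show ?thesis unfolding cR cQ0 e using 2 by simp
    next
      case 3
      have "degree ([:-1, 1 :: rat:] ^ Suc d) = Suc d" by (rule degree_linear_power)
      then have e: "coeff ([:-1, 1 :: rat:] ^ Suc d) i = 0" using 3 by (intro coeff_eq_0) simp
      have "coeff P i = 0" using 3 by (simp add: d_def coeff_eq_0)
      then show ?thesis unfolding cR cQ0 e using 3 by simp
    qed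
  qed
  have degQ0: "degree Q0 = Suc d" "lead_coeff Q0 = c" using c0 by (simp_all add: Q0_def degree_monom_eq)
  show ?case
  proof (cases "R = 0")
    case True
    then have "Q0 - pcompose Q0 [:-1, 1:] = P" by (simp add: R_def)
    then show ?thesis using degQ0 unfolding d_def c_def by blast
  next
    case False
    then have "degree R < d" using coeffR by (metis leading_coeff_0_iff not_le_imp_less)
    then obtain Q1 where Q1: "degree Q1 = Suc (degree R)" "Q1 - pcompose Q1 [:-1, 1:] = R"
      using less.hyps[of R] False unfolding d_def by blast
    have "degree Q1 < degree Q0" using Q1 degQ0 \<open>degree R < d\<close> by simp
    then have "degree (Q0 + Q1) = Suc d" "lead_coeff (Q0 + Q1) = c"
      using degQ0 by (simp_all add: degree_add_eq_left coeff_eq_0)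
    moreover have "(Q0 + Q1) - pcompose (Q0 + Q1) [:-1, 1:] = P"
    proof -
      have "(Q0 + Q1) - pcompose (Q0 + Q1) [:-1, 1:] = (Q0 - pcompose Q0 [:-1, 1:]) + (Q1 - pcompose Q1 [:-1, 1:])"
        by (simp add: pcompose_add)
      then show ?thesis by (simp add: Q1(2) R_def)
    qed
    ultimately show ?thesis unfolding d_def c_def by blast
  qed
qed

lemma eventually_poly_antidifference:
  assumes rec: "\<forall>\<^sub>F n in sequentially. f n = f (n - 1) + h n" and h: "eventually_poly h d"
  shows "eventually_poly f (Suc d)"
proof -
  obtain P :: "rat poly" where P: "degree P = d" "0 < lead_coeff P"
    "\<forall>\<^sub>F n in sequentially. of_nat (h n) = poly P (of_nat n)"
    using h unfolding eventually_poly_def by blast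
  have "P \<noteq> 0" using P(2) by auto
  then obtain Q where Q: "degree Q = Suc d" "lead_coeff Q = lead_coeff P / of_nat (Suc d)"
    "Q - pcompose Q [:-1, 1:] = P"
    using poly_antidifference P(1) by blast
  have "\<forall>\<^sub>F n in sequentially. f n = f (n - 1) + h n \<and> of_nat (h n) = poly P (of_nat n)"
    using rec P(3) by eventually_elim simp
  then obtain N where N: "\<And>n. n \<ge> N \<Longrightarrow> f n = f (n - 1) + h n" "\<And>n. n \<ge> N \<Longrightarrow> of_nat (h n) = poly P (of_nat n)"
    unfolding eventually_sequentially by blast
  define k where "k = (of_nat (f N) - poly Q (of_nat N) :: rat)"
  have "of_nat (f n) = poly Q (of_nat n) + k" if "n \<ge> N" for n
    using that
  proof (induction n rule: dec_induct)
    case base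
    show ?case by (simp add: k_def)
  next
    case (step n)
    have "poly P (of_nat (Suc n)) = poly Q (of_nat (Suc n)) - poly Q (of_nat n)"
      unfolding Q(3)[symmetric] by (simp add: poly_pcompose)
    then show ?case using N[of "Suc n"] step by simp
  qed
  then have ev: "\<forall>\<^sub>F n in sequentially. of_nat (f n) = poly (Q + [:k:]) (of_nat n)"
    unfolding eventually_sequentially by (intro exI[of _ N]) simp
  have "degree [:k:] < degree Q" using Q(1) by simp
  then have "degree (Q + [:k:]) = Suc d" "lead_coeff (Q + [:k:]) = lead_coeff Q"
    using Q(1) by (simp_all add: degree_add_eq_left coeff_eq_0)
  moreover have "0 < lead_coeff Q" using Q(2) P(2) by simp
  ultimately show ?thesis unfolding eventually_poly_def using ev by metis
qed

text \<open>
  The base of the growth argument, where positivity has to come from outside.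
\<close>

lemma eventually_poly_const:
  assumes rec: "\<forall>\<^sub>F n in sequentially. f n = f (n - 1)" and pos: "\<forall>\<^sub>F n in sequentially. 0 < f n"
  shows "eventually_poly f 0"
proof -
  have "\<forall>\<^sub>F n in sequentially. f n = f (n - 1) \<and> 0 < f n" using rec pos by eventually_elim simp
  then obtain N where N: "\<And>n. n \<ge> N \<Longrightarrow> f n = f (n - 1)" "\<And>n. n \<ge> N \<Longrightarrow> 0 < f n"
    unfolding eventually_sequentially by blast
  have "of_nat (f n) = poly [:of_nat (f N) :: rat:] (of_nat n)" if "n \<ge> N" for n
    using that
  proof (induction n rule: dec_induct)
    case (step n)
    then show ?case using N(1)[of "Suc n"] by simp
  qed simp
  then have "\<forall>\<^sub>F n in sequentially. of_nat (f n) = poly [:of_nat (f N) :: rat:] (of_nat n)"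
    unfolding eventually_sequentially by blast
  moreover have "degree [:of_nat (f N) :: rat:] = 0" "0 < lead_coeff [:of_nat (f N) :: rat:]"
    using N(2)[of N] by simp_all
  ultimately show ?thesis unfolding eventually_poly_def by blast
qed

section \<open>Polynomial growth of the counts\<close>

lemma core_count_shift_poly:
  assumes "eventually_poly (\<lambda>n. core_count (2 * n + \<epsilon>) s) d"
  shows "eventually_poly (\<lambda>n. core_count (2 * n + \<epsilon> - 2 * x) s) d"
proof (rule eventually_poly_cong)
  show "eventually_poly (\<lambda>n. core_count (2 * (n - x) + \<epsilon>) s) d"
    using eventually_poly_shift[OF assms, of x] .
  show "\<forall>\<^sub>F n in sequentially. core_count (2 * n + \<epsilon> - 2 * x) s = core_count (2 * (n - x) + \<epsilon>) s"
    unfolding eventually_sequentially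
  proof (intro exI[of _ x] allI impI)
    fix n assume "x \<le> n"
    then have "2 * n + \<epsilon> - 2 * x = 2 * (n - x) + \<epsilon>" by simp
    then show "core_count (2 * n + \<epsilon> - 2 * x) s = core_count (2 * (n - x) + \<epsilon>) s" by simp
  qed
qed

text \<open>
  Strong induction on \<open>t\<close>. The recursion writes the backward difference as a finite sum of shifted
  counts for smaller excess, all of degree at most \<open>(t - 2) div 2\<close>; for \<open>t < 2\<close> the sum is empty
  and the count is eventually constant.
\<close>

theorem core_count_eventually_poly:
  assumes \<epsilon>: "\<epsilon> \<in> {0, 1}"
  shows "eventually_poly (\<lambda>n. core_count (2 * n + \<epsilon>) t) (t div 2)"
proof (induction t rule: less_induct)
  case (less t)
  let ?f = "\<lambda>n. core_count (2 * n + \<epsilon>) t"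
  let ?A = "{(L, R) \<in> outers t. R \<noteq> [] \<and> last R = 1}"
  let ?B = "{(L, R) \<in> outers t. hd L = 1} - {([1], [])}"
  have fin: "finite ?A" "finite ?B"
    by (rule finite_subset[OF _ finite_outers[of t]]; auto)+
  have ex: "2 \<le> excess (fst p @ snd p)" "excess (fst p @ snd p) \<le> t" if "p \<in> ?A \<union> ?B" for p
  proof -
    obtain L R where p: "p = (L, R)" by fastforce
    show "2 \<le> excess (fst p @ snd p)"
      using that outers_last[of L R t] outers_hd[of L R t] unfolding p by auto
    show "excess (fst p @ snd p) \<le> t" using that unfolding p by (auto simp: outers_def)
  qed
  have rec: "\<forall>\<^sub>F n in sequentially. ?f n = ?f (n - 1) + (outer_sum ?A (2 * n + \<epsilon>) t + outer_sum ?B (2 * n + \<epsilon>) t)"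
    unfolding eventually_sequentially
  proof (intro exI[of _ "8 * t + 5"] allI impI)
    fix n assume "8 * t + 5 \<le> n"
    then have N: "8 * t + 4 < 2 * n + \<epsilon>" "2 * n + \<epsilon> - 2 = 2 * (n - 1) + \<epsilon>" by auto
    show "?f n = ?f (n - 1) + (outer_sum ?A (2 * n + \<epsilon>) t + outer_sum ?B (2 * n + \<epsilon>) t)"
      using core_count_rec[OF N(1)] unfolding N(2) by simp
  qed
  show ?case
  proof (cases "t < 2")
    case True
    then have "?A \<union> ?B = {}" using ex by fastforce
    then have A: "?A = {}" and B: "?B = {}" by blast+
    have "outer_sum {} m t = 0" for m by (simp add: outer_sum_def)
    then have "\<forall>\<^sub>F n in sequentially. ?f n = ?f (n - 1)"
      using rec unfolding A B by simp
    moreover have "\<forall>\<^sub>F n in sequentially. 0 < ?f n"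
      unfolding eventually_sequentially using core_count_pos[OF \<epsilon>, of t] True by (intro exI[of _ 2]) simp
    ultimately have "eventually_poly ?f 0" by (rule eventually_poly_const)
    then show ?thesis using True by simp
  next
    case False
    then have t: "t div 2 = Suc ((t - 2) div 2)" by presburger
    have summand: "\<exists>d\<le>(t - 2) div 2. eventually_poly (\<lambda>n. core_count (2 * n + \<epsilon> - 2 * sum_list (fst p)) (t - excess (fst p @ snd p))) d"
      if "p \<in> ?A \<union> ?B" for p
    proof (intro exI conjI)
      show "eventually_poly (\<lambda>n. core_count (2 * n + \<epsilon> - 2 * sum_list (fst p)) (t - excess (fst p @ snd p))) ((t - excess (fst p @ snd p)) div 2)"
        by (rule core_count_shift_poly[OF less.IH]) (use ex[OF that] in simp)
      show "(t - excess (fst p @ snd p)) div 2 \<le> (t - 2) div 2"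
        by (rule div_le_mono) (use ex[OF that] in simp)
    qed
    \<comment> \<open>This outer factor has excess 2 for every \<open>t \<ge> 2\<close>, so its summand has degree exactly
        \<open>(t - 2) div 2\<close> and the top degree is attained.\<close>
    define q where "q = ([1, 4 :: nat], [4 :: nat])"
    have q: "q \<in> ?B" using outers_14[of t] False by (simp add: q_def)
    have "excess (fst q @ snd q) = 2" by (simp add: q_def excess_def)
    then have "eventually_poly (\<lambda>n. core_count (2 * n + \<epsilon>) (t - excess (fst q @ snd q))) ((t - 2) div 2)"
      using less.IH[of "t - 2"] False by (simp only:)
    then have "eventually_poly (\<lambda>n. core_count (2 * n + \<epsilon> - 2 * sum_list (fst q)) (t - excess (fst q @ snd q))) ((t - 2) div 2)"
      by (rule core_count_shift_poly)
    then have "eventually_poly (\<lambda>n. \<Sum>p\<in>?B. core_count (2 * n + \<epsilon> - 2 * sum_list (fst p)) (t - excess (fst p @ snd p))) ((t - 2) div 2)"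
      by (rule eventually_poly_sum[OF fin(2) q]) (use summand in blast)
    then have B: "eventually_poly (\<lambda>n. outer_sum ?B (2 * n + \<epsilon>) t) ((t - 2) div 2)"
      by (simp add: outer_sum_def split_beta)
    have "eventually_poly (\<lambda>n. outer_sum ?A (2 * n + \<epsilon>) t + outer_sum ?B (2 * n + \<epsilon>) t) ((t - 2) div 2)"
    proof -
      \<comment> \<open>The whole sum over ?B enters as one further summand, indexed by None, of the top degree;
          so it does not matter whether ?A is empty.\<close>
      let ?g = "\<lambda>p n. case p of None \<Rightarrow> outer_sum ?B (2 * n + \<epsilon>) t
        | Some p \<Rightarrow> core_count (2 * n + \<epsilon> - 2 * sum_list (fst p)) (t - excess (fst p @ snd p))"
      have "eventually_poly (\<lambda>n. \<Sum>p\<in>insert None (Some ` ?A). ?g p n) ((t - 2) div 2)"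
      proof (rule eventually_poly_sum)
        show "finite (insert None (Some ` ?A))" using fin(1) by blast
        show "None \<in> insert None (Some ` ?A)" by simp
        show "eventually_poly (?g None) ((t - 2) div 2)" using B by simp
        fix q assume "q \<in> insert None (Some ` ?A)"
        then show "\<exists>d\<le>(t - 2) div 2. eventually_poly (?g q) d"
          using B summand by auto
      qed
      moreover have "(\<Sum>p\<in>insert None (Some ` ?A). ?g p n) = outer_sum ?A (2 * n + \<epsilon>) t + outer_sum ?B (2 * n + \<epsilon>) t" for n
        using fin(1) by (simp add: sum.reindex outer_sum_def split_beta)
      ultimately show ?thesis by simp
    qed
    then show ?thesis unfolding t by (rule eventually_poly_antidifference[OF rec])
  qed
qed

text \<open>
  The number of all paths is a sum of shifted core counts, the outer factor \<open>[1, 1]\<close> among them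
  having the top degree.
\<close>

theorem card_paths_eventually_poly:
  assumes \<epsilon>: "\<epsilon> \<in> {0, 1}"
  shows "eventually_poly (\<lambda>n. card (paths (2 * n + \<epsilon>) t)) (t div 2)"
proof (rule eventually_poly_cong)
  let ?g = "\<lambda>p n. core_count (2 * n + \<epsilon> - 2 * sum_list (fst p)) (t - excess (fst p @ snd p))"
  show "\<forall>\<^sub>F n in sequentially. card (paths (2 * n + \<epsilon>) t) = outer_sum (outers t) (2 * n + \<epsilon>) t + outer_sum (outers t) (2 * n + \<epsilon>) t"
    unfolding eventually_sequentially
    by (intro exI[of _ "8 * t + 5"] allI impI) (simp add: card_paths_rec)
  have "eventually_poly (\<lambda>n. \<Sum>p\<in>outers t. ?g p n) (t div 2)"
  proof (rule eventually_poly_sum[OF finite_outers outers_1])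
    show "eventually_poly (?g ([1], [])) (t div 2)"
      using core_count_shift_poly[OF core_count_eventually_poly[OF \<epsilon>, of t], of 1] by simp
    fix p assume "p \<in> outers t"
    show "\<exists>d\<le>t div 2. eventually_poly (?g p) d"
      using core_count_shift_poly[OF core_count_eventually_poly[OF \<epsilon>]] div_le_mono[OF diff_le_self] by blast
  qed
  then have "eventually_poly (\<lambda>n. outer_sum (outers t) (2 * n + \<epsilon>) t) (t div 2)"
    by (simp add: outer_sum_def split_beta)
  from eventually_poly_add[OF this this]
  show "eventually_poly (\<lambda>n. outer_sum (outers t) (2 * n + \<epsilon>) t + outer_sum (outers t) (2 * n + \<epsilon>) t) (t div 2)" by simp
qed

section \<open>Frobenius compositions\<close>

lemma frobenius_iff_path:
  fixes K :: "'k :: field_char_0 itself"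
  assumes "0 < n"
  shows "a \<in> frobenius_compositions K n \<longleftrightarrow> positive a \<and> sum_list a = n \<and> path_comp a"
proof -
  have "lie_index (parabolic K a) commutator_mat = 0 \<longleftrightarrow> path_comp a" if "sum_list a = n"
    using lie_index_eq_0_iff_rigid[of a n K] rigid_iff_meander_path[OF infinite_UNIV_char_0, of a "[n]" K] that assms
    unfolding path_comp_def by simp
  moreover have "a \<noteq> []" if "sum_list a = n" using that assms by auto
  ultimately show ?thesis unfolding frobenius_compositions_def compositions_def positive_def by auto
qed

text \<open>
  A path has exactly two odd parts, the part \<open>n\<close> of the second composition included.
\<close>

lemma path_length_excess:
  assumes "positive a" "path_comp a"
  shows "length a + excess a = sum_list a div 2 + 1"
  using sum_excess[OF assms(1)] path_comp_odd_parts[OF assms(2)] by (auto split: if_splits elim!: oddE evenE)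

theorem theorem5p5:
  fixes K :: "'k :: {alg_closed_field, field_char_0} itself"
  shows "(\<forall>p n :: nat. 0 < p \<longrightarrow> 0 < n \<longrightarrow> n div 2 + 1 < p \<longrightarrow>
            frobenius_compositions_parts K n p = {}) \<and>
         (\<forall>\<epsilon> \<in> {0, 1 :: nat}. \<forall>t :: nat. \<exists>P :: rat poly.
            degree P = t div 2 \<and> 0 < lead_coeff P \<and>
            (\<forall>\<^sub>F n in sequentially.
               of_nat (card (frobenius_compositions_parts K (2 * n + \<epsilon>) (n + 1 - t))) = poly P (of_nat n)))"
proof (intro conjI allI impI ballI)
  fix p n :: nat
  assume "0 < n" "n div 2 + 1 < p"
  have False if "a \<in> frobenius_compositions_parts K n p" for a
    using that frobenius_iff_path[OF \<open>0 < n\<close>, of a K] path_length_excess[of a] \<open>n div 2 + 1 < p\<close>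
    unfolding frobenius_compositions_parts_def by auto
  then show "frobenius_compositions_parts K n p = {}" by blast
next
  fix \<epsilon> t :: nat assume \<epsilon>: "\<epsilon> \<in> {0, 1}"
  have "eventually_poly (\<lambda>n. card (frobenius_compositions_parts K (2 * n + \<epsilon>) (n + 1 - t))) (t div 2)"
  proof (rule eventually_poly_cong[OF _ card_paths_eventually_poly[OF \<epsilon>]])
    show "\<forall>\<^sub>F n in sequentially. card (frobenius_compositions_parts K (2 * n + \<epsilon>) (n + 1 - t)) = card (paths (2 * n + \<epsilon>) t)"
      unfolding eventually_sequentially
    \<comment> \<open>for \<open>n < t\<close> the subtraction \<open>n + 1 - t\<close> no longer yields a positive number of parts\<close>
    proof (intro exI[of _ "t + 1"] allI impI)
      fix n assume n: "t + 1 \<le> n"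
      have "a \<in> frobenius_compositions_parts K (2 * n + \<epsilon>) (n + 1 - t) \<longleftrightarrow> a \<in> paths (2 * n + \<epsilon>) t" for a
      proof -
        have "length a = n + 1 - t \<longleftrightarrow> excess a = t"
          if "positive a" "path_comp a" "sum_list a = 2 * n + \<epsilon>"
          using path_length_excess[OF that(1,2)] that(3) n \<epsilon> by auto
        moreover have "0 < 2 * n + \<epsilon>" using n by simp
        ultimately show ?thesis
          unfolding frobenius_compositions_parts_def paths_def
          using frobenius_iff_path[of "2 * n + \<epsilon>" a K] by auto
      qed
      then show "card (frobenius_compositions_parts K (2 * n + \<epsilon>) (n + 1 - t)) = card (paths (2 * n + \<epsilon>) t)"
        by (intro arg_cong[where f = card]) blast
    qed
  qed
  then show "\<exists>P :: rat poly. degree P = t div 2 \<and> 0 < lead_coeff P \<and>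
      (\<forall>\<^sub>F n in sequentially. of_nat (card (frobenius_compositions_parts K (2 * n + \<epsilon>) (n + 1 - t))) = poly P (of_nat n))"
    unfolding eventually_poly_def .
qed

end
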